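(* Let $(M,d)$ be a proper geodesic $\delta$-hyperbolic space, $o\in M$, and assume that $G=\mathrm{Isom}(M)$ acts cocompactly on $M$. Let $\mu$ be a non-elementary probability measure on $G$ with bounded support $S$, and let $I_\mu$ be the rate function of the large deviation principle satisfied by the sequence $\frac1n\kappa(R_n)$. Then for every $t\in[0,\infty)$, $$I_\mu(t)\geq \frac{(t-\ell(\mu))^2}{\kappa_S^2\,D\left(\kappa_S,\|\lambda_G(\mu_{r,\mathrm{lazy}})\|_2\right)}$$ for every $r\in[0,1)$, where $$D(\kappa,\lambda)=32\left(16\ln^+(\kappa)+\tfrac{8A_0}{3}+33\right)^2\frac{1}{(1-\sqrt{\lambda})^4}\ \ (\lambda<1),\qquad D(\kappa,1)=\infty,$$ with $A_0=\left(\frac{\mu_G(B_{2R(\delta)+2D_0})}{\mu_G(B_{R(\delta)+D_0})}\right)^{1/2}$, $R(\delta)=14\delta+4$ and $D_0=2\,\mathrm{diam}(G\backslash M)$.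
   Context: A metric space $M$ is $\delta$-hyperbolic if $(x|y)_o\geq \min\{(x|z)_o,(z|y)_o\}-\delta$ for all $x,y,z,o\in M$, where $(x|y)_o=\frac12(d(x,o)+d(y,o)-d(x,y))$. An isometry $\gamma$ is loxodromic if $(\gamma^n x)_{n\in\mathbb{Z}}$ is a quasi-geodesic for any $x \in M$; it then fixes exactly two points of the Gromov boundary; two loxodromic elements are independent if their fixed point pairs are disjoint. $\mu$ is non-elementary if the semigroup generated by its support contains two independent loxodromic elements. $\mu_G$ is a Haar measure on the locally compact group $G$; $\kappa(g)=d(go,o)$; $\kappa_S=\sup_{g\in S}\kappa(g)$ and $S$ is bounded if $\kappa_S<\infty$; $B_R=\{g\in G:d(go,o)\leq R\}$; $\mathrm{diam}(G\backslash M)=\sup_{x,y\in M}\inf_{g\in G}d(gx,y)$; $\mu_{r,\mathrm{lazy}}=r\delta_{\mathrm{id}}+(1-r)\mu$; $\lambda_G(\mu)$ is the image of $\mu$ under the left-regular representation on $L^2(G)$ with operator norm $\|\cdot\|_2$; $\ln^+x=\max\{\ln x,0\}$. $(X_i)$ are i.i.d. with law $\mu$, $R_n=X_1\cdots X_n$, and $\ell(\mu)=\lim\frac1n\kappa(R_n)$ a.s. is the drift. It is known (Boulanger–Mathieu–Sert–Sisto) that $\frac1n\kappa(R_n)$ satisfies a large deviation principle with a proper convex rate function $I_\mu:[0,\infty)\to[0,+\infty]$: $I_\mu$ is lower semicontinuous and for every measurable $J\subset\mathbb{R}$, $$-\inf_{\alpha\in\mathrm{int}(J)}I_\mu(\alpha)\leq\liminf_{n\to\infty}\tfrac1n\ln\mathbb{P}\left(\tfrac{\kappa(R_n)}{n}\in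 J\right)\leq\limsup_{n\to\infty}\tfrac1n\ln\mathbb{P}\left(\tfrac{\kappa(R_n)}{n}\in J\right)\leq-\inf_{\alpha\in\overline{J}}I_\mu(\alpha),$$ where infima are over points in the domain $[0,\infty)$ of $I_\mu$. When $D=\infty$ the right-hand side of the lower bound is $0$. *)

theory Defs
  imports "HOL-Probability.Probability"
begin

definition gromov_product :: "'a::metric_space \<Rightarrow> 'a \<Rightarrow> 'a \<Rightarrow> real" where
  "gromov_product p x y = (dist x p + dist y p - dist x y) / 2"

definition hyperbolic_space :: "'a::metric_space itself \<Rightarrow> real \<Rightarrow> bool" where
  "hyperbolic_space _ \<delta> \<longleftrightarrow>
    (\<forall>x y z p :: 'a. gromov_product p x y \<ge> min (gromov_product p x z) (gromov_product p z y) - \<delta>)"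

definition geodesic_space :: "'a::metric_space itself \<Rightarrow> bool" where
  "geodesic_space _ \<longleftrightarrow>
    (\<forall>x y :: 'a. \<exists>c :: real \<Rightarrow> 'a. c 0 = x \<and> c (dist x y) = y \<and>
      (\<forall>s\<in>{0..dist x y}. \<forall>t\<in>{0..dist x y}. dist (c s) (c t) = \<bar>s - t\<bar>))"

definition proper_space :: "'a::metric_space itself \<Rightarrow> bool" where
  "proper_space _ \<longleftrightarrow> (\<forall>(x::'a) r. compact (cball x r))"

text \<open>
  The group law is composition. The topology is that of pointwise convergence, i.e. the subspace
  topology of the product topology on the type of all functions; on a group of isometries it
  coincides with the compact-open topology.
\<close>

definition isoms :: "('a::metric_space \<Rightarrow> 'a) set" where
  "isoms = {g. surj g \<and> (\<forall>x y. dist (g x) (g y) = dist x y)}"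

definition isom_borel :: "('a::metric_space \<Rightarrow> 'a) measure" where
  "isom_borel = restrict_space borel isoms"

definition cocompact_action :: "'a::metric_space itself \<Rightarrow> bool" where
  "cocompact_action _ \<longleftrightarrow> (\<exists>K :: 'a set. compact K \<and> (\<Union>g\<in>isoms. g ` K) = UNIV)"

text \<open>
  The supremum and infimum are those of \<^typ>\<open>real\<close>; the supremum is over a set that is
  bounded above as soon as the action is cocompact.
\<close>

definition quotient_diam :: "'a::metric_space itself \<Rightarrow> real" where
  "quotient_diam _ = (SUP (x :: 'a, y). INF g\<in>isoms. dist (g x) y)"

definition displacement :: "'a::metric_space \<Rightarrow> ('a \<Rightarrow> 'a) \<Rightarrow> real" where
  "displacement p g = dist (g p) p"

definition isom_ball :: "'a::metric_space \<Rightarrow> real \<Rightarrow> ('a \<Rightarrow> 'a) set" where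
  "isom_ball p R = {g \<in> isoms. displacement p g \<le> R}"

definition haar_measure :: "('a::metric_space \<Rightarrow> 'a) measure \<Rightarrow> bool" where
  "haar_measure m \<longleftrightarrow>
     sets m = sets isom_borel \<and>
     emeasure m (space m) \<noteq> 0 \<and>
     (\<forall>K. compact K \<and> K \<subseteq> isoms \<longrightarrow> emeasure m K < \<infinity>) \<and>
     (\<forall>A\<in>sets m. emeasure m A =
        (INF U\<in>{U. openin (top_of_set isoms) U \<and> A \<subseteq> U}. emeasure m U)) \<and>
     (\<forall>U. openin (top_of_set isoms) U \<longrightarrow>
        emeasure m U = (SUP K\<in>{K. compact K \<and> K \<subseteq> U}. emeasure m K)) \<and>
     (\<forall>g\<in>isoms. \<forall>A\<in>sets m. emeasure m ((\<lambda>h. g \<circ> h) ` A) = emeasure m A)"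

definition isom_power :: "('a \<Rightarrow> 'a) \<Rightarrow> int \<Rightarrow> 'a \<Rightarrow> 'a" where
  "isom_power g n = (if n \<ge> 0 then g ^^ nat n else inv g ^^ nat (- n))"

definition quasi_geodesic :: "(int \<Rightarrow> 'a::metric_space) \<Rightarrow> bool" where
  "quasi_geodesic c \<longleftrightarrow>
    (\<exists>L\<ge>1. \<exists>C\<ge>0. \<forall>m n.
       \<bar>of_int m - of_int n\<bar> / L - C \<le> dist (c m) (c n) \<and>
       dist (c m) (c n) \<le> L * \<bar>of_int m - of_int n\<bar> + C)"

definition loxodromic :: "('a::metric_space \<Rightarrow> 'a) \<Rightarrow> bool" where
  "loxodromic g \<longleftrightarrow> g \<in> isoms \<and> (\<forall>x. quasi_geodesic (\<lambda>n. isom_power g n x))"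

text \<open>
  Boundary points are classes of sequences converging to infinity. The base point \<open>p\<close> is only
  auxiliary: changing it alters Gromov products by a bounded amount.
\<close>

definition gromov_equiv :: "'a::metric_space \<Rightarrow> (nat \<Rightarrow> 'a) \<Rightarrow> (nat \<Rightarrow> 'a) \<Rightarrow> bool" where
  "gromov_equiv p s t \<longleftrightarrow>
     filterlim (\<lambda>(i, j). gromov_product p (s i) (t j)) at_top (sequentially \<times>\<^sub>F sequentially)"

definition gromov_sequences :: "'a::metric_space \<Rightarrow> (nat \<Rightarrow> 'a) set" where
  "gromov_sequences p = {s. gromov_equiv p s s}"

definition gromov_boundary :: "'a::metric_space \<Rightarrow> (nat \<Rightarrow> 'a) set set" where
  "gromov_boundary p = gromov_sequences p //
     {(s, t). s \<in> gromov_sequences p \<and> t \<in> gromov_sequences p \<and> gromov_equiv p s t}"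

definition boundary_act :: "('a \<Rightarrow> 'a) \<Rightarrow> (nat \<Rightarrow> 'a) set \<Rightarrow> (nat \<Rightarrow> 'a) set" where
  "boundary_act g \<xi> = (\<lambda>s. g \<circ> s) ` \<xi>"

definition boundary_fixpoints :: "'a::metric_space \<Rightarrow> ('a \<Rightarrow> 'a) \<Rightarrow> (nat \<Rightarrow> 'a) set set" where
  "boundary_fixpoints p g = {\<xi> \<in> gromov_boundary p. boundary_act g \<xi> = \<xi>}"

definition independent_loxodromics ::
    "'a::metric_space \<Rightarrow> ('a \<Rightarrow> 'a) \<Rightarrow> ('a \<Rightarrow> 'a) \<Rightarrow> bool" where
  "independent_loxodromics p g h \<longleftrightarrow>
     loxodromic g \<and> loxodromic h \<and> boundary_fixpoints p g \<inter> boundary_fixpoints p h = {}"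

definition isom_prob :: "('a::metric_space \<Rightarrow> 'a) measure \<Rightarrow> bool" where
  "isom_prob \<mu> \<longleftrightarrow> prob_space \<mu> \<and> sets \<mu> = sets isom_borel"

definition isom_support :: "('a::metric_space \<Rightarrow> 'a) measure \<Rightarrow> ('a \<Rightarrow> 'a) set" where
  "isom_support \<mu> =
     {g \<in> isoms. \<forall>U. openin (top_of_set isoms) U \<and> g \<in> U \<longrightarrow> emeasure \<mu> U > 0}"

inductive_set semigroup_span :: "('a \<Rightarrow> 'a) set \<Rightarrow> ('a \<Rightarrow> 'a) set" for S where
  incl: "g \<in> S \<Longrightarrow> g \<in> semigroup_span S"
| comp: "g \<in> semigroup_span S \<Longrightarrow> h \<in> semigroup_span S \<Longrightarrow> g \<circ> h \<in> semigroup_span S"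

definition non_elementary :: "'a::metric_space \<Rightarrow> ('a \<Rightarrow> 'a) measure \<Rightarrow> bool" where
  "non_elementary p \<mu> \<longleftrightarrow>
     (\<exists>g\<in>semigroup_span (isom_support \<mu>). \<exists>h\<in>semigroup_span (isom_support \<mu>).
        independent_loxodromics p g h)"

definition bounded_isoms :: "'a::metric_space \<Rightarrow> ('a \<Rightarrow> 'a) set \<Rightarrow> bool" where
  "bounded_isoms p S \<longleftrightarrow> bdd_above (displacement p ` S)"

definition max_displacement :: "'a::metric_space \<Rightarrow> ('a \<Rightarrow> 'a) set \<Rightarrow> real" where
  "max_displacement p S = (SUP g\<in>S. displacement p g)"

definition lazy :: "real \<Rightarrow> ('a::metric_space \<Rightarrow> 'a) measure \<Rightarrow> ('a \<Rightarrow> 'a) measure" where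
  "lazy r \<mu> = measure_of isoms (sets isom_borel)
     (\<lambda>A. ennreal r * indicator A id + ennreal (1 - r) * emeasure \<mu> A)"

text \<open>
  Square-integrable functions are not identified up to null sets; this does not affect norms.
\<close>

definition square_integrable :: "'b measure \<Rightarrow> ('b \<Rightarrow> complex) set" where
  "square_integrable m =
     {f \<in> borel_measurable m. integrable m (\<lambda>x. (cmod (f x))\<^sup>2)}"

definition norm_L2 :: "'b measure \<Rightarrow> ('b \<Rightarrow> complex) \<Rightarrow> real" where
  "norm_L2 m f = sqrt (\<integral>x. (cmod (f x))\<^sup>2 \<partial>m)"

definition left_regular :: "('a \<Rightarrow> 'a) \<Rightarrow> (('a \<Rightarrow> 'a) \<Rightarrow> complex) \<Rightarrow> ('a \<Rightarrow> 'a) \<Rightarrow> complex" where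
  "left_regular g f = (\<lambda>x. f (inv g \<circ> x))"

definition left_regular_measure ::
    "('a \<Rightarrow> 'a) measure \<Rightarrow> (('a \<Rightarrow> 'a) \<Rightarrow> complex) \<Rightarrow> ('a \<Rightarrow> 'a) \<Rightarrow> complex" where
  "left_regular_measure \<nu> f = (\<lambda>x. \<integral>g. left_regular g f x \<partial>\<nu>)"

text \<open>For a probability measure \<open>\<nu>\<close> the supremum is over a set bounded above by 1.\<close>

definition regular_norm :: "('a \<Rightarrow> 'a) measure \<Rightarrow> ('a \<Rightarrow> 'a) measure \<Rightarrow> real" where
  "regular_norm m \<nu> =
     (SUP f\<in>{f \<in> square_integrable m. norm_L2 m f \<le> 1}. norm_L2 m (left_regular_measure \<nu> f))"

primrec walk :: "(nat \<Rightarrow> 'w \<Rightarrow> 'a \<Rightarrow> 'a) \<Rightarrow> nat \<Rightarrow> 'w \<Rightarrow> 'a \<Rightarrow> 'a" where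
  "walk X 0 \<omega> = id"
| "walk X (Suc n) \<omega> = walk X n \<omega> \<circ> X (Suc n) \<omega>"

definition iid_isoms ::
    "'w measure \<Rightarrow> (nat \<Rightarrow> 'w \<Rightarrow> 'a::metric_space \<Rightarrow> 'a) \<Rightarrow> ('a \<Rightarrow> 'a) measure \<Rightarrow> bool" where
  "iid_isoms P X \<mu> \<longleftrightarrow>
     prob_space P \<and>
     prob_space.indep_vars P (\<lambda>_. isom_borel) X {1..} \<and>
     (\<forall>i\<ge>1. distr P isom_borel (X i) = \<mu>)"

definition ereal_ln :: "real \<Rightarrow> ereal" where
  "ereal_ln x = (if x \<le> 0 then -\<infinity> else ereal (ln x))"

text \<open>
  A rate function on \<open>[0,\<infinity>)\<close> is represented by a function on \<^typ>\<open>real\<close> of which only the values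
  on \<open>{0..}\<close> matter; infima over the empty set are \<open>\<infinity>\<close>. Properness means compactness of the
  sublevel sets.
\<close>

definition proper_convex_rate_function :: "(real \<Rightarrow> ereal) \<Rightarrow> bool" where
  "proper_convex_rate_function I \<longleftrightarrow>
     (\<forall>x\<ge>0. I x \<ge> 0) \<and>
     (\<forall>c. closed {x. x \<ge> 0 \<and> I x \<le> c}) \<and>
     (\<forall>c::real. compact {x. x \<ge> 0 \<and> I x \<le> ereal c}) \<and>
     (\<forall>x\<ge>0. \<forall>y\<ge>0. \<forall>u\<in>{0..1}.
        I ((1 - u) * x + u * y) \<le> ereal (1 - u) * I x + ereal u * I y)"

definition satisfies_LDP ::
    "'w measure \<Rightarrow> (nat \<Rightarrow> 'w \<Rightarrow> real) \<Rightarrow> (real \<Rightarrow> ereal) \<Rightarrow> bool" where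
  "satisfies_LDP P Z I \<longleftrightarrow>
     (\<forall>J\<in>sets (borel :: real measure).
        - (INF \<alpha>\<in>interior J \<inter> {0..}. I \<alpha>)
          \<le> liminf (\<lambda>n. ereal (1 / real n) * ereal_ln (measure P {\<omega> \<in> space P. Z n \<omega> \<in> J})) \<and>
        limsup (\<lambda>n. ereal (1 / real n) * ereal_ln (measure P {\<omega> \<in> space P. Z n \<omega> \<in> J}))
          \<le> - (INF \<alpha>\<in>closure J \<inter> {0..}. I \<alpha>))"

definition ln_plus :: "real \<Rightarrow> real" where
  "ln_plus x = max (ln x) 0"

definition hyp_radius :: "real \<Rightarrow> real" where
  "hyp_radius \<delta> = 14 * \<delta> + 4"

definition volume_ratio ::
    "('a::metric_space \<Rightarrow> 'a) measure \<Rightarrow> 'a \<Rightarrow> real \<Rightarrow> real \<Rightarrow> real" where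
  "volume_ratio m p R D\<^sub>0 =
     (measure m (isom_ball p (2 * R + 2 * D\<^sub>0)) / measure m (isom_ball p (R + D\<^sub>0))) powr (1 / 2)"

definition deviation_const :: "real \<Rightarrow> real \<Rightarrow> real \<Rightarrow> ereal" where
  "deviation_const A\<^sub>0 \<kappa> \<rho> =
     (if \<rho> < 1
      then ereal (32 * (16 * ln_plus \<kappa> + 8 * A\<^sub>0 / 3 + 33)\<^sup>2 * (1 / (1 - sqrt \<rho>) ^ 4))
      else \<infinity>)"

end

theory Submission
  imports Defs
begin

text \<open>
  Let \<open>\<eta>\<close> be the law of the walk at an independent geometric time with parameter \<open>\<theta>\<close>. The function
  \<open>\<psi> g = \<kappa> g - 2 c g\<close>, where \<open>c g\<close> is the \<open>\<eta>\<close>-mean of the Gromov product of \<open>inv g p\<close> and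
  \<open>h p\<close>, has along the walk a drift that is constant up to \<open>2 c (1 / \<theta> - 1)\<close>, and its conditional
  increments range over an interval of length \<open>2 \<kappa> + 2 sup c\<close>. Hoeffding's lemma then gives
  Gaussian deviation bounds for \<open>\<kappa>\<close>, provided that \<open>c\<close> is bounded uniformly in \<open>\<theta> < 1\<close>.

  For this bound, let the Gromov product of \<open>y\<close> and \<open>h p\<close> exceed \<open>\<kappa> N + \<delta>\<close>. By memorylessness one may
  insert \<open>N\<close> lazy steps before \<open>h\<close>. After these steps the walk is still within \<open>\<kappa> N\<close> of \<open>p\<close>, so the
  geodesic to its final position passes near the point \<open>q\<close> at distance \<open>\<kappa> N\<close> from \<open>p\<close> on a geodesic
  to \<open>y\<close>, and it does so at distance at most \<open>2 \<kappa> N\<close> from its starting point. For each of these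
  positions the waypoint on the remaining geodesic is independent of the \<open>N\<close> steps, and the norm of
  the regular representation bounds the probability of being near \<open>q\<close> by \<open>A\<^sub>0 \<lambda>\<^sup>N\<close>. Hence the tail is at
  most \<open>(2 \<kappa> N + 1) A\<^sub>0 \<lambda>\<^sup>N\<close>, which is summable with a sum of order \<open>ln \<kappa> + ln A\<^sub>0\<close>.
\<close>

subsection \<open>Measurability on the group of isometries\<close>

text \<open>The model for \<open>\<psi>\<close> is a Busemann-type cocycle averaged over a
  stationary measure on the boundary, whose drift is exactly constant. The geometric law
  \<open>\<eta>\<close> stands in for that measure: it lives on the group itself and is the mixture
  of the identity, with weight \<open>1 - \<theta>\<close>, and of one step of the walk followed by
  \<open>\<eta>\<close>, with weight \<open>\<theta>\<close>. No boundary limit has to be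
  constructed; the price is an error proportional to \<open>1 / \<theta> - 1\<close>, which
  disappears when \<open>\<theta>\<close> tends to 1 at the very end. The powers of
  \<open>1 - sqrt \<lambda>\<close> arise as follows. Half of the decay \<lambda>^N is spent on the
  linear number of positions, so that the remaining series has ratio \<open>sqrt \<lambda>\<close>;
  the logarithm of its prefactor costs up to a further 1 / (1 - sqrt \<lambda>); and the range of
  the increments, then of order 1 / (1 - sqrt \<lambda>)^2, enters Hoeffding's lemma squared. The
  final constant contains \<delta> only through the volume ratio, so the additive \<delta> in the
  threshold of the tail must itself be bounded by a multiple of \<kappa>.\<close>

locale separable_metric =
  fixes w :: "nat \<Rightarrow> 'a::metric_space"
  assumes dense: "e > 0 \<Longrightarrow> \<exists>i. dist (w i) x < e"

text \<open>Closed balls are totally bounded, so finite nets of mesh 1 / Suc j in the balls of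
  radius n form a countable dense set. A fixed dense sequence takes the place of a
  second-countability assumption on the type, and all measurability arguments refer to it.\<close>

lemma proper_space_separable:
  assumes "proper_space TYPE('a::metric_space)"
  shows "\<exists>w :: nat \<Rightarrow> 'a. separable_metric w"
proof -
  fix o' :: 'a
  have "\<exists>k. finite k \<and> k \<subseteq> cball o' (real n) \<and> cball o' (real n) \<subseteq> (\<Union>x\<in>k. ball x (1 / Suc j))" for n j :: nat
    using assms seq_compact_imp_totally_bounded[of "cball o' (real n)"]
    unfolding proper_space_def compact_eq_seq_compact_metric by simp
  then obtain F where F: "\<And>n j. finite (F n j)"
      "\<And>n j. cball o' (real n) \<subseteq> (\<Union>x\<in>F n j. ball x (1 / Suc j))"
    by metis
  define Q where "Q = (\<Union>n j. F n j)"
  have "countable Q"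
    unfolding Q_def using F(1) by (simp add: countable_finite)
  have dense: "\<exists>q\<in>Q. dist q x < e" if "e > 0" for x e
  proof -
    obtain n where n: "dist o' x \<le> real n" using real_arch_simple by blast
    obtain j where j: "1 / Suc j < e" using nat_approx_posE[OF \<open>e > 0\<close>] by blast
    from n F(2)[of n j] obtain q where "q \<in> F n j" "dist q x < 1 / Suc j" by auto
    with j show ?thesis unfolding Q_def by force
  qed
  have "Q \<noteq> {}" using dense[of 1] by auto
  show ?thesis
  proof (intro exI[of _ "from_nat_into Q"] separable_metric.intro)
    fix e :: real and x assume "e > 0"
    with dense obtain q where "q \<in> Q" "dist q x < e" by blast
    then show "\<exists>i. dist (from_nat_into Q i) x < e"
      using from_nat_into_surj[OF \<open>countable Q\<close>] by metis
  qed
qed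

context separable_metric
begin

text \<open>Balls around the \<open>w i\<close> with radii 1 / Suc n form a countable base, so the
  distances to the \<open>w i\<close> generate the Borel sets.\<close>

lemma borel_measurable_metricI:
  assumes "\<And>i. (\<lambda>x. dist (f x) (w i)) \<in> borel_measurable N"
  shows "f \<in> measurable N borel"
proof (rule borel_measurableI)
  fix S :: "'a set" assume "open S"
  define J where "J = {t. ball (w (fst t)) (1 / Suc (snd t)) \<subseteq> S}"
  have "\<exists>t\<in>J. x \<in> ball (w (fst t)) (1 / Suc (snd t))" if x: "x \<in> S" for x
  proof -
    obtain e where e: "e > 0" "ball x e \<subseteq> S" using \<open>open S\<close> x unfolding open_contains_ball by blast
    obtain n where n: "1 / Suc n < e / 2" using e nat_approx_posE[of "e/2"] by auto
    obtain i where i: "dist (w i) x < 1 / Suc n" using dense[of "1 / Suc n" x] by auto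
    have "ball (w i) (1 / Suc n) \<subseteq> ball x e"
    proof
      fix y assume "y \<in> ball (w i) (1 / Suc n)"
      then have "dist x y < 1 / Suc n + 1 / Suc n"
        using i dist_triangle[of x y "w i"] by (simp add: dist_commute)
      with n show "y \<in> ball x e" by simp
    qed
    with e(2) have "ball (w i) (1 / Suc n) \<subseteq> S" by blast
    then have "(i, n) \<in> J" by (simp add: J_def del: of_nat_Suc)
    with i show ?thesis by (intro bexI[of _ "(i, n)"]) simp_all
  qed
  then have "S = (\<Union>t\<in>J. ball (w (fst t)) (1 / Suc (snd t)))" unfolding J_def by blast
  then have "f -` S \<inter> space N = (\<Union>t\<in>J. f -` ball (w (fst t)) (1 / Suc (snd t)) \<inter> space N)"
    by blast
  also have "f -` ball (w i) e \<inter> space N = {x \<in> space N. dist (f x) (w i) < e}" for i e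
    by (auto simp: dist_commute)
  then have "(\<Union>t\<in>J. f -` ball (w (fst t)) (1 / Suc (snd t)) \<inter> space N) \<in> sets N"
    using assms by (intro sets.countable_UN') (auto intro!: borel_measurable_less)
  finally show "f -` S \<inter> space N \<in> sets N" .
qed

lemma borel_measurable_dist_sep:
  fixes f g :: "'b \<Rightarrow> 'a"
  assumes f: "f \<in> measurable N borel" and g: "g \<in> measurable N borel"
  shows "(\<lambda>x. dist (f x) (g x)) \<in> borel_measurable N"
proof -
  have c: "(\<lambda>x. dist x (w i)) \<in> borel_measurable borel" for i
    by (intro borel_measurable_continuous_onI continuous_intros)
  have [measurable]: "(\<lambda>x. dist (f x) (w i)) \<in> borel_measurable N"
      "(\<lambda>x. dist (g x) (w i)) \<in> borel_measurable N" for i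
    using measurable_compose[OF f c] measurable_compose[OF g c] by auto
  \<comment> \<open>A countable infimum of sums in which \<open>f\<close> and \<open>g\<close>
    appear separately, so that measurability of the distance on a product space is not called
    upon.\<close>
  have "dist (f x) (g x) = (INF i. dist (f x) (w i) + dist (g x) (w i))" for x
  proof (rule antisym)
    show "dist (f x) (g x) \<le> (INF i. dist (f x) (w i) + dist (g x) (w i))"
      by (rule cINF_greatest) (auto simp: dist_triangle2)
    show "(INF i. dist (f x) (w i) + dist (g x) (w i)) \<le> dist (f x) (g x)"
    proof (rule field_le_epsilon)
      fix e :: real assume "e > 0"
      then obtain i where i: "dist (w i) (g x) < e / 2" using dense[of "e/2" "g x"] by auto
      have "(INF i. dist (f x) (w i) + dist (g x) (w i)) \<le> dist (f x) (w i) + dist (g x) (w i)"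
        by (rule cINF_lower) (auto intro!: bdd_belowI2[where m = 0])
      also have "\<dots> \<le> dist (f x) (g x) + e"
        using i dist_triangle[of "f x" "w i" "g x"] by (simp add: dist_commute)
      finally show "(INF i. dist (f x) (w i) + dist (g x) (w i)) \<le> dist (f x) (g x) + e" .
    qed
  qed
  moreover have "(\<lambda>x. INF i\<in>UNIV. dist (f x) (w i) + dist (g x) (w i)) \<in> borel_measurable N"
    by (rule borel_measurable_cINF) (auto intro!: bdd_belowI2[where m = 0])
  ultimately show ?thesis by simp
qed

text \<open>Lists of triples of naturals are countable, so these cylinders give a countable base of
  the topology of pointwise convergence on \<open>isoms\<close>.\<close>

definition cyl :: "(nat \<times> nat \<times> nat) list \<Rightarrow> ('a \<Rightarrow> 'a) set" where
  "cyl l = {g \<in> isoms. \<forall>(i, j, n)\<in>set l. dist (g (w i)) (w j) < 1 / Suc n}"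

text \<open>A basic neighbourhood restricts finitely many values \<open>g x\<close>. Isometries are
  1-Lipschitz, so a condition at x may be replaced by one at a nearby \<open>w i\<close>, with the
  target approximated by some \<open>w j\<close>.\<close>

lemma cyl_base:
  assumes U: "openin (top_of_set isoms) U" and g: "g \<in> U"
  shows "\<exists>l. g \<in> cyl l \<and> cyl l \<subseteq> U"
proof -
  obtain T where T: "open T" "U = isoms \<inter> T" using U by (auto simp: openin_open)
  have "openin (product_topology (\<lambda>_. euclidean) UNIV) T" using T(1) by (simp add: open_fun_def)
  moreover have "g \<in> T" using g T by auto
  ultimately obtain V where V: "g \<in> (\<Pi>\<^sub>E x\<in>UNIV. V x)" "\<And>x. open (V x)"
      "finite {x. V x \<noteq> UNIV}" "(\<Pi>\<^sub>E x\<in>UNIV. V x) \<subseteq> T"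
    using product_topology_open_contains_basis[of "\<lambda>_. euclidean" UNIV T g] by auto
  define X where "X = {x. V x \<noteq> UNIV}"
  have gi: "g \<in> isoms" using g T by auto
  have "\<exists>t. \<forall>h\<in>isoms. (case t of (i, j, n) \<Rightarrow> dist (g (w i)) (w j) < 1 / Suc n \<and>
      (dist (h (w i)) (w j) < 1 / Suc n \<longrightarrow> h x \<in> V x))" for x
  proof -
    have "g x \<in> V x" using V(1) by auto
    then obtain e where e: "e > 0" "ball (g x) e \<subseteq> V x" using V(2)[of x] unfolding open_contains_ball by blast
    \<comment> \<open>Four errors add up between \<open>g x\<close> and \<open>h x\<close>:
      replacing x by \<open>w i\<close> for both maps, and comparing both images with
      \<open>w j\<close>.\<close>
    obtain n where n: "1 / Suc n < e / 4" using e nat_approx_posE[of "e/4"] by auto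
    obtain i where i: "dist (w i) x < 1 / Suc n" using dense[of "1 / Suc n" x] by auto
    obtain j where j: "dist (w j) (g (w i)) < 1 / Suc n" using dense[of "1 / Suc n" "g (w i)"] by auto
    have "h x \<in> V x" if "h \<in> isoms" "dist (h (w i)) (w j) < 1 / Suc n" for h
    proof -
      have "dist (h x) (h (w i)) < 1 / Suc n" "dist (g x) (g (w i)) < 1 / Suc n"
        using that(1) gi i by (auto simp: isoms_def dist_commute)
      then have "dist (g x) (h x) < e"
        using that(2) j n dist_triangle[of "g x" "h x" "g (w i)"]
          dist_triangle[of "g (w i)" "h x" "w j"] dist_triangle[of "w j" "h x" "h (w i)"]
        by (simp add: dist_commute)
      with e show ?thesis by auto
    qed
    with j show ?thesis by (intro exI[of _ "(i, j, n)"]) (auto simp: dist_commute)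
  qed
  then have "\<exists>t. \<forall>x. \<forall>h\<in>isoms. (case t x of (i, j, n) \<Rightarrow> dist (g (w i)) (w j) < 1 / Suc n \<and>
      (dist (h (w i)) (w j) < 1 / Suc n \<longrightarrow> h x \<in> V x))"
    by (intro choice allI)
  then obtain t where t': "\<forall>x. \<forall>h\<in>isoms. (case t x of (i, j, n) \<Rightarrow> dist (g (w i)) (w j) < 1 / Suc n \<and>
      (dist (h (w i)) (w j) < 1 / Suc n \<longrightarrow> h x \<in> V x))" ..
  have t: "case t x of (i, j, n) \<Rightarrow> dist (g (w i)) (w j) < 1 / Suc n \<and>
      (dist (h (w i)) (w j) < 1 / Suc n \<longrightarrow> h x \<in> V x)" if "h \<in> isoms" for x h
    by (rule bspec[OF spec[OF t'] that])
  obtain xs where xs: "set xs = X" using finite_list[OF V(3)] unfolding X_def by blast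
  have "case t x of (i, j, n) \<Rightarrow> dist (g (w i)) (w j) < 1 / Suc n" for x
    using t[OF gi, of x] by (auto split: prod.splits)
  with gi have "g \<in> cyl (map t xs)"
    unfolding cyl_def by (auto simp del: of_nat_Suc)
  moreover have "cyl (map t xs) \<subseteq> U"
  proof
    fix h assume h: "h \<in> cyl (map t xs)"
    then have hi: "h \<in> isoms" by (auto simp: cyl_def)
    have "h x \<in> V x" for x
    proof (cases "x \<in> X")
      case True
      obtain i j n where ijn: "t x = (i, j, n)" by (metis prod_cases3)
      have "(i, j, n) \<in> set (map t xs)" using True xs ijn by force
      then have "dist (h (w i)) (w j) < 1 / Suc n" using h unfolding cyl_def by auto
      with t[OF hi, of x] ijn show ?thesis by auto
    qed (auto simp: X_def)
    then have "h \<in> T" using V(4) by auto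
    with hi T show "h \<in> U" by auto
  qed
  ultimately show ?thesis by blast
qed

lemma space_isom_borel [simp]: "space isom_borel = isoms"
  by (simp add: isom_borel_def space_restrict_space)

lemma sets_isom_borel_open:
  assumes "openin (top_of_set isoms) U" shows "U \<in> sets isom_borel"
proof -
  obtain T where T: "open T" "U = isoms \<inter> T" using assms unfolding openin_open by blast
  show ?thesis
    unfolding isom_borel_def sets_restrict_space T(2) by (intro imageI borel_open T)
qed

lemma measurable_isom_eval: "(\<lambda>g. g x) \<in> measurable isom_borel borel"
  unfolding isom_borel_def
  by (intro measurable_restrict_space1 borel_measurable_continuous_onI continuous_on_product_coordinates)

lemma open_isoms_countable_cyl:
  assumes "openin (top_of_set isoms) U"
  shows "U = (\<Union>l\<in>{l. cyl l \<subseteq> U}. cyl l)"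
proof (intro antisym subsetI)
  fix g assume "g \<in> U"
  then obtain l where l: "g \<in> cyl l" "cyl l \<subseteq> U" using cyl_base[OF assms] by blast
  show "g \<in> (\<Union>l\<in>{l. cyl l \<subseteq> U}. cyl l)"
    by (rule UN_I[of l]) (use l in simp_all)
next
  fix g assume "g \<in> (\<Union>l\<in>{l. cyl l \<subseteq> U}. cyl l)"
  then show "g \<in> U" by auto
qed

text \<open>By the countable base of cylinders, the Borel sets of the group are generated by the
  evaluations at the \<open>w i\<close>.\<close>

lemma measurable_isom_borelI:
  assumes "\<And>x. x \<in> space N \<Longrightarrow> f x \<in> isoms"
    and ev: "\<And>i. (\<lambda>x. f x (w i)) \<in> measurable N borel"
  shows "f \<in> measurable N isom_borel"
proof -
  have c: "(\<lambda>x. dist x (w i)) \<in> borel_measurable borel" for i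
    by (intro borel_measurable_continuous_onI continuous_intros)
  have [measurable]: "(\<lambda>x. dist (f x (w i)) (w j)) \<in> borel_measurable N" for i j
    using measurable_compose[OF ev c] by simp
  have cyl: "f -` cyl l \<inter> space N \<in> sets N" for l
  proof -
    have "f -` cyl l \<inter> space N =
        space N \<inter> {x \<in> space N. \<forall>(i, j, n)\<in>set l. dist (f x (w i)) (w j) < 1 / Suc n}"
      using assms(1) by (auto simp: cyl_def)
    also have "\<dots> \<in> sets N"
      by (intro sets.Int sets.top sets.sets_Collect_finite_All) (auto split: prod.splits)
    finally show ?thesis .
  qed
  show ?thesis
    unfolding isom_borel_def
  proof (rule measurable_restrict_space2)
    show "f \<in> space N \<rightarrow> isoms" using assms(1) by auto
    show "f \<in> borel_measurable N"
    proof (rule borel_measurableI)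
      fix S :: "('a \<Rightarrow> 'a) set" assume "open S"
      then have "openin (top_of_set isoms) (isoms \<inter> S)" by (auto simp: openin_open)
      from open_isoms_countable_cyl[OF this]
      have eq: "isoms \<inter> S = (\<Union>l\<in>{l. cyl l \<subseteq> isoms \<inter> S}. cyl l)" .
      have "f -` S \<inter> space N = f -` (isoms \<inter> S) \<inter> space N" using assms(1) by auto
      also have "\<dots> = (\<Union>l\<in>{l. cyl l \<subseteq> isoms \<inter> S}. f -` cyl l \<inter> space N)"
        using arg_cong[OF eq, of "\<lambda>A. f -` A \<inter> space N"] by (simp only: vimage_UN Int_UN_distrib2 UN_simps)
      also have "\<dots> \<in> sets N" using cyl by (intro sets.countable_UN') auto
      finally show "f -` S \<inter> space N \<in> sets N" .
    qed
  qed
qed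

end

section \<open>Algebra of the isometry group\<close>

lemma isoms_bij:
  assumes "g \<in> isoms" shows "bij g"
proof -
  have "x = y" if "g x = g y" for x y
  proof -
    have "dist x y = dist (g x) (g y)" using assms by (simp add: isoms_def)
    with that show ?thesis by simp
  qed
  then show ?thesis using assms by (auto simp: isoms_def bij_def inj_on_def)
qed

lemma isoms_dist: "g \<in> isoms \<Longrightarrow> dist (g x) (g y) = dist x y"
  by (simp add: isoms_def)

lemma isoms_id [simp]: "id \<in> isoms"
  by (auto simp: isoms_def)

lemma isoms_comp: "g \<in> isoms \<Longrightarrow> h \<in> isoms \<Longrightarrow> g \<circ> h \<in> isoms"
  unfolding isoms_def using comp_surj[of h g] by simp

lemma isoms_inv_apply:
  assumes "g \<in> isoms" shows "inv g (g x) = x" "g (inv g x) = x"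
  using isoms_bij[OF assms] by (auto simp: bij_def surj_f_inv_f)

lemma isoms_inv_comp:
  assumes "g \<in> isoms" shows "inv g \<circ> g = id" "g \<circ> inv g = id"
  using isoms_inv_apply[OF assms] by auto

lemma isoms_dist_inv:
  assumes "g \<in> isoms" shows "dist (inv g x) y = dist x (g y)"
  using isoms_dist[OF assms, of "inv g x" y] by (simp add: isoms_inv_apply[OF assms])

lemma isoms_dist_inv':
  assumes "g \<in> isoms" shows "dist x (inv g y) = dist (g x) y"
  using isoms_dist_inv[OF assms, of y x] by (simp add: dist_commute)

lemma isoms_inv:
  assumes "g \<in> isoms" shows "inv g \<in> isoms"
proof -
  have "dist (inv g x) (inv g y) = dist x y" for x y
    using assms by (simp add: isoms_dist_inv isoms_inv_apply)
  moreover have "surj (inv g)" using isoms_bij[OF assms] by (simp add: bij_imp_bij_inv bij_is_surj)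
  ultimately show ?thesis by (auto simp: isoms_def)
qed

context separable_metric
begin

lemma measurable_eval_isom:
  fixes f g :: "'b \<Rightarrow> 'a \<Rightarrow> 'a"
  assumes "f \<in> measurable N isom_borel"
  shows "(\<lambda>x. f x y) \<in> measurable N borel"
  by (rule measurable_compose[OF assms measurable_isom_eval])

lemma measurable_space_isom:
  "f \<in> measurable N isom_borel \<Longrightarrow> x \<in> space N \<Longrightarrow> f x \<in> isoms"
  using measurable_space[of f N isom_borel x] by simp

text \<open>The inverse moves to the other side of the distance,
  \<open>dist (inv g x) y = dist x (g y)\<close>, which reduces the claim to evaluations of
  \<open>f\<close>.\<close>

lemma measurable_inv_isom [measurable (raw)]:
  fixes f :: "'b \<Rightarrow> 'a \<Rightarrow> 'a"
  assumes f: "f \<in> measurable N isom_borel"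
  shows "(\<lambda>x. inv (f x)) \<in> measurable N isom_borel"
proof (rule measurable_isom_borelI)
  show "inv (f x) \<in> isoms" if "x \<in> space N" for x
    by (rule isoms_inv[OF measurable_space_isom[OF f that]])
  fix i
  show "(\<lambda>x. inv (f x) (w i)) \<in> borel_measurable N"
  proof (rule borel_measurable_metricI)
    fix j
    have "(\<lambda>x. dist (w i) (f x (w j))) \<in> borel_measurable N"
      by (rule borel_measurable_dist_sep[OF measurable_const measurable_eval_isom[OF f]]) simp
    then show "(\<lambda>x. dist (inv (f x) (w i)) (w j)) \<in> borel_measurable N"
      by (rule measurable_cong[THEN iffD1, rotated])
         (simp add: isoms_dist_inv measurable_space_isom[OF f])
  qed
qed

text \<open>Moving \<open>f\<close> to the other side leaves a distance between two evaluations,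
  each of which involves only one of the two maps.\<close>

lemma measurable_comp_isom [measurable (raw)]:
  fixes f :: "'b \<Rightarrow> 'a \<Rightarrow> 'a"
  assumes f: "f \<in> measurable N isom_borel" and g: "g \<in> measurable N isom_borel"
  shows "(\<lambda>x. f x \<circ> g x) \<in> measurable N isom_borel"
proof (rule measurable_isom_borelI)
  show "f x \<circ> g x \<in> isoms" if "x \<in> space N" for x
    by (rule isoms_comp[OF measurable_space_isom[OF f that] measurable_space_isom[OF g that]])
  fix i
  show "(\<lambda>x. (f x \<circ> g x) (w i)) \<in> borel_measurable N"
  proof (rule borel_measurable_metricI)
    fix j
    have "(\<lambda>x. dist (g x (w i)) (inv (f x) (w j))) \<in> borel_measurable N"
      by (rule borel_measurable_dist_sep[OF measurable_eval_isom[OF g]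
            measurable_eval_isom[OF measurable_inv_isom[OF f]]])
    then show "(\<lambda>x. dist ((f x \<circ> g x) (w i)) (w j)) \<in> borel_measurable N"
      by (rule measurable_cong[THEN iffD1, rotated])
         (simp add: isoms_dist_inv' measurable_space_isom[OF f])
  qed
qed

lemma borel_measurable_dist_isom [measurable (raw)]:
  fixes f g :: "'b \<Rightarrow> 'a \<Rightarrow> 'a"
  assumes "f \<in> measurable N isom_borel" "g \<in> measurable N isom_borel"
  shows "(\<lambda>x. dist (f x y) (g x z)) \<in> borel_measurable N"
  by (intro borel_measurable_dist_sep measurable_eval_isom assms)

lemma borel_measurable_displacement [measurable]:
  fixes p :: 'a
  shows "displacement p \<in> borel_measurable isom_borel"
proof -
  have "(\<lambda>g. dist (g p) p) \<in> borel_measurable isom_borel"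
    by (intro borel_measurable_dist_sep measurable_isom_eval) auto
  then show ?thesis unfolding displacement_def[abs_def] .
qed

lemma isom_ball_sets [measurable]:
  fixes p :: 'a
  shows "isom_ball p R \<in> sets isom_borel"
proof -
  have "{g \<in> space isom_borel. displacement p g \<le> R} \<in> sets isom_borel" by measurable
  then show ?thesis by (simp add: isom_ball_def)
qed

text \<open>Each point outside the support has a null neighbourhood, hence lies in a null cylinder,
  and there are only countably many cylinders.\<close>

lemma AE_support:
  fixes \<mu> :: "('a \<Rightarrow> 'a) measure"
  assumes "isom_prob \<mu>"
  shows "AE g in \<mu>. g \<in> isom_support \<mu>"
proof -
  have s: "sets \<mu> = sets isom_borel" using assms by (simp add: isom_prob_def)
  then have sp: "space \<mu> = isoms" using sets_eq_imp_space_eq[OF s] by simp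
  define Z where "Z = {l. emeasure \<mu> (cyl l) = 0}"
  have cyl: "cyl l \<in> sets \<mu>" for l
  proof -
    have "{g \<in> space isom_borel. \<forall>(i, j, n)\<in>set l. dist (g (w i)) (w j) < 1 / Suc n} \<in> sets isom_borel"
    proof (rule sets.sets_Collect_finite_All)
      fix t assume "t \<in> set l"
      have [measurable]: "(\<lambda>g. dist (g (w i)) (w j)) \<in> borel_measurable isom_borel" for i j
        by (intro borel_measurable_dist_sep measurable_isom_eval) auto
      show "{g \<in> space isom_borel. case t of (i, j, n) \<Rightarrow> dist (g (w i)) (w j) < 1 / Suc n} \<in> sets isom_borel"
        by (cases t) (auto simp del: space_isom_borel of_nat_Suc intro!: borel_measurable_less)
    qed auto
    then show ?thesis by (simp add: cyl_def s)
  qed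
  have "(\<Union>l\<in>Z. cyl l) \<in> null_sets \<mu>"
    by (intro null_sets_UN') (auto simp: Z_def null_sets_def cyl)
  moreover have "{g \<in> space \<mu>. g \<notin> isom_support \<mu>} \<subseteq> (\<Union>l\<in>Z. cyl l)"
  proof safe
    fix g assume g: "g \<in> space \<mu>" "g \<notin> isom_support \<mu>"
    then obtain U where U: "openin (top_of_set isoms) U" "g \<in> U" "emeasure \<mu> U = 0"
      using sp by (auto simp: isom_support_def)
    from cyl_base[OF U(1,2)] obtain l where l: "g \<in> cyl l" "cyl l \<subseteq> U" by auto
    have "emeasure \<mu> (cyl l) \<le> emeasure \<mu> U"
      using l U(1) by (intro emeasure_mono) (auto simp: s sets_isom_borel_open)
    with U l show "g \<in> (\<Union>l\<in>Z. cyl l)" by (auto simp: Z_def)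
  qed
  ultimately show ?thesis by (rule AE_I')
qed

end

subsection \<open>Convolution\<close>

lemma isom_prob_simps:
  assumes "isom_prob \<mu>"
  shows "prob_space \<mu>" "sets \<mu> = sets isom_borel" "space \<mu> = isoms"
proof -
  show "prob_space \<mu>" "sets \<mu> = sets isom_borel" using assms by (auto simp: isom_prob_def)
  then show "space \<mu> = isoms"
    using sets_eq_imp_space_eq[of \<mu> isom_borel]
    by (simp add: isom_borel_def space_restrict_space)
qed

lemma isom_prob_return: "isom_prob (return isom_borel (id :: 'a::metric_space \<Rightarrow> 'a))"
proof -
  have "(id :: 'a \<Rightarrow> 'a) \<in> space isom_borel" by (simp add: isom_borel_def space_restrict_space)
  then show ?thesis by (simp add: isom_prob_def prob_space_return)
qed

text \<open>Mixtures over a discrete parameter: the lazy measure and the law at a geometric time are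
  both of this form.\<close>

lemma isom_prob_bind_pmf:
  fixes q :: "'b pmf"
  assumes "\<And>b. isom_prob (N b)"
  shows "isom_prob (measure_pmf q \<bind> N)"
    and "f \<in> borel_measurable isom_borel \<Longrightarrow>
      (\<integral>\<^sup>+x. f x \<partial>(measure_pmf q \<bind> N)) = (\<integral>\<^sup>+b. \<integral>\<^sup>+x. f x \<partial>N b \<partial>measure_pmf q)"
proof -
  have N: "N \<in> measurable (measure_pmf q) (subprob_algebra isom_borel)"
  proof (rule measurableI)
    show "N x \<in> space (subprob_algebra isom_borel)" for x
      using isom_prob_simps[OF assms[of x]]
      by (auto simp: space_subprob_algebra intro: prob_space_imp_subprob_space)
  qed simp
  have "prob_space (measure_pmf q \<bind> N)"
    by (rule measure_pmf.prob_space_bind[OF _ N]) (simp add: isom_prob_simps[OF assms])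
  moreover have "sets (measure_pmf q \<bind> N) = sets isom_borel"
    by (rule sets_bind) (simp_all add: isom_prob_simps(2)[OF assms])
  ultimately show "isom_prob (measure_pmf q \<bind> N)" by (simp add: isom_prob_def)
  show "(\<integral>\<^sup>+x. f x \<partial>(measure_pmf q \<bind> N)) = (\<integral>\<^sup>+b. \<integral>\<^sup>+x. f x \<partial>N b \<partial>measure_pmf q)"
    if "f \<in> borel_measurable isom_borel" by (rule nn_integral_bind[OF that N])
qed

context
  fixes r :: real
  assumes r: "0 \<le> r" "r \<le> 1"
begin

text \<open>\<open>lazy\<close> is given by a set function through \<open>measure_of\<close>; its
  countable additivity comes from recognising it as a Bernoulli mixture.\<close>

lemma lazy_eq_bind:
  fixes \<mu> :: "('b::metric_space \<Rightarrow> 'b) measure"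
  assumes "isom_prob \<mu>"
  shows "lazy r \<mu> = measure_pmf (bernoulli_pmf r) \<bind> (\<lambda>b. if b then return isom_borel id else \<mu>)"
proof -
  let ?N = "\<lambda>b. if b then return isom_borel id else \<mu>"
  define M where "M = measure_pmf (bernoulli_pmf r) \<bind> ?N"
  have N: "isom_prob (?N b)" for b using assms isom_prob_return by auto
  have M: "isom_prob M" unfolding M_def by (rule isom_prob_bind_pmf(1)[OF N])
  have M2: "(\<integral>\<^sup>+x. f x \<partial>M) = (\<integral>\<^sup>+b. \<integral>\<^sup>+x. f x \<partial>?N b \<partial>measure_pmf (bernoulli_pmf r))"
    if "f \<in> borel_measurable isom_borel" for f
    unfolding M_def by (rule isom_prob_bind_pmf(2)[OF N that])
  have em: "emeasure M A = ennreal r * indicator A id + ennreal (1 - r) * emeasure \<mu> A"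
    if A: "A \<in> sets isom_borel" for A
  proof -
    have "emeasure M A = (\<integral>\<^sup>+x. indicator A x \<partial>M)"
      by (rule nn_integral_indicator[symmetric]) (use A in \<open>simp add: isom_prob_simps(2)[OF M]\<close>)
    also have "\<dots> = (\<integral>\<^sup>+b. emeasure (?N b) A \<partial>measure_pmf (bernoulli_pmf r))"
      using A by (subst M2) (auto simp: isom_prob_simps(2)[OF N])
    finally show ?thesis using r A by (simp add: mult.commute)
  qed
  have sp: "space isom_borel = (isoms :: ('b \<Rightarrow> 'b) set)"
    by (simp add: isom_borel_def space_restrict_space)
  have sig: "sigma_sets isoms (sets isom_borel) = (sets isom_borel :: ('b \<Rightarrow> 'b) set set)"
    using sets.sigma_sets_eq[of "isom_borel :: ('b \<Rightarrow> 'b) measure"] by (simp add: sp)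
  have "sets isom_borel \<subseteq> Pow (isoms :: ('b \<Rightarrow> 'b) set)"
    using sets.space_closed[of "isom_borel :: ('b \<Rightarrow> 'b) measure"] by (simp add: sp)
  then have "lazy r \<mu> = measure_of (space M) (sets M) (emeasure M)"
    unfolding lazy_def isom_prob_simps[OF M] by (rule measure_of_eq) (simp add: sig em)
  then show ?thesis by (simp add: measure_of_of_measure M_def)
qed

lemma isom_prob_lazy: "isom_prob \<mu> \<Longrightarrow> isom_prob (lazy r \<mu>)"
  by (auto simp: lazy_eq_bind isom_prob_return intro!: isom_prob_bind_pmf)

lemma nn_integral_lazy:
  fixes \<mu> :: "('b::metric_space \<Rightarrow> 'b) measure"
  assumes "isom_prob \<mu>" "f \<in> borel_measurable isom_borel"
  shows "(\<integral>\<^sup>+x. f x \<partial>lazy r \<mu>) = ennreal r * f id + ennreal (1 - r) * (\<integral>\<^sup>+x. f x \<partial>\<mu>)"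
proof -
  have "(id :: 'b \<Rightarrow> 'b) \<in> space isom_borel" by (simp add: isom_borel_def space_restrict_space)
  with assms r show ?thesis
    by (subst lazy_eq_bind, simp, subst isom_prob_bind_pmf)
      (auto simp: isom_prob_return nn_integral_return mult.commute)
qed

end

context separable_metric
begin

definition conv :: "('a \<Rightarrow> 'a) measure \<Rightarrow> ('a \<Rightarrow> 'a) measure \<Rightarrow> ('a \<Rightarrow> 'a) measure" where
  "conv \<mu> \<nu> = distr (\<mu> \<Otimes>\<^sub>M \<nu>) isom_borel (\<lambda>(g, h). g \<circ> h)"

lemma measurable_conv_comp:
  fixes \<mu> \<nu> :: "('a \<Rightarrow> 'a) measure"
  assumes "sets \<mu> = sets isom_borel" "sets \<nu> = sets isom_borel"
  shows "(\<lambda>(g, h). g \<circ> h) \<in> measurable (\<mu> \<Otimes>\<^sub>M \<nu>) isom_borel"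
proof -
  have [measurable_cong]: "sets \<mu> = sets isom_borel" "sets \<nu> = sets isom_borel" by fact+
  show ?thesis unfolding split_beta' by measurable
qed

lemma isom_prob_conv:
  assumes "isom_prob \<mu>" "isom_prob \<nu>"
  shows "isom_prob (conv \<mu> \<nu>)"
proof -
  interpret \<mu>: prob_space \<mu> using assms by (simp add: isom_prob_simps)
  interpret \<nu>: prob_space \<nu> using assms by (simp add: isom_prob_simps)
  interpret pair_prob_space \<mu> \<nu> ..
  show ?thesis
    unfolding isom_prob_def conv_def
    by (simp add: P.prob_space_distr measurable_conv_comp isom_prob_simps assms)
qed

lemma nn_integral_conv:
  assumes "isom_prob \<mu>" "isom_prob \<nu>" "f \<in> borel_measurable isom_borel"
  shows "(\<integral>\<^sup>+x. f x \<partial>conv \<mu> \<nu>) = (\<integral>\<^sup>+g. \<integral>\<^sup>+h. f (g \<circ> h) \<partial>\<nu> \<partial>\<mu>)"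
proof -
  interpret \<nu>: prob_space \<nu> using assms by (simp add: isom_prob_simps)
  note m = measurable_conv_comp[OF isom_prob_simps(2)[OF assms(1)] isom_prob_simps(2)[OF assms(2)]]
  have "(\<integral>\<^sup>+x. f x \<partial>conv \<mu> \<nu>) = (\<integral>\<^sup>+x. f (case x of (g, h) \<Rightarrow> g \<circ> h) \<partial>(\<mu> \<Otimes>\<^sub>M \<nu>))"
    unfolding conv_def using assms(3) by (intro nn_integral_distr[OF m]) simp
  also have "\<dots> = (\<integral>\<^sup>+g. \<integral>\<^sup>+h. f (g \<circ> h) \<partial>\<nu> \<partial>\<mu>)"
    by (subst \<nu>.nn_integral_fst[symmetric]) (auto intro: measurable_compose[OF m assms(3)])
  finally show ?thesis .
qed

lemma borel_measurable_nn_integral_comp: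
  fixes \<nu> :: "('a \<Rightarrow> 'a) measure"
  assumes "isom_prob \<nu>" "f \<in> borel_measurable isom_borel"
  shows "(\<lambda>g. \<integral>\<^sup>+h. f (g \<circ> h) \<partial>\<nu>) \<in> borel_measurable isom_borel"
proof -
  interpret \<nu>: prob_space \<nu> using assms by (simp add: isom_prob_simps)
  have m: "(\<lambda>(g, h). g \<circ> h) \<in> measurable (isom_borel \<Otimes>\<^sub>M \<nu>) isom_borel"
    by (rule measurable_conv_comp[OF refl isom_prob_simps(2)[OF assms(1)]])
  show ?thesis
    using \<nu>.borel_measurable_nn_integral_fst[OF measurable_compose[OF m assms(2)]] by simp
qed

text \<open>The free end \<open>\<xi>\<close> is there because the N lazy steps will be followed by
  a waypoint, whose law is arbitrary.\<close>

primrec conv_iter :: "('a \<Rightarrow> 'a) measure \<Rightarrow> ('a \<Rightarrow> 'a) measure \<Rightarrow> nat \<Rightarrow> ('a \<Rightarrow> 'a) measure" where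
  "conv_iter \<nu> \<xi> 0 = \<xi>"
| "conv_iter \<nu> \<xi> (Suc n) = conv \<nu> (conv_iter \<nu> \<xi> n)"

abbreviation conv_pow :: "('a \<Rightarrow> 'a) measure \<Rightarrow> nat \<Rightarrow> ('a \<Rightarrow> 'a) measure" where
  "conv_pow \<nu> \<equiv> conv_iter \<nu> (return isom_borel id)"

lemma isom_prob_conv_iter: "isom_prob \<nu> \<Longrightarrow> isom_prob \<xi> \<Longrightarrow> isom_prob (conv_iter \<nu> \<xi> n)"
  by (induction n) (auto intro: isom_prob_conv)

lemma measurable_comp_left:
  assumes "f \<in> borel_measurable isom_borel" "g \<in> (isoms :: ('a \<Rightarrow> 'a) set)"
  shows "(\<lambda>h. f (g \<circ> h)) \<in> borel_measurable isom_borel"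
proof -
  have "(\<lambda>h. g \<circ> h) \<in> measurable isom_borel isom_borel"
    using assms(2) by (intro measurable_comp_isom) auto
  from measurable_compose[OF this assms(1)] show ?thesis .
qed

lemma nn_integral_conv_iter:
  assumes \<nu>: "isom_prob \<nu>" and \<xi>: "isom_prob \<xi>" and f: "f \<in> borel_measurable isom_borel"
  shows "(\<integral>\<^sup>+x. f x \<partial>conv_iter \<nu> \<xi> n) = (\<integral>\<^sup>+g. \<integral>\<^sup>+v. f (g \<circ> v) \<partial>\<xi> \<partial>conv_pow \<nu> n)"
  using f
proof (induction n arbitrary: f)
  case 0
  have "(\<lambda>g. \<integral>\<^sup>+v. f (g \<circ> v) \<partial>\<xi>) \<in> borel_measurable isom_borel"
    by (rule borel_measurable_nn_integral_comp[OF \<xi> 0])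
  then have "(\<integral>\<^sup>+g. \<integral>\<^sup>+v. f (g \<circ> v) \<partial>\<xi> \<partial>return isom_borel id) = (\<integral>\<^sup>+v. f (id \<circ> v) \<partial>\<xi>)"
    by (intro nn_integral_return) simp_all
  then show ?case by (simp only: conv_iter.simps id_comp)
next
  case (Suc n)
  have m: "(\<lambda>g. \<integral>\<^sup>+v. f (g \<circ> v) \<partial>\<xi>) \<in> borel_measurable isom_borel"
    by (rule borel_measurable_nn_integral_comp[OF \<xi> Suc.prems])
  have "(\<integral>\<^sup>+x. f x \<partial>conv_iter \<nu> \<xi> (Suc n)) = (\<integral>\<^sup>+g. \<integral>\<^sup>+h. f (g \<circ> h) \<partial>conv_iter \<nu> \<xi> n \<partial>\<nu>)"
    unfolding conv_iter.simps by (rule nn_integral_conv[OF \<nu> isom_prob_conv_iter[OF \<nu> \<xi>] Suc.prems])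
  also have "\<dots> = (\<integral>\<^sup>+g. \<integral>\<^sup>+h. \<integral>\<^sup>+v. f (g \<circ> (h \<circ> v)) \<partial>\<xi> \<partial>conv_pow \<nu> n \<partial>\<nu>)"
    using measurable_comp_left[OF Suc.prems]
    by (intro nn_integral_cong Suc.IH) (simp add: isom_prob_simps[OF \<nu>])
  also have "\<dots> = (\<integral>\<^sup>+g. \<integral>\<^sup>+v. f (g \<circ> v) \<partial>\<xi> \<partial>conv_pow \<nu> (Suc n))"
    by (simp add: nn_integral_conv[OF \<nu> isom_prob_conv_iter[OF \<nu> isom_prob_return] m] comp_assoc)
  finally show ?case .
qed

text \<open>\<open>geometric_pmf\<close> counts failures starting from 0, so time n has weight (1 -
  \<theta>) \<theta>^n and \<theta> close to 1 means a long time.\<close>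

definition geometric_conv :: "real \<Rightarrow> ('a \<Rightarrow> 'a) measure \<Rightarrow> ('a \<Rightarrow> 'a) measure" where
  "geometric_conv \<theta> \<mu> = measure_pmf (geometric_pmf (1 - \<theta>)) \<bind> conv_pow \<mu>"

lemma isom_prob_geometric_conv: "isom_prob \<mu> \<Longrightarrow> isom_prob (geometric_conv \<theta> \<mu>)"
  unfolding geometric_conv_def
  by (intro isom_prob_bind_pmf isom_prob_conv_iter isom_prob_return)

text \<open>The geometric clock either rings at once or is as good as new after one step. This
  renewal identity is the sense in which the law is almost stationary.\<close>

lemma nn_integral_geometric_conv:
  assumes \<theta>: "0 < \<theta>" "\<theta> < 1" and \<mu>: "isom_prob \<mu>" and f: "f \<in> borel_measurable isom_borel"
  shows "(\<integral>\<^sup>+h. f h \<partial>geometric_conv \<theta> \<mu>) =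
    ennreal (1 - \<theta>) * f id + ennreal \<theta> * (\<integral>\<^sup>+x. \<integral>\<^sup>+h. f (x \<circ> h) \<partial>geometric_conv \<theta> \<mu> \<partial>\<mu>)"
proof -
  note pow = isom_prob_conv_iter[OF \<mu> isom_prob_return]
  define q where "q = geometric_pmf (1 - \<theta>)"
  have eta: "(\<integral>\<^sup>+h. f h \<partial>geometric_conv \<theta> \<mu>) = (\<integral>\<^sup>+n. \<integral>\<^sup>+h. f h \<partial>conv_pow \<mu> n \<partial>q)"
    if "f \<in> borel_measurable isom_borel" for f
    unfolding geometric_conv_def q_def by (rule isom_prob_bind_pmf(2)[OF pow that])
  have q: "q = bernoulli_pmf (1 - \<theta>) \<bind> (\<lambda>b. if b then return_pmf 0 else map_pmf Suc q)"
    unfolding q_def using \<theta> by (intro geometric_bind_pmf_unfold) auto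
  have "(\<integral>\<^sup>+h. f h \<partial>geometric_conv \<theta> \<mu>) = (\<integral>\<^sup>+n. \<integral>\<^sup>+h. f h \<partial>conv_pow \<mu> n \<partial>q)"
    by (rule eta[OF f])
  also have "\<dots> = ennreal (1 - \<theta>) * (\<integral>\<^sup>+h. f h \<partial>conv_pow \<mu> 0) +
      ennreal \<theta> * (\<integral>\<^sup>+n. \<integral>\<^sup>+h. f h \<partial>conv_pow \<mu> (Suc n) \<partial>q)"
    by (subst q) (use \<theta> in \<open>simp add: mult.commute\<close>)
  also have "(\<integral>\<^sup>+h. f h \<partial>conv_pow \<mu> 0) = f id"
    using f by (simp add: nn_integral_return)
  also have "(\<integral>\<^sup>+n. \<integral>\<^sup>+h. f h \<partial>conv_pow \<mu> (Suc n) \<partial>q) =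
      (\<integral>\<^sup>+n. \<integral>\<^sup>+x. \<integral>\<^sup>+h. f (x \<circ> h) \<partial>conv_pow \<mu> n \<partial>\<mu> \<partial>q)"
    by (simp add: nn_integral_conv[OF \<mu> pow f])
  also have "\<dots> = (\<integral>\<^sup>+x. \<integral>\<^sup>+n. \<integral>\<^sup>+h. f (x \<circ> h) \<partial>conv_pow \<mu> n \<partial>q \<partial>\<mu>)"
  proof -
    interpret \<mu>: prob_space \<mu> using \<mu> by (simp add: isom_prob_simps)
    interpret pair_prob_space "measure_pmf q" \<mu> ..
    have c: "(\<lambda>x. \<integral>\<^sup>+h. f (x \<circ> h) \<partial>conv_pow \<mu> n) \<in> borel_measurable \<mu>" for n
      using borel_measurable_nn_integral_comp[OF pow f]
      by (simp add: measurable_cong_sets[OF isom_prob_simps(2)[OF \<mu>] refl])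
    have "(\<lambda>(n, x). \<integral>\<^sup>+h. f (x \<circ> h) \<partial>conv_pow \<mu> n) \<in> borel_measurable (count_space UNIV \<Otimes>\<^sub>M \<mu>)"
      by (rule measurable_pair_measure_countable1) (use c in auto)
    then have "(\<lambda>(n, x). \<integral>\<^sup>+h. f (x \<circ> h) \<partial>conv_pow \<mu> n) \<in> borel_measurable (measure_pmf q \<Otimes>\<^sub>M \<mu>)"
      by (simp add: measurable_cong_sets[OF sets_pair_measure_cong[OF sets_measure_pmf_count_space refl] refl])
    from Fubini'[OF this] show ?thesis by simp
  qed
  also have "\<dots> = (\<integral>\<^sup>+x. \<integral>\<^sup>+h. f (x \<circ> h) \<partial>geometric_conv \<theta> \<mu> \<partial>\<mu>)"
    using measurable_comp_left[OF f]
    by (intro nn_integral_cong eta[symmetric]) (simp add: isom_prob_simps[OF \<mu>])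
  finally show ?thesis .
qed

end

subsection \<open>Hyperbolic geometry\<close>

lemma hyperbolic_four_point:
  assumes "hyperbolic_space TYPE('a::metric_space) \<delta>"
  shows "dist (x::'a) y + dist z p \<le> max (dist x z + dist y p) (dist y z + dist x p) + 2 * \<delta>"
proof -
  have "min (gromov_product p x z) (gromov_product p z y) - \<delta> \<le> gromov_product p x y"
    using assms unfolding hyperbolic_space_def by blast
  then show ?thesis
    unfolding gromov_product_def by (simp add: dist_commute min_def max_def field_simps split: if_splits)
qed

lemma hyperbolic_delta_nonneg:
  assumes "hyperbolic_space TYPE('a::metric_space) \<delta>"
  shows "0 \<le> \<delta>"
proof -
  fix x :: 'a
  show ?thesis using hyperbolic_four_point[OF assms, of x x x x] by simp
qed

lemma geodesic_point:
  assumes "geodesic_space TYPE('a::metric_space)" "0 \<le> s" "s \<le> dist (x::'a) y"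
  shows "\<exists>z. dist x z = s \<and> dist z y = dist x y - s"
proof -
  obtain c where c: "c 0 = x" "c (dist x y) = y"
      "\<And>s t. s \<in> {0..dist x y} \<Longrightarrow> t \<in> {0..dist x y} \<Longrightarrow> dist (c s) (c t) = \<bar>s - t\<bar>"
    using assms(1) unfolding geodesic_space_def by metis
  have "dist x (c s) = s" using c(3)[of 0 s] assms(2,3) by (simp add: c(1))
  moreover have "dist (c s) y = dist x y - s" using c(3)[of s "dist x y"] assms(2,3) by (simp add: c(2))
  ultimately show ?thesis by blast
qed

lemma gromov_product_bounds:
  "0 \<le> gromov_product p x y" "gromov_product p x y \<le> dist x p" "gromov_product p x y \<le> dist y p"
  using dist_triangle[of x y p] dist_triangle[of x p y] dist_triangle[of y p x]
  by (auto simp: gromov_product_def dist_commute)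

text \<open>If the Gromov product with \<open>y\<close> jumps across the level \<open>s\<close> between \<open>z\<close> and \<open>z'\<close>, then a
  geodesic from \<open>z\<close> to \<open>z'\<close> passes near the point \<open>q\<close> at distance \<open>s\<close> from \<open>p\<close> on a geodesic to \<open>y\<close>.\<close>

lemma crossing_near_point:
  fixes p :: "'a::metric_space"
  assumes hyp: "hyperbolic_space TYPE('a) \<delta>"
    and q: "dist p q = s" "dist q y = dist p y - s"
    and z: "gromov_product p y z \<le> s" "s \<le> gromov_product p y z'"
    and jump: "gromov_product p y z + \<delta> < gromov_product p y z'"
  shows "dist z q + dist q z' \<le> dist z z' + 6 * \<delta>"
proof -
  \<comment> \<open>The bounds on the two Gromov products decide the first two maxima, and the jump
    by more than \<delta> excludes the second term of the third. Adding the three inequalities gives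
    the error \<open>6 * \<delta>\<close>.\<close>
  have "dist z q + dist p y \<le> max (dist z p + dist q y) (dist q p + dist z y) + 2 * \<delta>"
    using hyperbolic_four_point[OF hyp, of z q p y] by (simp add: dist_commute)
  moreover have "dist z' q + dist p y \<le> max (dist z' p + dist q y) (dist q p + dist z' y) + 2 * \<delta>"
    using hyperbolic_four_point[OF hyp, of z' q p y] by (simp add: dist_commute)
  moreover have "dist z y + dist z' p \<le> max (dist z z' + dist p y) (dist z p + dist z' y) + 2 * \<delta>"
    using hyperbolic_four_point[OF hyp, of z y z' p] by (simp add: dist_commute)
  ultimately show ?thesis
    using q z jump unfolding gromov_product_def
    by (simp add: dist_commute max_def field_simps split: if_splits)
qed

text \<open>The four point condition for \<open>w\<close>, \<open>q\<close> and the two ends. The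
  minimum is there because \<open>dist x q\<close> may exceed \<open>dist x y\<close> by up to 3
  \<delta>; the slack of 1/4 and 1/2 is that of approximating a geodesic point by the dense
  sequence.\<close>

lemma near_geodesic_close:
  fixes x y :: "'a::metric_space"
  assumes hyp: "hyperbolic_space TYPE('a) \<delta>" and geo: "dist x q + dist q y \<le> dist x y + 6 * \<delta>"
    and k: "k \<le> dist x q" "dist x q \<le> k + 1"
    and w: "\<bar>dist x w - min k (dist x y)\<bar> \<le> 1 / 4" "dist x w + dist w y \<le> dist x y + 1 / 2"
  shows "dist w q \<le> 8 * \<delta> + 2"
proof -
  have d: "0 \<le> \<delta>" by (rule hyperbolic_delta_nonneg[OF hyp])
  have "dist x q \<le> dist x y + 3 * \<delta>" using geo dist_triangle[of x q y] by (simp add: dist_commute)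
  then have a: "min k (dist x y) \<le> dist x q" "dist x q \<le> min k (dist x y) + 1 + 3 * \<delta>"
    using k d by (auto simp: min_def)
  have "dist w q + dist x y \<le> max (dist x w + dist q y) (dist x q + dist w y) + 2 * \<delta>"
    using hyperbolic_four_point[OF hyp, of w q x y] by (simp add: dist_commute max.commute)
  moreover have "min k (dist x y) - 1 / 4 \<le> dist x w" "dist x w \<le> min k (dist x y) + 1 / 4"
    using w(1) by linarith+
  ultimately show ?thesis using a geo w(2) d by (simp add: max_def split: if_splits)
qed

text \<open>Both points can be carried into the compact set, so its diameter is a bound. Without
  such a bound the real supremum in \<open>quotient_diam\<close> would carry no information.\<close>

lemma quotient_diam_bdd:
  assumes "cocompact_action TYPE('a::metric_space)"
  shows "bdd_above (range (\<lambda>(x :: 'a, y). INF g\<in>isoms. dist (g x) y))"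
proof -
  obtain K :: "'a set" where K: "compact K" "(\<Union>g\<in>isoms. g ` K) = UNIV"
    using assms unfolding cocompact_action_def by blast
  obtain B where B: "\<And>x y. x \<in> K \<Longrightarrow> y \<in> K \<Longrightarrow> dist x y \<le> B"
    using compact_imp_bounded[OF K(1)] unfolding bounded_two_points by blast
  have "(INF g\<in>isoms. dist (g x) y) \<le> B" for x y :: 'a
  proof -
    obtain g h a b where gh: "g \<in> isoms" "h \<in> isoms" "a \<in> K" "b \<in> K" "x = g a" "y = h b"
      using K(2) UNIV_I[of x] UNIV_I[of y] unfolding K(2)[symmetric] by blast
    have "dist ((h \<circ> inv g) x) y = dist a b"
      using gh by (simp add: isoms_inv_apply isoms_dist)
    moreover have "h \<circ> inv g \<in> isoms" using gh by (intro isoms_comp isoms_inv)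
    ultimately have "(INF g\<in>isoms. dist (g x) y) \<le> dist a b"
      by (metis (no_types, lifting) bdd_belowI2 cINF_lower zero_le_dist)
    with B[OF gh(3,4)] show ?thesis by simp
  qed
  then show ?thesis by (intro bdd_aboveI2[where M = B]) auto
qed

lemma quotient_diam_approx:
  assumes "cocompact_action TYPE('a::metric_space)" "0 < e"
  shows "\<exists>g\<in>isoms. dist (g x) (y::'a) < quotient_diam TYPE('a) + e"
proof -
  have "(INF g\<in>isoms. dist (g x) y) \<le> quotient_diam TYPE('a)"
    unfolding quotient_diam_def
    using cSUP_upper[OF _ quotient_diam_bdd[OF assms(1)], of "(x, y)"] by simp
  then have "(INF g\<in>isoms. dist (g x) y) < quotient_diam TYPE('a) + e" using assms(2) by simp
  then show ?thesis
    by (subst (asm) cINF_less_iff) (auto intro!: bdd_belowI2[where m = 0] exI[of _ id] isoms_id)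
qed

lemma quotient_diam_nonneg:
  assumes "cocompact_action TYPE('a::metric_space)"
  shows "0 \<le> quotient_diam TYPE('a)"
proof (rule field_le_epsilon)
  fix e :: real and x :: 'a assume "e > 0"
  then obtain g :: "'a \<Rightarrow> 'a" where "dist (g x) x < quotient_diam TYPE('a) + e"
    using quotient_diam_approx[OF assms, of e x x] by blast
  then show "0 \<le> quotient_diam TYPE('a) + e" using zero_le_dist[of "g x" x] by linarith
qed

lemma displacement_comp:
  assumes "g \<in> isoms" shows "displacement p (g \<circ> h) \<le> displacement p g + displacement p h"
  using dist_triangle[of "g (h p)" p "g p"] isoms_dist[OF assms, of "h p" p]
  by (simp add: displacement_def)

lemma displacement_nonneg: "0 \<le> displacement p g"
  by (simp add: displacement_def)

lemma displacement_id [simp]: "displacement p id = 0"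
  by (simp add: displacement_def)

lemma isom_power_fix:
  assumes "g \<in> isoms" "g p = p" shows "isom_power g n p = p"
proof -
  have "inv g p = p" using isoms_inv_apply(1)[OF assms(1), of p] assms(2) by simp
  then have "(g ^^ k) p = p" "(inv g ^^ k) p = p" for k using assms(2) by (induction k) auto
  then show ?thesis by (simp add: isom_power_def)
qed

text \<open>If it vanished, the support and the semigroup it spans would fix \<open>p\<close>. A
  loxodromic element would then have a constant orbit, against the linear lower bound of a
  quasi-geodesic.\<close>

lemma max_displacement_pos:
  assumes "non_elementary p \<mu>" "bounded_isoms p (isom_support \<mu>)"
  shows "0 < max_displacement p (isom_support \<mu>)"
proof (rule ccontr)
  assume neg: "\<not> 0 < max_displacement p (isom_support \<mu>)"
  have fixp: "g p = p" if "g \<in> isom_support \<mu>" for g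
  proof -
    have "displacement p g \<le> max_displacement p (isom_support \<mu>)"
      unfolding max_displacement_def using assms(2) that by (intro cSUP_upper) (auto simp: bounded_isoms_def)
    with neg displacement_nonneg[of p g] have "displacement p g = 0" by linarith
    then show ?thesis by (simp add: displacement_def)
  qed
  have "g p = p" if "g \<in> semigroup_span (isom_support \<mu>)" for g
    using that by (induction rule: semigroup_span.induct) (auto simp: fixp)
  then obtain g where g: "g p = p" "loxodromic g"
    using assms(1) unfolding non_elementary_def independent_loxodromics_def by blast
  then have "isom_power g n p = p" for n using isom_power_fix[of g p n] by (auto simp: loxodromic_def)
  have "quasi_geodesic (\<lambda>n. isom_power g n p)" using g by (simp add: loxodromic_def)
  then obtain L C where L: "L \<ge> 1" "\<And>m n. \<bar>of_int m - of_int n\<bar> / L - C \<le> (0::real)"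
    unfolding quasi_geodesic_def \<open>\<And>n. isom_power g n p = p\<close> dist_self by blast
  obtain n :: nat where "L * C < real n" using reals_Archimedean2 by blast
  moreover have "real n / L \<le> C" using L(2)[of "int n" 0] by simp
  ultimately show False using L(1) by (simp add: field_simps)
qed

subsection \<open>Haar measure and the regular representation\<close>

text \<open>Arzela-Ascoli in product form: an isometry in the ball sends x into the compact ball of
  radius \<open>R + dist x p\<close> around \<open>p\<close>, and Tychonoff's theorem applies to the
  product of these balls.\<close>

lemma isom_ball_compact:
  fixes p :: "'a::metric_space"
  assumes "proper_space TYPE('a)"
  shows "compact (isom_ball p R)"
proof -
  define C :: "('a \<Rightarrow> 'a) set" where "C = (\<Pi>\<^sub>E x\<in>UNIV. cball p (R + dist x p))"
  have "compactin (product_topology (\<lambda>_. euclidean) UNIV) C"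
    unfolding C_def compactin_PiE using assms by (auto simp: proper_space_def)
  then have C: "compact C" by (simp add: euclidean_product_topology)
  text \<open>Surjectivity is not a closed condition, but carrying the inverse along makes it one.\<close>
  define E :: "(('a \<Rightarrow> 'a) \<times> ('a \<Rightarrow> 'a)) set" where
    "E = {gh. (\<forall>x y. dist (fst gh x) y = dist x (snd gh y)) \<and> dist (fst gh p) p \<le> R}"
  have ev: "continuous_on UNIV (\<lambda>gh :: ('a \<Rightarrow> 'a) \<times> ('a \<Rightarrow> 'a). fst gh x)"
      "continuous_on UNIV (\<lambda>gh :: ('a \<Rightarrow> 'a) \<times> ('a \<Rightarrow> 'a). snd gh x)" for x
    using continuous_on_compose2[OF continuous_on_product_coordinates[of x] continuous_on_fst[OF continuous_on_id]]
      continuous_on_compose2[OF continuous_on_product_coordinates[of x] continuous_on_snd[OF continuous_on_id]]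
    by auto
  have "closed E"
    unfolding E_def
    by (intro closed_Collect_conj closed_Collect_all closed_Collect_eq closed_Collect_le
        continuous_on_dist ev continuous_on_const)
  then have "compact (fst ` ((C \<times> C) \<inter> E))"
    using C by (intro compact_continuous_image compact_Int_closed compact_Times continuous_on_fst continuous_on_id)
  also have "fst ` ((C \<times> C) \<inter> E) = isom_ball p R"
  proof safe
    fix g h assume gh: "(g, h) \<in> E"
    then have a: "dist (g x) y = dist x (h y)" for x y by (auto simp: E_def)
    have hg: "h (g x) = x" for x using a[of x "g x"] by simp
    have gh': "g (h y) = y" for y using a[of "h y" y] by simp
    have "surj g" by (rule surjI[of g h]) (rule gh')
    moreover have "dist (g x) (g y) = dist x y" for x y using a[of x "g y"] by (simp add: hg)
    ultimately show "fst (g, h) \<in> isom_ball p R"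
      using gh by (auto simp: E_def isom_ball_def isoms_def displacement_def)
  next
    fix g assume "g \<in> isom_ball p R"
    then have g: "g \<in> isoms" "dist (g p) p \<le> R" by (auto simp: isom_ball_def displacement_def)
    have "dist p (g x) \<le> R + dist x p" for x
      using dist_triangle[of p "g x" "g p"] g isoms_dist[OF g(1), of p x] by (simp add: dist_commute)
    moreover have "dist p (inv g x) \<le> R + dist x p" for x
      using dist_triangle[of "g p" x p] g isoms_dist_inv'[OF g(1), of p x] by (simp add: dist_commute)
    moreover have "(g, inv g) \<in> E" using g by (auto simp: E_def isoms_dist_inv')
    ultimately have "(g, inv g) \<in> (C \<times> C) \<inter> E" by (auto simp: C_def)
    then show "g \<in> fst ` ((C \<times> C) \<inter> E)" by force
  qed
  finally show ?thesis .
qed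

locale haar_isoms = separable_metric w
  for w :: "nat \<Rightarrow> 'a::metric_space" +
  fixes m :: "('a \<Rightarrow> 'a) measure" and p :: 'a
  assumes proper: "proper_space TYPE('a)"
    and haar: "haar_measure m"
begin

lemma sets_m [measurable_cong]: "sets m = sets isom_borel"
  using haar by (simp add: haar_measure_def)

lemma space_m [simp]: "space m = isoms"
  using sets_eq_imp_space_eq[OF sets_m] by simp

definition near :: "('a \<Rightarrow> 'a) \<Rightarrow> real \<Rightarrow> ('a \<Rightarrow> 'a) set" where
  "near u R = {x \<in> isoms. dist (u p) (x p) \<le> R}"

lemma near_translate:
  assumes "u \<in> isoms" shows "near u R = (\<lambda>h. u \<circ> h) ` isom_ball p R"
proof (intro equalityI subsetI)
  fix x assume x: "x \<in> near u R"
  then have "inv u \<circ> x \<in> isom_ball p R"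
    using assms by (auto simp: near_def isom_ball_def displacement_def isoms_dist_inv isoms_dist_inv' dist_commute
        intro: isoms_comp isoms_inv)
  moreover have "x = u \<circ> (inv u \<circ> x)" using isoms_inv_comp(2)[OF assms] by (simp flip: comp_assoc)
  ultimately show "x \<in> (\<lambda>h. u \<circ> h) ` isom_ball p R" by (metis image_eqI)
next
  fix x assume "x \<in> (\<lambda>h. u \<circ> h) ` isom_ball p R"
  then show "x \<in> near u R"
    using assms by (auto simp: near_def isom_ball_def displacement_def isoms_dist dist_commute
        intro: isoms_comp)
qed

lemma near_sets [measurable]: "near u R \<in> sets isom_borel"
proof -
  have "{x \<in> space isom_borel. dist (u p) (x p) \<le> R} \<in> sets isom_borel"
    by (intro borel_measurable_le borel_measurable_dist_sep measurable_isom_eval) auto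
  then show ?thesis by (simp add: near_def)
qed

lemma emeasure_translate:
  assumes "g \<in> isoms" "A \<in> sets isom_borel"
  shows "emeasure m ((\<lambda>h. g \<circ> h) ` A) = emeasure m A"
  using haar assms by (simp add: haar_measure_def)

lemma emeasure_near: "u \<in> isoms \<Longrightarrow> emeasure m (near u R) = emeasure m (isom_ball p R)"
  by (simp add: near_translate emeasure_translate isom_ball_sets)

lemma emeasure_isom_ball_finite: "emeasure m (isom_ball p R) < \<infinity>"
  using haar isom_ball_compact[OF proper, of p R] by (auto simp: haar_measure_def isom_ball_def)

lemma isoms_UN_isom_ball: "isoms = (\<Union>n::nat. isom_ball p (real n))"
  by (auto simp: isom_ball_def intro: real_arch_simple)

sublocale m: sigma_finite_measure m
proof
  show "\<exists>A. countable A \<and> A \<subseteq> sets m \<and> \<Union> A = space m \<and> (\<forall>a\<in>A. emeasure m a \<noteq> \<infinity>)"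
    using emeasure_isom_ball_finite isoms_UN_isom_ball
    by (intro exI[of _ "range (\<lambda>n::nat. isom_ball p (real n))"]) (auto simp: sets_m isom_ball_sets less_top)
qed

definition V :: "real \<Rightarrow> real" where "V R = measure m (isom_ball p R)"

lemma emeasure_V: "emeasure m (isom_ball p R) = ennreal (V R)"
  using emeasure_isom_ball_finite[of R] by (simp add: V_def emeasure_eq_ennreal_measure less_top)

text \<open>Left translates of a null ball would be null, and countably many of them, placed along
  the dense sequence, cover the group.\<close>

lemma V_pos:
  assumes "0 < R" shows "0 < V R"
proof (rule ccontr)
  assume "\<not> 0 < V R"
  then have z: "emeasure m (near u R) = 0" if "u \<in> isoms" for u
    using that by (simp add: emeasure_near emeasure_V ennreal_neg not_less)
  define v where "v i = (SOME u. u \<in> isoms \<and> dist (w i) (u p) < R / 2)" for i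
  define J where "J = {i. \<exists>u\<in>isoms. dist (w i) (u p) < R / 2}"
  have v: "v i \<in> isoms" "dist (w i) (v i p) < R / 2" if "i \<in> J" for i
    using that someI_ex[of "\<lambda>u. u \<in> isoms \<and> dist (w i) (u p) < R / 2"] by (auto simp: J_def v_def)
  have "(\<Union>i\<in>J. near (v i) R) \<in> null_sets m"
    by (intro null_sets_UN') (auto simp: null_sets_def z v sets_m near_sets)
  moreover have "isoms \<subseteq> (\<Union>i\<in>J. near (v i) R)"
  proof
    fix x :: "'a \<Rightarrow> 'a" assume x: "x \<in> isoms"
    obtain i where i: "dist (w i) (x p) < R / 2" using dense[of "R / 2" "x p"] assms by auto
    then have "i \<in> J" using x by (auto simp: J_def)
    moreover have "dist (v i p) (x p) \<le> R"
      using v(2)[OF \<open>i \<in> J\<close>] i dist_triangle[of "v i p" "x p" "w i"] by (simp add: dist_commute)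
    ultimately show "x \<in> (\<Union>i\<in>J. near (v i) R)" using x by (auto simp: near_def)
  qed
  moreover have "isoms \<in> sets m" using sets.top[of m] by simp
  ultimately have "isoms \<in> null_sets m" using null_sets_subset by blast
  then show False using haar by (auto simp: haar_measure_def null_sets_def)
qed

lemma nn_integral_translate:
  assumes g: "g \<in> isoms" and f: "f \<in> borel_measurable isom_borel"
  shows "(\<integral>\<^sup>+x. f (inv g \<circ> x) \<partial>m) = (\<integral>\<^sup>+x. f x \<partial>m)"
proof -
  have "(\<lambda>x. inv g \<circ> x) \<in> measurable isom_borel isom_borel"
    by (intro measurable_comp_isom measurable_const) (auto simp: isoms_inv[OF g])
  then have M: "(\<lambda>x. inv g \<circ> x) \<in> measurable m m"
    by (simp add: measurable_cong_sets[OF sets_m sets_m])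
  have "distr m m (\<lambda>x. inv g \<circ> x) = m"
  proof (rule measure_eqI)
    fix A assume "A \<in> sets (distr m m (\<lambda>x. inv g \<circ> x))"
    then have A: "A \<in> sets m" by simp
    then have Ai: "A \<subseteq> isoms" using sets.sets_into_space[OF A] by simp
    have "(\<lambda>x. inv g \<circ> x) -` A \<inter> isoms = (\<lambda>h. g \<circ> h) ` A"
    proof (intro equalityI subsetI)
      fix x assume x: "x \<in> (\<lambda>x. inv g \<circ> x) -` A \<inter> isoms"
      have "x = g \<circ> (inv g \<circ> x)" using isoms_inv_comp(2)[OF g] by (simp flip: comp_assoc)
      then show "x \<in> (\<lambda>h. g \<circ> h) ` A" using x by (intro rev_image_eqI[of "inv g \<circ> x"]) auto
    next
      fix x assume "x \<in> (\<lambda>h. g \<circ> h) ` A"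
      then obtain h where h: "h \<in> A" "x = g \<circ> h" by auto
      have "inv g \<circ> x = h" using isoms_inv_comp(1)[OF g] by (simp add: h flip: comp_assoc)
      then show "x \<in> (\<lambda>x. inv g \<circ> x) -` A \<inter> isoms" using h Ai g by (auto intro: isoms_comp)
    qed
    then show "emeasure (distr m m (\<lambda>x. inv g \<circ> x)) A = emeasure m A"
      using A emeasure_translate[OF g, of A] by (simp add: emeasure_distr[OF M A] sets_m)
  qed simp
  then have "(\<integral>\<^sup>+x. f x \<partial>m) = (\<integral>\<^sup>+x. f x \<partial>distr m m (\<lambda>x. inv g \<circ> x))" by simp
  also have "\<dots> = (\<integral>\<^sup>+x. f (inv g \<circ> x) \<partial>m)"
    by (rule nn_integral_distr[OF M]) (simp add: measurable_cong_sets[OF sets_m refl] f)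
  finally show ?thesis by simp
qed

section \<open>Square-integrable functions and the norm of the regular representation\<close>

definition N2 :: "(('a \<Rightarrow> 'a) \<Rightarrow> complex) \<Rightarrow> ennreal" where
  "N2 f = (\<integral>\<^sup>+x. ennreal ((cmod (f x))\<^sup>2) \<partial>m)"

lemma square_integrable_iff:
  "f \<in> square_integrable m \<longleftrightarrow> f \<in> borel_measurable isom_borel \<and> N2 f < \<infinity>"
proof -
  have "(\<lambda>x. (cmod (f x))\<^sup>2) \<in> borel_measurable m" if "f \<in> borel_measurable m"
    using that by measurable
  then show ?thesis
    by (auto simp: square_integrable_def N2_def integrable_iff_bounded measurable_cong_sets[OF sets_m refl])
qed

lemma norm_L2_eq:
  assumes "f \<in> borel_measurable isom_borel"
  shows "norm_L2 m f = sqrt (enn2real (N2 f))"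
proof -
  have "f \<in> borel_measurable m" using assms by (simp add: measurable_cong_sets[OF sets_m refl])
  then have "(\<lambda>x. (cmod (f x))\<^sup>2) \<in> borel_measurable m" by measurable
  then show ?thesis unfolding norm_L2_def N2_def by (subst integral_eq_nn_integral) auto
qed

lemma norm_L2_N2:
  assumes "f \<in> square_integrable m"
  shows "ennreal ((norm_L2 m f)\<^sup>2) = N2 f"
  using assms by (simp add: norm_L2_eq square_integrable_iff less_top)

text \<open>By Cauchy-Schwarz the squared mean is at most the mean of the square, and each left
  translation preserves the Haar integral. This makes the supremum in \<open>regular_norm\<close>
  one over a bounded set.\<close>

lemma left_regular_measure_contract:
  assumes \<nu>: "isom_prob \<nu>" and f: "f \<in> square_integrable m"
  shows "left_regular_measure \<nu> f \<in> square_integrable m"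
    and "norm_L2 m (left_regular_measure \<nu> f) \<le> norm_L2 m f"
proof -
  interpret \<nu>: prob_space \<nu> using \<nu> by (simp add: isom_prob_simps)
  have s\<nu>[measurable_cong]: "sets \<nu> = sets isom_borel" using \<nu> by (simp add: isom_prob_simps)
  have fm[measurable]: "f \<in> borel_measurable isom_borel" using f by (simp add: square_integrable_iff)
  have [measurable]: "(\<lambda>(x, g). f (inv g \<circ> x)) \<in> borel_measurable (m \<Otimes>\<^sub>M \<nu>)"
    unfolding split_beta' by measurable
  have mf[measurable]: "left_regular_measure \<nu> f \<in> borel_measurable m"
    unfolding left_regular_measure_def left_regular_def
    by (rule \<nu>.borel_measurable_lebesgue_integral) simp
  have pt: "ennreal ((cmod (left_regular_measure \<nu> f x))\<^sup>2)
      \<le> (\<integral>\<^sup>+g. ennreal ((cmod (f (inv g \<circ> x)))\<^sup>2) \<partial>\<nu>)" if x: "x \<in> isoms" for x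
  proof (cases "integrable \<nu> (\<lambda>g. f (inv g \<circ> x))")
    case True
    have [measurable]: "(\<lambda>g. f (inv g \<circ> x)) \<in> borel_measurable \<nu>" using True by auto
    have "ennreal ((cmod (left_regular_measure \<nu> f x))\<^sup>2) = (ennreal (cmod (left_regular_measure \<nu> f x)))\<^sup>2"
      by (simp add: ennreal_power)
    also have "\<dots> \<le> (\<integral>\<^sup>+g. ennreal (cmod (f (inv g \<circ> x))) * 1 \<partial>\<nu>)\<^sup>2"
      unfolding left_regular_measure_def left_regular_def
      using integral_norm_bound_ennreal[OF True] by (intro power_mono) auto
    also have "\<dots> \<le> (\<integral>\<^sup>+g. (ennreal (cmod (f (inv g \<circ> x))))\<^sup>2 \<partial>\<nu>) * (\<integral>\<^sup>+g. 1\<^sup>2 \<partial>\<nu>)"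
      by (rule Cauchy_Schwarz_nn_integral) auto
    finally show ?thesis by (simp add: \<nu>.emeasure_space_1 ennreal_power)
  next
    \<comment> \<open>The Bochner integral of a non-integrable function is 0, so the bound is
      trivial.\<close>
    case False
    then show ?thesis by (simp add: left_regular_measure_def left_regular_def not_integrable_integral_eq)
  qed
  interpret pair_sigma_finite m \<nu> ..
  have "N2 (left_regular_measure \<nu> f) \<le> (\<integral>\<^sup>+x. \<integral>\<^sup>+g. ennreal ((cmod (f (inv g \<circ> x)))\<^sup>2) \<partial>\<nu> \<partial>m)"
    unfolding N2_def using pt by (intro nn_integral_mono) simp
  also have "\<dots> = (\<integral>\<^sup>+g. \<integral>\<^sup>+x. ennreal ((cmod (f (inv g \<circ> x)))\<^sup>2) \<partial>m \<partial>\<nu>)"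
    by (rule Fubini'[symmetric]) measurable
  also have "\<dots> = (\<integral>\<^sup>+g. N2 f \<partial>\<nu>)"
    unfolding N2_def
    by (intro nn_integral_cong nn_integral_translate) (auto simp: isom_prob_simps[OF \<nu>])
  also have "\<dots> = N2 f" by (simp add: \<nu>.emeasure_space_1)
  finally have le: "N2 (left_regular_measure \<nu> f) \<le> N2 f" .
  with f mf show "left_regular_measure \<nu> f \<in> square_integrable m"
    by (auto simp: square_integrable_iff measurable_cong_sets[OF sets_m refl])
  with f le show "norm_L2 m (left_regular_measure \<nu> f) \<le> norm_L2 m f"
    by (auto simp: square_integrable_iff norm_L2_eq intro!: enn2real_mono)
qed

lemma norm_L2_scale: "norm_L2 m (\<lambda>x. of_real c * f x) = \<bar>c\<bar> * norm_L2 m f"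
  by (simp add: norm_L2_def norm_mult power_mult_distrib real_sqrt_mult)

lemma regular_norm_bdd:
  assumes "isom_prob \<nu>"
  shows "bdd_above ((\<lambda>f. norm_L2 m (left_regular_measure \<nu> f)) ` {f \<in> square_integrable m. norm_L2 m f \<le> 1})"
  using left_regular_measure_contract[OF assms] by (intro bdd_aboveI2[where M = 1]) force

lemma regular_norm_nonneg:
  assumes "isom_prob \<nu>" shows "0 \<le> regular_norm m \<nu>"
proof -
  have "(\<lambda>_. 0) \<in> {f \<in> square_integrable m. norm_L2 m f \<le> 1}"
    by (simp add: square_integrable_def norm_L2_def)
  from cSUP_upper[OF this regular_norm_bdd[OF assms]] show ?thesis
    unfolding regular_norm_def by (simp add: norm_L2_def left_regular_measure_def left_regular_def)
qed

lemma left_regular_measure_bound: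
  assumes \<nu>: "isom_prob \<nu>" and f: "f \<in> square_integrable m"
  shows "norm_L2 m (left_regular_measure \<nu> f) \<le> regular_norm m \<nu> * norm_L2 m f"
proof (cases "norm_L2 m f = 0")
  \<comment> \<open>A function of norm 0 cannot be normalised; the contraction property covers
    it.\<close>
  case True
  then show ?thesis using left_regular_measure_contract(2)[OF \<nu> f] by simp
next
  case False
  define c where "c = 1 / norm_L2 m f"
  have pos: "0 < norm_L2 m f" using False by (simp add: norm_L2_def less_le)
  then have c: "0 < c" "c * norm_L2 m f = 1" by (auto simp: c_def)
  define g where "g = (\<lambda>x. of_real c * f x)"
  have "g \<in> square_integrable m"
    using f by (auto simp: square_integrable_def g_def norm_mult power_mult_distrib)
  moreover have "norm_L2 m g \<le> 1" unfolding g_def norm_L2_scale using c by simp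
  ultimately have "norm_L2 m (left_regular_measure \<nu> g) \<le> regular_norm m \<nu>"
    unfolding regular_norm_def by (intro cSUP_upper regular_norm_bdd[OF \<nu>]) simp
  also have "left_regular_measure \<nu> g = (\<lambda>x. of_real c * left_regular_measure \<nu> f x)"
    by (simp add: left_regular_measure_def left_regular_def g_def)
  finally have "c * norm_L2 m (left_regular_measure \<nu> f) \<le> regular_norm m \<nu>"
    unfolding norm_L2_scale using c by simp
  then show ?thesis using pos by (simp add: c_def field_simps)
qed

section \<open>Smoothing a law over balls\<close>

lemma nn_indicator_Fubini:
  assumes \<xi>: "isom_prob \<xi>" and A: "A \<in> sets isom_borel"
  shows "(\<integral>\<^sup>+x. indicator A x * emeasure \<xi> (near x R) \<partial>m) = (\<integral>\<^sup>+v. emeasure m (A \<inter> near v R) \<partial>\<xi>)"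
proof -
  interpret \<xi>: prob_space \<xi> using \<xi> by (simp add: isom_prob_simps)
  have s\<xi>[measurable_cong]: "sets \<xi> = sets isom_borel" using \<xi> by (simp add: isom_prob_simps)
  interpret pair_sigma_finite m \<xi> ..
  define D where "D = {xv \<in> space (m \<Otimes>\<^sub>M \<xi>). dist (fst xv p) (snd xv p) \<le> R}"
  have [measurable]: "D \<in> sets (m \<Otimes>\<^sub>M \<xi>)" unfolding D_def by measurable
  have [measurable]: "A \<in> sets m" using A by (simp add: sets_m)
  have D: "indicator A x * indicator (near x R) v = indicator A x * (indicator D (x, v) :: ennreal)"
      "indicator A x * (indicator D (x, v) :: ennreal) = indicator (A \<inter> near v R) x"
    if "x \<in> isoms" "v \<in> isoms" for x v
    using that by (auto simp: D_def near_def space_pair_measure isom_prob_simps(3)[OF \<xi>] dist_commute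
        split: split_indicator)
  have "(\<integral>\<^sup>+x. indicator A x * emeasure \<xi> (near x R) \<partial>m)
      = (\<integral>\<^sup>+x. \<integral>\<^sup>+v. indicator A x * indicator (near x R) v \<partial>\<xi> \<partial>m)"
    by (intro nn_integral_cong, subst nn_integral_cmult) (auto simp: s\<xi> near_sets)
  also have "\<dots> = (\<integral>\<^sup>+x. \<integral>\<^sup>+v. indicator A x * indicator D (x, v) \<partial>\<xi> \<partial>m)"
    using D by (intro nn_integral_cong) (simp add: isom_prob_simps(3)[OF \<xi>])
  also have "\<dots> = (\<integral>\<^sup>+v. \<integral>\<^sup>+x. indicator A x * indicator D (x, v) \<partial>m \<partial>\<xi>)"
    by (rule Fubini'[symmetric]) measurable
  also have "\<dots> = (\<integral>\<^sup>+v. \<integral>\<^sup>+x. indicator (A \<inter> near v R) x \<partial>m \<partial>\<xi>)"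
    using D by (intro nn_integral_cong) (simp add: isom_prob_simps(3)[OF \<xi>])
  also have "\<dots> = (\<integral>\<^sup>+v. emeasure m (A \<inter> near v R) \<partial>\<xi>)"
    by (intro nn_integral_cong nn_integral_indicator) (use A near_sets in \<open>auto simp: sets_m\<close>)
  finally show ?thesis .
qed

text \<open>A law may be singular with respect to Haar measure, but its mass in the ball around
  \<open>x\<close> is a bounded function of \<open>x\<close>, on which the regular representation
  can act.\<close>

definition smear :: "real \<Rightarrow> ('a \<Rightarrow> 'a) measure \<Rightarrow> ('a \<Rightarrow> 'a) \<Rightarrow> real" where
  "smear R \<xi> x = measure \<xi> (near x R)"

lemma smear_bounds: "isom_prob \<xi> \<Longrightarrow> 0 \<le> smear R \<xi> x" "isom_prob \<xi> \<Longrightarrow> smear R \<xi> x \<le> 1"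
  by (auto simp: smear_def isom_prob_simps(1) prob_space.prob_le_1)

lemma borel_measurable_smear:
  assumes \<xi>: "isom_prob \<xi>"
  shows "smear R \<xi> \<in> borel_measurable isom_borel"
proof -
  interpret \<xi>: prob_space \<xi> using \<xi> by (simp add: isom_prob_simps)
  have s\<xi>[measurable_cong]: "sets \<xi> = sets isom_borel" using \<xi> by (simp add: isom_prob_simps)
  have "(\<lambda>x. emeasure \<xi> {v \<in> space \<xi>. dist (x p) (v p) \<le> R}) \<in> borel_measurable isom_borel"
    by measurable
  then have "(\<lambda>x. enn2real (emeasure \<xi> {v \<in> space \<xi>. dist (x p) (v p) \<le> R})) \<in> borel_measurable isom_borel"
    by measurable
  then show ?thesis
    by (simp add: smear_def[abs_def] near_def measure_def isom_prob_simps(3)[OF \<xi>])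
qed

lemma emeasure_smear: "isom_prob \<xi> \<Longrightarrow> emeasure \<xi> (near x R) = ennreal (smear R \<xi> x)"
  by (simp add: smear_def isom_prob_simps(1) finite_measure.emeasure_eq_measure prob_space.finite_measure)

text \<open>A function with values in [0, 1] has square at most itself, and its integral is the
  volume of one ball by Fubini and left invariance. The bound is the same for every law, which is
  what admits arbitrary waypoint laws.\<close>

lemma smear_initial:
  assumes \<xi>: "isom_prob \<xi>"
  shows "(\<lambda>x. complex_of_real (smear R \<xi> x)) \<in> square_integrable m"
    and "norm_L2 m (\<lambda>x. complex_of_real (smear R \<xi> x)) \<le> sqrt (V R)"
proof -
  interpret \<xi>: prob_space \<xi> using \<xi> by (simp add: isom_prob_simps)
  let ?f = "\<lambda>x. complex_of_real (smear R \<xi> x)"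
  have m: "?f \<in> borel_measurable isom_borel"
    using borel_measurable_smear[OF \<xi>] by measurable
  have "N2 ?f \<le> (\<integral>\<^sup>+x. indicator isoms x * emeasure \<xi> (near x R) \<partial>m)"
    unfolding N2_def
  proof (intro nn_integral_mono)
    fix x assume "x \<in> space m"
    have "(smear R \<xi> x)\<^sup>2 \<le> smear R \<xi> x"
      using smear_bounds[OF \<xi>, of R x] by (simp add: power2_eq_square mult_left_le)
    then show "ennreal ((cmod (?f x))\<^sup>2) \<le> indicator isoms x * emeasure \<xi> (near x R)"
      using \<open>x \<in> space m\<close> by (simp add: emeasure_smear[OF \<xi>] ennreal_leI)
  qed
  also have "\<dots> = (\<integral>\<^sup>+v. emeasure m (isoms \<inter> near v R) \<partial>\<xi>)"
    using sets.top[of isom_borel] by (intro nn_indicator_Fubini[OF \<xi>]) simp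
  also have "\<dots> = (\<integral>\<^sup>+v. ennreal (V R) \<partial>\<xi>)"
  proof (intro nn_integral_cong)
    fix v assume "v \<in> space \<xi>"
    then have "v \<in> isoms" by (simp add: isom_prob_simps(3)[OF \<xi>])
    moreover have "isoms \<inter> near v R = near v R" by (auto simp: near_def)
    ultimately show "emeasure m (isoms \<inter> near v R) = ennreal (V R)"
      by (simp add: emeasure_near emeasure_V)
  qed
  also have "\<dots> = ennreal (V R)" by (simp add: \<xi>.emeasure_space_1)
  finally have le: "N2 ?f \<le> ennreal (V R)" .
  then show "?f \<in> square_integrable m" using m by (auto simp: square_integrable_iff intro: le_less_trans)
  have "enn2real (N2 ?f) \<le> V R" using le by (intro enn2real_leI) (auto simp: V_def)
  then show "norm_L2 m ?f \<le> sqrt (V R)" by (simp add: norm_L2_eq[OF m])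
qed

text \<open>Since \<open>dist (x p) (g (h p)) = dist (inv g (x p)) (h p)\<close>, smoothing
  intertwines convolution with the left regular representation.\<close>

lemma smear_conv:
  assumes \<nu>: "isom_prob \<nu>" and \<xi>: "isom_prob \<xi>" and x: "x \<in> isoms"
  shows "left_regular_measure \<nu> (\<lambda>x. complex_of_real (smear R \<xi> x)) x = complex_of_real (smear R (conv \<nu> \<xi>) x)"
proof -
  interpret \<nu>: prob_space \<nu> using \<nu> by (simp add: isom_prob_simps)
  have s\<nu>[measurable_cong]: "sets \<nu> = sets isom_borel" using \<nu> by (simp add: isom_prob_simps)
  note [measurable] = borel_measurable_smear[OF \<xi>, of R]
  have "(\<lambda>g. inv g \<circ> x) \<in> measurable \<nu> isom_borel"
    using x by (intro measurable_comp_isom measurable_inv_isom measurable_const)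
      (auto simp: measurable_ident_sets[OF s\<nu>])
  from measurable_compose[OF this borel_measurable_smear[OF \<xi>, of R]]
  have m: "(\<lambda>g. smear R \<xi> (inv g \<circ> x)) \<in> borel_measurable \<nu>" .
  have "emeasure (conv \<nu> \<xi>) (near x R) = (\<integral>\<^sup>+v. indicator (near x R) v \<partial>conv \<nu> \<xi>)"
    by (rule nn_integral_indicator[symmetric]) (simp add: isom_prob_simps(2)[OF isom_prob_conv[OF \<nu> \<xi>]] near_sets)
  also have "\<dots> = (\<integral>\<^sup>+g. \<integral>\<^sup>+h. indicator (near x R) (g \<circ> h) \<partial>\<xi> \<partial>\<nu>)"
    by (rule nn_integral_conv[OF \<nu> \<xi>]) (simp add: near_sets)
  also have "\<dots> = (\<integral>\<^sup>+g. ennreal (smear R \<xi> (inv g \<circ> x)) \<partial>\<nu>)"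
  proof (intro nn_integral_cong)
    fix g assume "g \<in> space \<nu>"
    then have g: "g \<in> isoms" by (simp add: isom_prob_simps(3)[OF \<nu>])
    have "(\<integral>\<^sup>+h. indicator (near x R) (g \<circ> h) \<partial>\<xi>) = (\<integral>\<^sup>+h. indicator (near (inv g \<circ> x) R) h \<partial>\<xi>)"
      using g by (intro nn_integral_cong)
        (auto simp: near_def isom_prob_simps(3)[OF \<xi>] isoms_dist_inv intro: isoms_comp split: split_indicator)
    also have "\<dots> = emeasure \<xi> (near (inv g \<circ> x) R)"
      by (rule nn_integral_indicator) (simp add: isom_prob_simps(2)[OF \<xi>] near_sets)
    finally show "(\<integral>\<^sup>+h. indicator (near x R) (g \<circ> h) \<partial>\<xi>) = ennreal (smear R \<xi> (inv g \<circ> x))"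
      by (simp add: emeasure_smear[OF \<xi>])
  qed
  finally have "enn2real (emeasure (conv \<nu> \<xi>) (near x R)) = (\<integral>g. smear R \<xi> (inv g \<circ> x) \<partial>\<nu>)"
    using m smear_bounds[OF \<xi>] by (subst integral_eq_nn_integral) auto
  then show ?thesis
    by (simp add: left_regular_measure_def left_regular_def smear_def measure_def)
qed

lemma smear_iter:
  assumes \<nu>: "isom_prob \<nu>" and \<xi>: "isom_prob \<xi>"
  shows "(\<lambda>x. complex_of_real (smear R (conv_iter \<nu> \<xi> n) x)) \<in> square_integrable m \<and>
    norm_L2 m (\<lambda>x. complex_of_real (smear R (conv_iter \<nu> \<xi> n) x)) \<le> regular_norm m \<nu> ^ n * sqrt (V R)"
proof (induction n)
  case 0
  show ?case using smear_initial[OF \<xi>] by simp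
next
  case (Suc n)
  let ?f = "\<lambda>n x. complex_of_real (smear R (conv_iter \<nu> \<xi> n) x)"
  have eq: "left_regular_measure \<nu> (?f n) x = ?f (Suc n) x" if "x \<in> isoms" for x
    using smear_conv[OF \<nu> isom_prob_conv_iter[OF \<nu> \<xi>] that] by simp
  have f: "?f n \<in> square_integrable m" using Suc by simp
  have "norm_L2 m (?f (Suc n)) = norm_L2 m (left_regular_measure \<nu> (?f n))"
    unfolding norm_L2_def using eq by (intro arg_cong[where f = sqrt] Bochner_Integration.integral_cong) auto
  also have "\<dots> \<le> regular_norm m \<nu> * norm_L2 m (?f n)" by (rule left_regular_measure_bound[OF \<nu> f])
  also have "\<dots> \<le> regular_norm m \<nu> * (regular_norm m \<nu> ^ n * sqrt (V R))"
    using Suc by (intro mult_left_mono regular_norm_nonneg[OF \<nu>]) auto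
  finally have "norm_L2 m (?f (Suc n)) \<le> regular_norm m \<nu> ^ Suc n * sqrt (V R)" by (simp add: mult.assoc)
  moreover have "?f (Suc n) \<in> square_integrable m"
  proof -
    have "N2 (?f (Suc n)) = N2 (left_regular_measure \<nu> (?f n))"
      unfolding N2_def using eq by (intro nn_integral_cong) simp
    moreover have "?f (Suc n) \<in> borel_measurable isom_borel"
      using borel_measurable_smear[OF isom_prob_conv_iter[OF \<nu> \<xi>]] by measurable
    ultimately show ?thesis
      using left_regular_measure_contract(1)[OF \<nu> f] unfolding square_integrable_iff by metis
  qed
  ultimately show ?case by blast
qed

text \<open>Smoothing the law at scale \<open>R\<close> turns it into a square-integrable function, to which
  the norm bound of the regular representation applies.\<close>

lemma conv_iter_near_bound:
  assumes \<nu>: "isom_prob \<nu>" and \<xi>: "isom_prob \<xi>" and u: "u \<in> isoms" and R: "0 < R"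
  shows "measure (conv_iter \<nu> \<xi> n) (near u R) \<le> sqrt (V (2 * R) / V R) * regular_norm m \<nu> ^ n"
proof -
  define \<zeta> where "\<zeta> = conv_iter \<nu> \<xi> n"
  have \<zeta>: "isom_prob \<zeta>" unfolding \<zeta>_def by (rule isom_prob_conv_iter[OF \<nu> \<xi>])
  interpret \<zeta>: prob_space \<zeta> using \<zeta> by (simp add: isom_prob_simps)
  let ?f = "\<lambda>x. complex_of_real (smear R \<zeta> x)"
  have f: "?f \<in> square_integrable m" "norm_L2 m ?f \<le> regular_norm m \<nu> ^ n * sqrt (V R)"
    using smear_iter[OF \<nu> \<xi>, of R n] by (auto simp: \<zeta>_def)
  have sm: "smear R \<zeta> \<in> borel_measurable m"
    using borel_measurable_smear[OF \<zeta>] by (simp add: measurable_cong_sets[OF sets_m refl])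
  have V: "0 < V R" "0 \<le> V (2 * R)" using V_pos[OF R] by (auto simp: V_def)
  \<comment> \<open>A point of \<open>near u R\<close> spreads its mass over a ball that stays
    inside \<open>near u (2 * R)\<close>. Pairing the smoothed law with the indicator of the double
    ball, Cauchy-Schwarz then produces the volume ratio.\<close>
  have "ennreal (measure \<zeta> (near u R) * V R) = (\<integral>\<^sup>+v. ennreal (V R) * indicator (near u R) v \<partial>\<zeta>)"
    using V by (subst nn_integral_cmult_indicator)
      (auto simp: isom_prob_simps(2)[OF \<zeta>] near_sets \<zeta>.emeasure_eq_measure ennreal_mult mult.commute)
  also have "\<dots> \<le> (\<integral>\<^sup>+v. emeasure m (near u (2 * R) \<inter> near v R) \<partial>\<zeta>)"
  proof (intro nn_integral_mono)
    fix v assume "v \<in> space \<zeta>"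
    then have v: "v \<in> isoms" by (simp add: isom_prob_simps(3)[OF \<zeta>])
    show "ennreal (V R) * indicator (near u R) v \<le> emeasure m (near u (2 * R) \<inter> near v R)"
    proof (cases "v \<in> near u R")
      case True
      have "near v R \<subseteq> near u (2 * R)"
      proof
        fix x assume "x \<in> near v R"
        with True dist_triangle[of "u p" "x p" "v p"] show "x \<in> near u (2 * R)" by (auto simp: near_def)
      qed
      then have "near u (2 * R) \<inter> near v R = near v R" by blast
      with v True show ?thesis by (simp add: emeasure_near emeasure_V)
    qed simp
  qed
  also have "\<dots> = (\<integral>\<^sup>+x. indicator (near u (2 * R)) x * ennreal (smear R \<zeta> x) \<partial>m)"
    using nn_indicator_Fubini[OF \<zeta> near_sets, of u "2 * R" R] by (simp add: emeasure_smear[OF \<zeta>])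
  finally have 1: "ennreal (measure \<zeta> (near u R) * V R)
      \<le> (\<integral>\<^sup>+x. indicator (near u (2 * R)) x * ennreal (smear R \<zeta> x) \<partial>m)" .
  have "(ennreal (measure \<zeta> (near u R) * V R))\<^sup>2
      \<le> (\<integral>\<^sup>+x. indicator (near u (2 * R)) x * ennreal (smear R \<zeta> x) \<partial>m)\<^sup>2"
    using 1 by (intro power_mono) auto
  also have "\<dots> \<le> (\<integral>\<^sup>+x. (indicator (near u (2 * R)) x)\<^sup>2 \<partial>m) * (\<integral>\<^sup>+x. (ennreal (smear R \<zeta> x))\<^sup>2 \<partial>m)"
    using sm by (intro Cauchy_Schwarz_nn_integral) (auto simp: sets_m near_sets)
  also have "(\<integral>\<^sup>+x. (indicator (near u (2 * R)) x)\<^sup>2 \<partial>m) = (\<integral>\<^sup>+x. indicator (near u (2 * R)) x \<partial>m)"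
    by (intro nn_integral_cong) (auto split: split_indicator)
  also have "\<dots> = ennreal (V (2 * R))"
    using u by (subst nn_integral_indicator) (auto simp: sets_m near_sets emeasure_near emeasure_V)
  also have "(\<integral>\<^sup>+x. (ennreal (smear R \<zeta> x))\<^sup>2 \<partial>m) = N2 ?f"
    unfolding N2_def using smear_bounds[OF \<zeta>] by (intro nn_integral_cong) (simp add: ennreal_power)
  also have "\<dots> = ennreal ((norm_L2 m ?f)\<^sup>2)" by (rule norm_L2_N2[OF f(1), symmetric])
  finally have "ennreal ((measure \<zeta> (near u R) * V R)\<^sup>2) \<le> ennreal (V (2 * R) * (norm_L2 m ?f)\<^sup>2)"
    using V by (subst (asm) ennreal_power) (simp_all add: ennreal_mult)
  then have "(measure \<zeta> (near u R) * V R)\<^sup>2 \<le> V (2 * R) * (norm_L2 m ?f)\<^sup>2"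
    using V by (subst (asm) ennreal_le_iff) auto
  also have "\<dots> \<le> V (2 * R) * (regular_norm m \<nu> ^ n * sqrt (V R))\<^sup>2"
    using V f(2) by (intro mult_left_mono power_mono) (auto simp: norm_L2_def)
  also have "\<dots> = (sqrt (V (2 * R) * V R) * regular_norm m \<nu> ^ n)\<^sup>2"
    using V by (simp add: power_mult_distrib)
  finally have "measure \<zeta> (near u R) * V R \<le> sqrt (V (2 * R) * V R) * regular_norm m \<nu> ^ n"
    using V regular_norm_nonneg[OF \<nu>] by (rule_tac power2_le_imp_le) auto
  also have "sqrt (V (2 * R) * V R) = sqrt (V (2 * R) / V R) * V R"
    using V by (simp add: real_sqrt_mult real_sqrt_divide field_simps)
  finally show ?thesis using V by (simp add: \<zeta>_def field_simps)
qed

end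

subsection \<open>Tail of the Gromov product\<close>

lemma geometric_sum_le:
  fixes s :: real
  assumes "0 \<le> s" "s < 1" shows "(\<Sum>j<n. s ^ j) \<le> 1 / (1 - s)"
proof -
  have "(\<Sum>j<n. s ^ j) * (1 - s) = 1 - s ^ n" using assms by (simp add: sum_gp_strict)
  also have "\<dots> \<le> 1" using assms by simp
  finally show ?thesis using assms by (simp add: field_simps)
qed

lemma mult_power_le_inverse:
  fixes s :: real
  assumes "0 \<le> s" "s < 1" shows "real n * s ^ n \<le> 1 / (1 - s)"
proof -
  have "real n * s ^ n = (\<Sum>j<n. s ^ n)" by simp
  also have "\<dots> \<le> (\<Sum>j<n. s ^ j)" using assms by (intro sum_mono power_decreasing) auto
  finally show ?thesis using geometric_sum_le[OF assms, of n] by linarith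
qed

lemma power_le_exp:
  fixes s :: real
  assumes "0 \<le> s" shows "s ^ n \<le> exp (- ((1 - s) * real n))"
proof -
  have "s \<le> exp (- (1 - s))" using exp_ge_add_one_self[of "s - 1"] by simp
  then have "s ^ n \<le> exp (- (1 - s)) ^ n" using assms by (intro power_mono)
  then show ?thesis by (simp add: exp_of_nat_mult[symmetric] algebra_simps)
qed

text \<open>About \<open>ln C / (1 - s)\<close> terms are bounded by 1. By then \<open>C\<close> is
  used up, because \<open>s ^ k\<close> is at most \<open>exp (- ((1 - s) * k))\<close>, and a
  geometric series remains. So a prefactor costs only its logarithm.\<close>

lemma sum_min_geometric:
  fixes s C :: real and b :: "nat \<Rightarrow> real"
  assumes s: "0 \<le> s" "s < 1" and C: "1 \<le> C"
    and b: "\<And>n. b n \<le> 1" "\<And>n. b n \<le> C * s ^ n"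
  shows "(\<Sum>n<M. b n) \<le> (ln C + 2) / (1 - s)"
proof -
  define k where "k = nat \<lceil>ln C / (1 - s)\<rceil>"
  have lnC: "0 \<le> ln C / (1 - s)" using s C by simp
  then have k: "ln C / (1 - s) \<le> real k" "real k \<le> ln C / (1 - s) + 1"
    unfolding k_def by linarith+
  have "C * s ^ k \<le> C * exp (- ((1 - s) * real k))"
    using power_le_exp[OF s(1), of k] C by (intro mult_left_mono) auto
  also have "\<dots> \<le> C * exp (- ln C)" using k(1) s C by (simp add: field_simps)
  also have "\<dots> = 1" using C by (simp add: exp_minus)
  finally have Ck: "C * s ^ k \<le> 1" .
  have "b n \<le> (if n < k then 1 else 0) + (if k \<le> n then s ^ (n - k) else 0)" for n
  proof (cases "n < k")
    case False
    have "b n \<le> (C * s ^ k) * s ^ (n - k)" using b(2)[of n] False by (simp add: mult.assoc flip: power_add)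
    also have "\<dots> \<le> 1 * s ^ (n - k)" using Ck s by (intro mult_right_mono) auto
    finally show ?thesis using False by simp
  qed (use b(1) in simp)
  then have "(\<Sum>n<M. b n) \<le> (\<Sum>n<M. (if n < k then 1 else 0) + (if k \<le> n then s ^ (n - k) else 0))"
    by (rule sum_mono)
  also have "\<dots> = (\<Sum>n<M. if n < k then 1 else 0) + (\<Sum>n<M. if k \<le> n then s ^ (n - k) else 0)"
    by (rule sum.distrib)
  also have "(\<Sum>n<M. if n < k then 1 else (0::real)) \<le> real k"
  proof -
    have "(\<Sum>n<M. if n < k then 1 else (0::real)) = (\<Sum>n\<in>{..<M} \<inter> {..<k}. 1)"
      by (subst sum.inter_restrict) auto
    also have "\<dots> \<le> (\<Sum>n<k. 1)" by (rule sum_mono2) auto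
    finally show ?thesis by simp
  qed
  also have "(\<Sum>n<M. if k \<le> n then s ^ (n - k) else 0) \<le> (\<Sum>n<k + M. if k \<le> n then s ^ (n - k) else 0)"
    using s by (intro sum_mono2) auto
  also have "\<dots> = (\<Sum>n<k. if k \<le> n then s ^ (n - k) else 0) + (\<Sum>n\<in>{k..<k + M}. if k \<le> n then s ^ (n - k) else 0)"
    by (simp only: lessThan_atLeast0 sum.atLeastLessThan_concat[of 0 k "k + M"] le0 le_add1)
  also have "(\<Sum>n\<in>{k..<k + M}. if k \<le> n then s ^ (n - k) else 0) = (\<Sum>j<M. s ^ j)"
    using sum.shift_bounds_nat_ivl[of "\<lambda>n. if k \<le> n then s ^ (n - k) else 0" 0 k M]
    by (simp add: lessThan_atLeast0 add.commute)
  also have "(\<Sum>n<k. if k \<le> n then s ^ (n - k) else 0) = 0" by (rule sum.neutral) auto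
  finally have "(\<Sum>n<M. b n) \<le> real k + (\<Sum>j<M. s ^ j)" by simp
  also have "\<dots> \<le> ln C / (1 - s) + 1 + 1 / (1 - s)"
    using k(2) geometric_sum_le[OF s, of M] by linarith
  also have "\<dots> \<le> ln C / (1 - s) + 1 / (1 - s) + 1 / (1 - s)"
  proof -
    have "1 \<le> 1 / (1 - s)" using s by (simp add: pos_le_divide_eq)
    then show ?thesis by linarith
  qed
  also have "\<dots> = (ln C + 2) / (1 - s)" by (simp flip: add_divide_distrib)
  finally show ?thesis .
qed

lemma isom_prob_AE_iff:
  assumes "isom_prob \<mu>" "{g \<in> isoms. \<not> P g} \<in> sets isom_borel"
  shows "(AE g in \<mu>. P g) \<longleftrightarrow> (\<integral>\<^sup>+g. indicator {g \<in> isoms. \<not> P g} g \<partial>\<mu>) = 0"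
  using assms(2) AE_iff_measurable[of "{g \<in> isoms. \<not> P g}" \<mu> P]
  by (simp add: isom_prob_simps[OF assms(1)])

text \<open>\<open>\<kappa>\<close> is an almost sure bound for the length of one step, and
  \<open>\<rho>\<close> the radius in the denominator of the volume ratio, so that
  \<open>2 * \<rho>\<close> is the one in its numerator.\<close>

locale hyp_walk = haar_isoms w m p
  for w :: "nat \<Rightarrow> 'a::metric_space" and m :: "('a \<Rightarrow> 'a) measure" and p :: 'a +
  fixes \<delta> \<kappa> r \<rho> :: real and \<mu> :: "('a \<Rightarrow> 'a) measure"
  assumes geodesic: "geodesic_space TYPE('a)"
    and hyperbolic: "hyperbolic_space TYPE('a) \<delta>"
    and cocompact: "cocompact_action TYPE('a)"
    and \<mu>: "isom_prob \<mu>"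
    and \<rho>_eq: "\<rho> = hyp_radius \<delta> + 2 * quotient_diam TYPE('a)"
    and r: "0 \<le> r" "r < 1"
    and \<kappa>_pos: "0 < \<kappa>"
    and \<mu>_bounded: "AE g in \<mu>. displacement p g \<le> \<kappa>"
    and norm_less_1: "regular_norm m (lazy r \<mu>) < 1"
begin

abbreviation \<nu> :: "('a \<Rightarrow> 'a) measure" where "\<nu> \<equiv> lazy r \<mu>"
definition A\<^sub>0 :: real where "A\<^sub>0 = sqrt (V (2 * \<rho>) / V \<rho>)"
definition s :: real where "s = sqrt (regular_norm m \<nu>)"

lemma \<nu>: "isom_prob \<nu>" using r \<mu> by (intro isom_prob_lazy) auto

lemma \<delta>_nonneg: "0 \<le> \<delta>" by (rule hyperbolic_delta_nonneg[OF hyperbolic])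

lemma \<rho>_ge: "14 * \<delta> + 4 \<le> \<rho>" "0 < \<rho>"
  using \<delta>_nonneg quotient_diam_nonneg[OF cocompact] by (auto simp: \<rho>_eq hyp_radius_def)

lemma s: "0 \<le> s" "s < 1" "regular_norm m \<nu> ^ n = s ^ n * s ^ n"
proof -
  have l: "0 \<le> regular_norm m \<nu>" by (rule regular_norm_nonneg[OF \<nu>])
  show "0 \<le> s" "s < 1" using l norm_less_1 by (auto simp: s_def)
  have "regular_norm m \<nu> = s * s" using l by (simp add: s_def)
  then show "regular_norm m \<nu> ^ n = s ^ n * s ^ n" by (simp add: power_mult_distrib)
qed

lemma A\<^sub>0_ge_1: "1 \<le> A\<^sub>0"
proof -
  have "V \<rho> \<le> V (2 * \<rho>)"
  proof -
    have "emeasure m (isom_ball p \<rho>) \<le> emeasure m (isom_ball p (2 * \<rho>))"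
      using \<rho>_ge by (intro emeasure_mono) (auto simp: isom_ball_def sets_m isom_ball_sets[unfolded isom_ball_def])
    then show ?thesis by (simp add: emeasure_V V_def)
  qed
  then show ?thesis using V_pos[OF \<rho>_ge(2)] by (simp add: A\<^sub>0_def)
qed

lemma displaced_sets [measurable]: "{g \<in> isoms. \<not> displacement p g \<le> c} \<in> sets isom_borel"
proof -
  have "{g \<in> space isom_borel. \<not> displacement p g \<le> c} \<in> sets isom_borel" by measurable
  then show ?thesis by simp
qed

lemma \<nu>_bounded: "AE g in \<nu>. displacement p g \<le> \<kappa>"
proof -
  have "(\<integral>\<^sup>+g. indicator {g \<in> isoms. \<not> displacement p g \<le> \<kappa>} g \<partial>\<mu>) = 0"
    using \<mu>_bounded by (subst (asm) isom_prob_AE_iff[OF \<mu>]) auto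
  then show ?thesis
    using r \<kappa>_pos by (subst isom_prob_AE_iff[OF \<nu>]) (auto simp: nn_integral_lazy \<mu>)
qed

lemma conv_pow_bounded: "AE g in conv_pow \<nu> n. displacement p g \<le> \<kappa> * real n"
proof (induction n)
  case 0
  show ?case
    unfolding conv_iter.simps
    by (subst isom_prob_AE_iff[OF isom_prob_return displaced_sets], subst nn_integral_return) auto
next
  case (Suc n)
  let ?B = "\<lambda>n. {g \<in> isoms. \<not> displacement p g \<le> \<kappa> * real n}"
  note pow = isom_prob_conv_iter[OF \<nu> isom_prob_return]
  have "(\<integral>\<^sup>+g. indicator (?B (Suc n)) g \<partial>conv_pow \<nu> (Suc n))
      = (\<integral>\<^sup>+g. \<integral>\<^sup>+h. indicator (?B (Suc n)) (g \<circ> h) \<partial>conv_pow \<nu> n \<partial>\<nu>)"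
    unfolding conv_iter.simps by (rule nn_integral_conv[OF \<nu> pow]) simp
  also have "\<dots> \<le> (\<integral>\<^sup>+g. \<integral>\<^sup>+h. indicator (?B n) h \<partial>conv_pow \<nu> n \<partial>\<nu>)"
  proof (rule nn_integral_mono_AE, use \<nu>_bounded AE_space in eventually_elim)
    fix g assume g: "displacement p g \<le> \<kappa>" "g \<in> space \<nu>"
    then have gi: "g \<in> isoms" by (simp add: isom_prob_simps[OF \<nu>])
    show "(\<integral>\<^sup>+h. indicator (?B (Suc n)) (g \<circ> h) \<partial>conv_pow \<nu> n) \<le> (\<integral>\<^sup>+h. indicator (?B n) h \<partial>conv_pow \<nu> n)"
    proof (intro nn_integral_mono)
      fix h assume "h \<in> space (conv_pow \<nu> n)"
      then have "h \<in> isoms" by (simp add: isom_prob_simps[OF pow])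
      with displacement_comp[OF gi, of p h] g(1)
      show "indicator (?B (Suc n)) (g \<circ> h) \<le> (indicator (?B n) h :: ennreal)"
        by (auto simp: algebra_simps split: split_indicator)
    qed
  qed
  also have "(\<integral>\<^sup>+h. indicator (?B n) h \<partial>conv_pow \<nu> n) = 0"
    using Suc by (subst (asm) isom_prob_AE_iff[OF pow]) auto
  finally have "(\<integral>\<^sup>+g. indicator (?B (Suc n)) g \<partial>conv_pow \<nu> (Suc n)) = 0"
    by (simp only: nn_integral_const mult_zero_left le_zero_eq)
  then show ?case by (rule isom_prob_AE_iff[OF pow displaced_sets, THEN iffD2])
qed

section \<open>Waypoints on geodesics from the base point\<close>

definition rep :: "nat \<Rightarrow> 'a \<Rightarrow> 'a" where
  "rep i = (SOME g. g \<in> isoms \<and> dist (g p) (w i) < quotient_diam TYPE('a) + 1 / 4)"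

lemma rep: "rep i \<in> isoms" "dist (rep i p) (w i) < quotient_diam TYPE('a) + 1 / 4"
proof -
  have "\<exists>g. g \<in> isoms \<and> dist (g p) (w i) < quotient_diam TYPE('a) + 1 / 4"
    using quotient_diam_approx[OF cocompact, of "1 / 4" p "w i"] by auto
  from someI_ex[OF this] show "rep i \<in> isoms" "dist (rep i p) (w i) < quotient_diam TYPE('a) + 1 / 4"
    by (auto simp: rep_def)
qed

definition on_geodesic :: "nat \<Rightarrow> ('a \<Rightarrow> 'a) \<Rightarrow> nat \<Rightarrow> bool" where
  "on_geodesic k h i \<longleftrightarrow> \<bar>dist p (w i) - min (real k) (dist p (h p))\<bar> \<le> 1 / 4 \<and>
     dist p (w i) + dist (w i) (h p) \<le> dist p (h p) + 1 / 2"

text \<open>A group element moving \<open>p\<close> close to the point at distance \<open>k\<close> from \<open>p\<close> on a geodesic from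
  \<open>p\<close> to \<open>h p\<close>; the countable dense sequence makes the choice measurable in \<open>h\<close>.\<close>

definition waypoint :: "nat \<Rightarrow> ('a \<Rightarrow> 'a) \<Rightarrow> 'a \<Rightarrow> 'a" where
  "waypoint k h = rep (LEAST i. on_geodesic k h i)"

lemma ex_on_geodesic: "\<exists>i. on_geodesic k h i"
proof -
  obtain z where z: "dist p z = min (real k) (dist p (h p))"
      "dist z (h p) = dist p (h p) - min (real k) (dist p (h p))"
    using geodesic_point[OF geodesic, of "min (real k) (dist p (h p))" p "h p"] by auto
  obtain i where i: "dist (w i) z < 1 / 4" using dense[of "1 / 4" z] by auto
  have "dist p (w i) \<le> dist p z + dist (w i) z" "dist p z \<le> dist p (w i) + dist (w i) z"
      "dist (w i) (h p) \<le> dist (w i) z + dist z (h p)"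
    using dist_triangle[of p "w i" z] dist_triangle[of p z "w i"] dist_triangle[of "w i" "h p" z]
    by (auto simp: dist_commute)
  then have "on_geodesic k h i" unfolding on_geodesic_def using i z by (intro conjI; linarith)
  then show ?thesis ..
qed

lemma measurable_waypoint: "waypoint k \<in> measurable isom_borel isom_borel"
proof -
  have [measurable]: "Measurable.pred isom_borel (\<lambda>h. on_geodesic k h i)" for i
  proof -
    have F: "(\<lambda>h. dist p (h p)) \<in> borel_measurable isom_borel"
        "(\<lambda>h. dist (w i) (h p)) \<in> borel_measurable isom_borel"
      by (intro borel_measurable_dist_sep measurable_isom_eval measurable_const; simp)+
    have "Measurable.pred N (\<lambda>h. \<bar>c - min (real k) (F h)\<bar> \<le> 1 / 4 \<and> c + G h \<le> F h + 1 / 2)"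
      if "F \<in> borel_measurable N" "G \<in> borel_measurable N" for c F G and N :: "('a \<Rightarrow> 'a) measure"
      unfolding pred_def
      by (intro sets.sets_Collect_conj borel_measurable_le borel_measurable_add borel_measurable_abs
          borel_measurable_diff borel_measurable_min that borel_measurable_const)
    from this[OF F] show ?thesis unfolding on_geodesic_def .
  qed
  have "(\<lambda>h. LEAST i. on_geodesic k h i) \<in> measurable isom_borel (count_space UNIV)" by measurable
  moreover have "rep \<in> measurable (count_space UNIV) isom_borel" by (simp add: rep)
  ultimately show ?thesis unfolding waypoint_def by (rule measurable_compose)
qed

text \<open>At \<open>g\<close> the Gromov product with \<open>y\<close> is still at most
  \<open>a\<close>, at \<open>g \<circ> h\<close> it exceeds \<open>a + \<delta>\<close>, so the
  geodesic between their images of \<open>p\<close> passes near \<open>q\<close>. Both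
  \<open>g p\<close> and \<open>q\<close> are within \<open>a\<close> of \<open>p\<close>, so it
  does so at distance at most \<open>2 * a\<close> from its start; this limits the candidates for
  \<open>k\<close>.\<close>

lemma crossing_waypoint:
  assumes q: "dist p q = a" "dist q y = dist p y - a"
    and u: "u \<in> isoms" "dist (u p) q < quotient_diam TYPE('a) + 1 / 4"
    and gh: "g \<in> isoms" "h \<in> isoms" "displacement p g \<le> a"
    and far: "a + \<delta> < gromov_product p y (g (h p))"
  shows "\<exists>k \<le> nat \<lfloor>2 * a\<rfloor>. g \<circ> waypoint k h \<in> near u \<rho>"
proof -
  have g: "gromov_product p y (g p) \<le> displacement p g"
    using gromov_product_bounds(3) by (simp add: displacement_def)
  have "dist (g p) q + dist q (g (h p)) \<le> dist (g p) (g (h p)) + 6 * \<delta>"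
    by (rule crossing_near_point[OF hyperbolic q]) (use g gh far \<delta>_nonneg in linarith)+
  then have geo: "dist p (inv g q) + dist (inv g q) (h p) \<le> dist p (h p) + 6 * \<delta>"
    using gh by (simp add: isoms_dist_inv isoms_dist_inv' isoms_dist)
  define k where "k = nat \<lfloor>dist p (inv g q)\<rfloor>"
  have k: "real k \<le> dist p (inv g q)" "dist p (inv g q) \<le> real k + 1"
    using zero_le_dist[of p "inv g q"] unfolding k_def by linarith+
  have "dist p (inv g q) = dist (g p) q" using gh by (simp add: isoms_dist_inv')
  also have "\<dots> \<le> 2 * a"
    using dist_triangle[of "g p" q p] gh(3) q(1) by (simp add: displacement_def dist_commute)
  finally have "k \<le> nat \<lfloor>2 * a\<rfloor>" unfolding k_def by (intro nat_mono floor_mono)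
  moreover have "g \<circ> waypoint k h \<in> near u \<rho>"
  proof -
    define i where "i = (LEAST i. on_geodesic k h i)"
    have "on_geodesic k h i" unfolding i_def using ex_on_geodesic by (rule LeastI_ex)
    then have "dist (w i) (inv g q) \<le> 8 * \<delta> + 2"
      unfolding on_geodesic_def by (intro near_geodesic_close[OF hyperbolic geo k]) auto
    then have "dist (g (w i)) q \<le> 8 * \<delta> + 2" using gh by (simp add: isoms_dist_inv')
    moreover have "dist (g (rep i p)) (g (w i)) < quotient_diam TYPE('a) + 1 / 4"
      using rep(2)[of i] gh by (simp add: isoms_dist)
    \<comment> \<open>The error \<open>8 * \<delta> + 2\<close> of the geodesic point is increased
      twice by the quotient diameter plus 1/4, once for moving \<open>q\<close> into the orbit of
      \<open>p\<close> and once for moving \<open>w i\<close> there.\<close>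
    ultimately have "dist (u p) (g (rep i p)) \<le> 2 * quotient_diam TYPE('a) + 8 * \<delta> + 5 / 2"
      using u(2) dist_triangle[of "u p" "g (rep i p)" q] dist_triangle[of q "g (rep i p)" "g (w i)"]
      by (simp add: dist_commute)
    also have "\<dots> \<le> \<rho>" using \<delta>_nonneg by (simp add: \<rho>_eq hyp_radius_def)
    finally show ?thesis
      using gh rep(1)[of i] by (auto simp: near_def waypoint_def i_def intro: isoms_comp)
  qed
  ultimately show ?thesis by blast
qed

lemma borel_measurable_gromov_product [measurable]:
  "(\<lambda>h. gromov_product p y (h p)) \<in> borel_measurable isom_borel"
proof -
  have [measurable]: "(\<lambda>h. dist (h p) p) \<in> borel_measurable isom_borel"
      "(\<lambda>h. dist y (h p)) \<in> borel_measurable isom_borel"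
    by (intro borel_measurable_dist_sep measurable_isom_eval measurable_const; simp)+
  show ?thesis unfolding gromov_product_def by measurable
qed

definition far_set :: "'a \<Rightarrow> real \<Rightarrow> ('a \<Rightarrow> 'a) set" where
  "far_set y c = {h \<in> isoms. c < gromov_product p y (h p)}"

lemma far_set_sets [measurable]: "far_set y c \<in> sets isom_borel"
proof -
  have "{h \<in> space isom_borel. c < gromov_product p y (h p)} \<in> sets isom_borel" by measurable
  then show ?thesis by (simp add: far_set_def)
qed

text \<open>The shadow at depth \<open>\<kappa> N + \<delta>\<close> is only reached after passing near a fixed point \<open>q\<close>, at one of at
  most \<open>2 \<kappa> N + 1\<close> positions on the remaining geodesic.\<close>

lemma far_set_conv_bound:
  assumes \<eta>: "isom_prob \<eta>"
  shows "(\<integral>\<^sup>+g. \<integral>\<^sup>+h. indicator (far_set y (\<kappa> * real N + \<delta>)) (g \<circ> h) \<partial>\<eta> \<partial>conv_pow \<nu> N)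
    \<le> ennreal ((2 * \<kappa> * real N + 1) * A\<^sub>0 * regular_norm m \<nu> ^ N)"
proof -
  define a where "a = \<kappa> * real N"
  define K where "K = nat \<lfloor>2 * a\<rfloor>"
  define f where "f = (indicator (far_set y (a + \<delta>)) :: _ \<Rightarrow> ennreal)"
  note pow = isom_prob_conv_iter[OF \<nu> isom_prob_return]
  have a: "0 \<le> a" using \<kappa>_pos by (simp add: a_def)
  have "(\<integral>\<^sup>+g. \<integral>\<^sup>+h. f (g \<circ> h) \<partial>\<eta> \<partial>conv_pow \<nu> N)
      \<le> ennreal ((2 * a + 1) * A\<^sub>0 * regular_norm m \<nu> ^ N)"
  proof (cases "a \<le> dist p y")
    \<comment> \<open>The Gromov product never exceeds \<open>dist p y\<close>, so the far set is
      empty here, and there is no point at distance \<open>a\<close> on a geodesic from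
      \<open>p\<close> to \<open>y\<close>.\<close>
    case False
    have zero: "f (g \<circ> h) = 0" for g h :: "'a \<Rightarrow> 'a"
      using False gromov_product_bounds(2)[of p y "g (h p)"] \<delta>_nonneg
      by (auto simp: f_def far_set_def dist_commute split: split_indicator)
    have "(\<integral>\<^sup>+g. \<integral>\<^sup>+h. f (g \<circ> h) \<partial>\<eta> \<partial>conv_pow \<nu> N) = (\<integral>\<^sup>+g. \<integral>\<^sup>+h. 0 \<partial>\<eta> \<partial>conv_pow \<nu> N)"
      by (intro nn_integral_cong zero)
    then show ?thesis by simp
  next
    case True
    obtain q where q: "dist p q = a" "dist q y = dist p y - a"
      using geodesic_point[OF geodesic a True] by blast
    obtain u where u: "u \<in> isoms" "dist (u p) q < quotient_diam TYPE('a) + 1 / 4"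
      using quotient_diam_approx[OF cocompact, of "1 / 4" p q] by auto
    \<comment> \<open>For fixed \<open>k\<close> the waypoint depends on \<open>h\<close> alone, so
      composing it with N lazy steps is a convolution, to which the norm bound applies. Summing over
      all \<open>k\<close> makes it unnecessary to know which position is the right one, although
      that position depends on both \<open>g\<close> and \<open>h\<close>.\<close>
    define \<xi> where "\<xi> k = distr \<eta> isom_borel (waypoint k)" for k
    have wm: "waypoint k \<in> measurable \<eta> isom_borel" for k
      using measurable_waypoint by (simp add: measurable_cong_sets[OF isom_prob_simps(2)[OF \<eta>] refl])
    have \<xi>: "isom_prob (\<xi> k)" for k
      by (simp add: isom_prob_def \<xi>_def prob_space.prob_space_distr[OF isom_prob_simps(1)[OF \<eta>] wm])
    let ?I = "indicator (near u \<rho>) :: _ \<Rightarrow> ennreal"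
    have im: "(\<lambda>h. ?I (g \<circ> waypoint k h)) \<in> borel_measurable \<eta>" if "g \<in> isoms" for g k
      using measurable_compose[OF wm measurable_comp_left[OF _ that, of ?I]] near_sets by simp
    have "(\<integral>\<^sup>+g. \<integral>\<^sup>+h. f (g \<circ> h) \<partial>\<eta> \<partial>conv_pow \<nu> N)
        \<le> (\<integral>\<^sup>+g. (\<Sum>k\<le>K. \<integral>\<^sup>+v. ?I (g \<circ> v) \<partial>\<xi> k) \<partial>conv_pow \<nu> N)"
    proof (rule nn_integral_mono_AE, use conv_pow_bounded[of N] AE_space in eventually_elim)
      fix g assume g: "displacement p g \<le> \<kappa> * real N" "g \<in> space (conv_pow \<nu> N)"
      then have gi: "g \<in> isoms" by (simp add: isom_prob_simps[OF pow])
      have "(\<integral>\<^sup>+h. f (g \<circ> h) \<partial>\<eta>) \<le> (\<integral>\<^sup>+h. (\<Sum>k\<le>K. ?I (g \<circ> waypoint k h)) \<partial>\<eta>)"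
      proof (intro nn_integral_mono)
        fix h assume "h \<in> space \<eta>"
        then have hi: "h \<in> isoms" by (simp add: isom_prob_simps[OF \<eta>])
        show "f (g \<circ> h) \<le> (\<Sum>k\<le>K. ?I (g \<circ> waypoint k h))"
        proof (cases "g \<circ> h \<in> far_set y (a + \<delta>)")
          case True
          then have "a + \<delta> < gromov_product p y (g (h p))" by (simp add: far_set_def)
          from crossing_waypoint[OF q u gi hi _ this] g(1)
          obtain k where k: "k \<le> K" "g \<circ> waypoint k h \<in> near u \<rho>" by (auto simp: K_def a_def)
          have "f (g \<circ> h) \<le> ?I (g \<circ> waypoint k h)" using k by (simp add: f_def indicator_def)
          also have "\<dots> \<le> (\<Sum>k\<le>K. ?I (g \<circ> waypoint k h))"
            using k(1) by (intro member_le_sum) auto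
          finally show ?thesis .
        qed (simp add: f_def)
      qed
      also have "\<dots> = (\<Sum>k\<le>K. \<integral>\<^sup>+h. ?I (g \<circ> waypoint k h) \<partial>\<eta>)"
        by (rule nn_integral_sum) (rule im[OF gi])
      also have "\<dots> = (\<Sum>k\<le>K. \<integral>\<^sup>+v. ?I (g \<circ> v) \<partial>\<xi> k)"
        unfolding \<xi>_def
        using measurable_comp_left[OF _ gi, of ?I] near_sets
        by (intro sum.cong refl nn_integral_distr[symmetric] wm) simp
      finally show "(\<integral>\<^sup>+h. f (g \<circ> h) \<partial>\<eta>) \<le> (\<Sum>k\<le>K. \<integral>\<^sup>+v. ?I (g \<circ> v) \<partial>\<xi> k)" .
    qed
    also have "\<dots> = (\<Sum>k\<le>K. \<integral>\<^sup>+g. \<integral>\<^sup>+v. ?I (g \<circ> v) \<partial>\<xi> k \<partial>conv_pow \<nu> N)"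
      using borel_measurable_nn_integral_comp[OF \<xi>, of ?I] near_sets
      by (intro nn_integral_sum) (simp add: measurable_cong_sets[OF isom_prob_simps(2)[OF pow] refl])
    also have "\<dots> = (\<Sum>k\<le>K. \<integral>\<^sup>+x. ?I x \<partial>conv_iter \<nu> (\<xi> k) N)"
      using near_sets by (intro sum.cong refl nn_integral_conv_iter[OF \<nu> \<xi>, symmetric]) simp
    also have "\<dots> \<le> (\<Sum>k\<le>K. ennreal (A\<^sub>0 * regular_norm m \<nu> ^ N))"
    proof (intro sum_mono)
      fix k
      interpret z: prob_space "conv_iter \<nu> (\<xi> k) N"
        by (intro isom_prob_simps isom_prob_conv_iter \<nu> \<xi>)
      have "(\<integral>\<^sup>+x. ?I x \<partial>conv_iter \<nu> (\<xi> k) N) = emeasure (conv_iter \<nu> (\<xi> k) N) (near u \<rho>)"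
        by (rule nn_integral_indicator)
          (simp add: isom_prob_simps(2)[OF isom_prob_conv_iter[OF \<nu> \<xi>]] near_sets)
      also have "\<dots> \<le> ennreal (A\<^sub>0 * regular_norm m \<nu> ^ N)"
        unfolding z.emeasure_eq_measure A\<^sub>0_def
        by (intro ennreal_leI conv_iter_near_bound \<nu> \<xi> u \<rho>_ge)
      finally show "(\<integral>\<^sup>+x. ?I x \<partial>conv_iter \<nu> (\<xi> k) N) \<le> ennreal (A\<^sub>0 * regular_norm m \<nu> ^ N)" .
    qed
    also have "\<dots> = ennreal (real (Suc K) * (A\<^sub>0 * regular_norm m \<nu> ^ N))"
      using A\<^sub>0_ge_1 regular_norm_nonneg[OF \<nu>] by (simp add: ennreal_mult ennreal_of_nat_eq_real_of_nat del: of_nat_Suc)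
    also have "\<dots> \<le> ennreal ((2 * a + 1) * (A\<^sub>0 * regular_norm m \<nu> ^ N))"
    proof (intro ennreal_leI mult_right_mono)
      show "real (Suc K) \<le> 2 * a + 1" using a unfolding K_def by simp
      show "0 \<le> A\<^sub>0 * regular_norm m \<nu> ^ N" using A\<^sub>0_ge_1 regular_norm_nonneg[OF \<nu>] by simp
    qed
    finally show ?thesis by (simp add: mult.assoc)
  qed
  then show ?thesis by (simp add: f_def a_def mult.assoc)
qed

text \<open>By memorylessness, from a position where \<open>f\<close> vanishes the geometric clock may be made to
  wait for one more step, and a lazy step may replace it; this is what allows the norm of the lazy
  measure to be used for the walk itself.\<close>

lemma geometric_conv_far_step:
  assumes \<theta>: "0 < \<theta>" "\<theta> < 1"
    and f: "f \<in> borel_measurable isom_borel"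
    and zero: "\<And>g. g \<in> isoms \<Longrightarrow> displacement p g \<le> c \<Longrightarrow> f g = 0"
    and g: "g \<in> isoms" "displacement p g + \<kappa> * real j \<le> c"
  shows "(\<integral>\<^sup>+h. f (g \<circ> h) \<partial>geometric_conv \<theta> \<mu>)
    \<le> (\<integral>\<^sup>+x. \<integral>\<^sup>+h. f (g \<circ> x \<circ> h) \<partial>geometric_conv \<theta> \<mu> \<partial>conv_pow \<nu> j)"
  using g
proof (induction j arbitrary: g)
  define \<eta> where "\<eta> = geometric_conv \<theta> \<mu>"
  have \<eta>: "isom_prob \<eta>" unfolding \<eta>_def by (rule isom_prob_geometric_conv[OF \<mu>])
  note pow = isom_prob_conv_iter[OF \<nu> isom_prob_return]
  have fm: "(\<lambda>x. \<integral>\<^sup>+h. f (g \<circ> x \<circ> h) \<partial>\<eta>) \<in> borel_measurable isom_borel" if "g \<in> isoms" for g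
    using measurable_comp_left[OF borel_measurable_nn_integral_comp[OF \<eta> f] that] by (simp add: comp_assoc)
  {
    case 0
    have "(\<integral>\<^sup>+x. \<integral>\<^sup>+h. f (g \<circ> x \<circ> h) \<partial>\<eta> \<partial>return isom_borel id) = (\<integral>\<^sup>+h. f (g \<circ> id \<circ> h) \<partial>\<eta>)"
      using 0 by (intro nn_integral_return fm) simp_all
    then show ?case by (simp only: conv_iter.simps comp_id \<eta>_def order_refl)
  next
    case (Suc j)
    have gi: "g \<in> isoms" by fact
    define I where "I = (\<integral>\<^sup>+x. \<integral>\<^sup>+h. f (g \<circ> x \<circ> h) \<partial>\<eta> \<partial>\<mu>)"
    define J where "J = (\<integral>\<^sup>+h. f (g \<circ> h) \<partial>\<eta>)"
    have "f (g \<circ> id) = 0" using zero[OF gi] Suc.prems(2) \<kappa>_pos by (simp add: zero_le_mult_iff)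
       (smt (verit) mult_nonneg_nonneg of_nat_0_le_iff)
    then have "J = ennreal \<theta> * I"
      unfolding J_def I_def \<eta>_def
      by (subst nn_integral_geometric_conv[OF \<theta> \<mu> measurable_comp_left[OF f gi]]) (simp add: comp_assoc)
    also have "\<dots> \<le> 1 * I" using \<theta> by (intro mult_right_mono) auto
    finally have JI: "J \<le> I" by simp
    \<comment> \<open>Only the share \<open>1 - r\<close> is replaced by its one-step bound; the
      share \<open>r\<close> stays at \<open>g\<close>, and both together form the integral against
      one lazy step.\<close>
    have "J = ennreal r * J + ennreal (1 - r) * J"
      using r by (simp flip: distrib_right ennreal_plus)
    also have "\<dots> \<le> ennreal r * J + ennreal (1 - r) * I"
      using JI by (intro add_left_mono mult_left_mono) auto
    also have "\<dots> = (\<integral>\<^sup>+x. \<integral>\<^sup>+h. f (g \<circ> x \<circ> h) \<partial>\<eta> \<partial>\<nu>)"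
      using r by (subst nn_integral_lazy[OF _ _ \<mu> fm[OF gi]]) (auto simp: J_def I_def)
    also have "\<dots> \<le> (\<integral>\<^sup>+x. \<integral>\<^sup>+y. \<integral>\<^sup>+h. f (g \<circ> x \<circ> y \<circ> h) \<partial>\<eta> \<partial>conv_pow \<nu> j \<partial>\<nu>)"
    proof (rule nn_integral_mono_AE, use \<nu>_bounded AE_space in eventually_elim)
      fix x assume x: "displacement p x \<le> \<kappa>" "x \<in> space \<nu>"
      then have xi: "x \<in> isoms" by (simp add: isom_prob_simps[OF \<nu>])
      have "displacement p (g \<circ> x) + \<kappa> * real j \<le> c"
        using displacement_comp[OF gi, of p x] x(1) Suc.prems(2) by (simp add: algebra_simps)
      from Suc.IH[OF isoms_comp[OF gi xi] this]
      show "(\<integral>\<^sup>+h. f (g \<circ> x \<circ> h) \<partial>\<eta>) \<le> (\<integral>\<^sup>+y. \<integral>\<^sup>+h. f (g \<circ> x \<circ> y \<circ> h) \<partial>\<eta> \<partial>conv_pow \<nu> j)"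
        by (simp only: \<eta>_def)
    qed
    also have "\<dots> = (\<integral>\<^sup>+x. \<integral>\<^sup>+h. f (g \<circ> x \<circ> h) \<partial>\<eta> \<partial>conv_pow \<nu> (Suc j))"
      unfolding conv_iter.simps by (subst nn_integral_conv[OF \<nu> pow fm[OF gi]]) (simp add: comp_assoc)
    finally show ?case by (simp only: J_def \<eta>_def)
  }
qed

text \<open>A Gromov product is at most the displacement, so the far set is out of reach of the
  first N lazy steps, and these can be inserted at no cost.\<close>

lemma far_set_tail:
  assumes \<theta>: "0 < \<theta>" "\<theta> < 1"
  shows "measure (geometric_conv \<theta> \<mu>) (far_set y (\<kappa> * real N + \<delta>))
    \<le> (2 * \<kappa> * real N + 1) * A\<^sub>0 * regular_norm m \<nu> ^ N"
proof -
  define \<eta> where "\<eta> = geometric_conv \<theta> \<mu>"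
  have \<eta>: "isom_prob \<eta>" unfolding \<eta>_def by (rule isom_prob_geometric_conv[OF \<mu>])
  interpret \<eta>: prob_space \<eta> using \<eta> by (rule isom_prob_simps)
  let ?A = "far_set y (\<kappa> * real N + \<delta>)"
  have "ennreal (measure \<eta> ?A) = (\<integral>\<^sup>+h. indicator ?A (id \<circ> h) \<partial>\<eta>)"
    using far_set_sets by (simp add: \<eta>.emeasure_eq_measure isom_prob_simps(2)[OF \<eta>])
  also have "\<dots> \<le> (\<integral>\<^sup>+x. \<integral>\<^sup>+h. indicator ?A (id \<circ> x \<circ> h) \<partial>\<eta> \<partial>conv_pow \<nu> N)"
    unfolding \<eta>_def
  proof (rule geometric_conv_far_step[OF \<theta>, where c = "\<kappa> * real N"])
    fix g :: "'a \<Rightarrow> 'a" assume "displacement p g \<le> \<kappa> * real N"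
    with gromov_product_bounds(3)[of p y "g p"] \<delta>_nonneg show "indicator ?A g = (0 :: ennreal)"
      by (auto simp: far_set_def displacement_def split: split_indicator)
  next
    show "indicator ?A \<in> borel_measurable isom_borel" using far_set_sets by simp
    show "displacement p id + \<kappa> * real N \<le> \<kappa> * real N" by (simp only: displacement_id add_0_left order_refl)
  qed (rule isoms_id)
  also have "\<dots> \<le> ennreal ((2 * \<kappa> * real N + 1) * A\<^sub>0 * regular_norm m \<nu> ^ N)"
    using far_set_conv_bound[OF \<eta>] by simp
  finally show ?thesis
    unfolding \<eta>_def using \<kappa>_pos A\<^sub>0_ge_1 regular_norm_nonneg[OF \<nu>] by (subst (asm) ennreal_le_iff) auto
qed

text \<open>The offset \<delta> of the thresholds plus \<open>\<kappa>\<close> times the bound for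
  the sum of the tail probabilities. The argument of the logarithm is the prefactor left after one
  power \<open>s ^ n\<close> has absorbed the factor linear in \<open>n\<close>.\<close>

definition K\<^sub>0 :: real where
  "K\<^sub>0 = \<delta> + \<kappa> * ((ln ((2 * \<kappa> / (1 - s) + 1) * A\<^sub>0) + 2) / (1 - s))"

lemma gromov_product_mean:
  assumes \<theta>: "0 < \<theta>" "\<theta> < 1"
  shows "(\<integral>h. gromov_product p y (h p) \<partial>geometric_conv \<theta> \<mu>) \<le> K\<^sub>0"
proof -
  define \<eta> where "\<eta> = geometric_conv \<theta> \<mu>"
  have \<eta>: "isom_prob \<eta>" unfolding \<eta>_def by (rule isom_prob_geometric_conv[OF \<mu>])
  interpret \<eta>: prob_space \<eta> using \<eta> by (rule isom_prob_simps)
  have s\<eta>[measurable_cong]: "sets \<eta> = sets isom_borel" by (rule isom_prob_simps[OF \<eta>])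
  define F where "F h = gromov_product p y (h p)" for h
  have Fm[measurable]: "F \<in> borel_measurable isom_borel"
    unfolding F_def[abs_def] by (rule borel_measurable_gromov_product)
  define A where "A N = far_set y (\<kappa> * real N + \<delta>)" for N
  have Am[measurable]: "A N \<in> sets isom_borel" for N unfolding A_def by (rule far_set_sets)
  obtain M :: nat where M: "dist p y / \<kappa> < real M" using reals_Archimedean2 by blast
  \<comment> \<open>Layer cake with steps of height \<open>\<kappa>\<close>. Finitely many N suffice
    because the product is at most \<open>dist p y\<close>; the final bound depends on neither
    \<open>M\<close> nor \<open>y\<close>.\<close>
  have pt: "F h \<le> \<delta> + \<kappa> * (\<Sum>N<M. indicator (A N) h)" if h: "h \<in> isoms" for h
  proof -
    define n where "n = nat \<lceil>(F h - \<delta>) / \<kappa>\<rceil>"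
    have "F h \<le> dist p y" using gromov_product_bounds(2)[of p y "h p"] by (simp add: F_def dist_commute)
    have "n \<le> M"
    proof -
      have "(F h - \<delta>) / \<kappa> \<le> dist p y / \<kappa>"
        using \<open>F h \<le> dist p y\<close> \<delta>_nonneg \<kappa>_pos by (intro divide_right_mono) auto
      then show ?thesis using M unfolding n_def by linarith
    qed
    have "indicator (A N) h = (1::real)" if "N < n" for N
    proof -
      have "real N < (F h - \<delta>) / \<kappa>" using that unfolding n_def by linarith
      then have "\<kappa> * real N + \<delta> < F h" using \<kappa>_pos by (simp add: field_simps)
      then show ?thesis using h by (simp add: A_def far_set_def F_def)
    qed
    then have "real n = (\<Sum>N<n. indicator (A N) h)" by simp
    also have "\<dots> \<le> (\<Sum>N<M. indicator (A N) h)" using \<open>n \<le> M\<close> by (intro sum_mono2) auto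
    finally have "(F h - \<delta>) / \<kappa> \<le> (\<Sum>N<M. indicator (A N) h)" unfolding n_def by linarith
    then show ?thesis using \<kappa>_pos by (simp add: field_simps)
  qed
  have Ai: "integrable \<eta> (\<lambda>h. indicator (A N) h :: real)" for N
    by (rule \<eta>.integrable_const_bound[where B = 1]) (auto split: split_indicator)
  have Fi: "integrable \<eta> F"
  proof (rule \<eta>.integrable_const_bound[where B = "dist y p"])
    show "AE h in \<eta>. norm (F h) \<le> dist y p"
      using gromov_product_bounds(1,2)[of p y] by (auto simp: F_def)
  qed simp
  have "(\<integral>h. F h \<partial>\<eta>) \<le> (\<integral>h. \<delta> + \<kappa> * (\<Sum>N<M. indicator (A N) h) \<partial>\<eta>)"
    using pt Fi Ai
    by (intro integral_mono) (auto simp: isom_prob_simps[OF \<eta>] intro!: Bochner_Integration.integrable_add)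
  also have "\<dots> = \<delta> + \<kappa> * (\<Sum>N<M. measure \<eta> (A N))"
    using Ai by (simp add: \<eta>.prob_space s\<eta>)
  also have "(\<Sum>N<M. measure \<eta> (A N)) \<le> (ln ((2 * \<kappa> / (1 - s) + 1) * A\<^sub>0) + 2) / (1 - s)"
  proof (rule sum_min_geometric)
    have "1 * 1 \<le> (2 * \<kappa> / (1 - s) + 1) * A\<^sub>0" using \<kappa>_pos s A\<^sub>0_ge_1 by (intro mult_mono) auto
    then show "1 \<le> (2 * \<kappa> / (1 - s) + 1) * A\<^sub>0" by simp
    fix n
    have "measure \<eta> (A n) \<le> (2 * \<kappa> * real n + 1) * A\<^sub>0 * regular_norm m \<nu> ^ n"
      unfolding \<eta>_def A_def by (rule far_set_tail[OF \<theta>])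
    also have "\<dots> = (2 * \<kappa> * (real n * s ^ n) + s ^ n) * A\<^sub>0 * s ^ n"
      unfolding s(3) by (simp add: algebra_simps)
    \<comment> \<open>Of the two factors \<open>s ^ n\<close> one compensates \<open>n\<close>, and
      the other keeps the series summable.\<close>
    also have "\<dots> \<le> (2 * \<kappa> * (1 / (1 - s)) + 1) * A\<^sub>0 * s ^ n"
      using \<kappa>_pos A\<^sub>0_ge_1 s
      by (intro mult_right_mono add_mono mult_left_mono mult_power_le_inverse power_le_one) auto
    finally show "measure \<eta> (A n) \<le> (2 * \<kappa> / (1 - s) + 1) * A\<^sub>0 * s ^ n" by simp
  qed (use s in auto)
  finally show ?thesis using \<kappa>_pos by (simp add: K\<^sub>0_def F_def \<eta>_def)
qed

section \<open>Comparison with the stated constant\<close>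

text \<open>Within \<open>\<rho> / \<kappa>\<close> steps the walk cannot leave a ball of radius \<open>\<rho>\<close>, so the spectral gap
  bounds \<open>\<delta>\<close> in terms of \<open>\<kappa>\<close>.\<close>

lemma \<delta>_le: "\<delta> \<le> \<kappa> * (1 + ln A\<^sub>0 / (2 * (1 - s))) / 14"
proof -
  define n where "n = nat \<lfloor>\<rho> / \<kappa>\<rfloor>"
  have pos: "0 \<le> \<rho> / \<kappa>" using \<rho>_ge \<kappa>_pos by simp
  have n: "\<kappa> * real n \<le> \<rho>" "\<rho> / \<kappa> \<le> real n + 1"
  proof -
    have "real n \<le> \<rho> / \<kappa>" using pos unfolding n_def by simp
    then show "\<kappa> * real n \<le> \<rho>" using \<kappa>_pos by (simp add: field_simps)
    show "\<rho> / \<kappa> \<le> real n + 1" unfolding n_def by linarith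
  qed
  have pow: "isom_prob (conv_pow \<nu> n)" by (rule isom_prob_conv_iter[OF \<nu> isom_prob_return])
  interpret pw: prob_space "conv_pow \<nu> n" using pow by (rule isom_prob_simps)
  have "AE g in conv_pow \<nu> n. g \<in> near id \<rho>"
    using conv_pow_bounded[of n] AE_space
  proof eventually_elim
    case (elim g)
    then show ?case using n(1) by (simp add: near_def displacement_def isom_prob_simps[OF pow] dist_commute)
  qed
  then have "measure (conv_pow \<nu> n) (near id \<rho>) = 1"
    using near_sets by (subst pw.prob_eq_1) (auto simp: isom_prob_simps[OF pow])
  then have "1 \<le> A\<^sub>0 * regular_norm m \<nu> ^ n"
    using conv_iter_near_bound[OF \<nu> isom_prob_return isoms_id \<rho>_ge(2), of n] by (simp add: A\<^sub>0_def)
  also have "\<dots> \<le> A\<^sub>0 * (exp (- ((1 - s) * real n)) * exp (- ((1 - s) * real n)))"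
    unfolding s(3) using A\<^sub>0_ge_1 s power_le_exp[OF s(1), of n] by (intro mult_left_mono mult_mono) auto
  also have "\<dots> = exp (ln A\<^sub>0 - 2 * (1 - s) * real n)"
  proof -
    have "A\<^sub>0 = exp (ln A\<^sub>0)" using A\<^sub>0_ge_1 by simp
    then have "A\<^sub>0 * (exp (- ((1 - s) * real n)) * exp (- ((1 - s) * real n)))
        = exp (ln A\<^sub>0) * (exp (- ((1 - s) * real n)) * exp (- ((1 - s) * real n)))" by simp
    also have "\<dots> = exp (ln A\<^sub>0 + (- ((1 - s) * real n) + - ((1 - s) * real n)))"
      by (simp only: exp_add)
    also have "ln A\<^sub>0 + (- ((1 - s) * real n) + - ((1 - s) * real n)) = ln A\<^sub>0 - 2 * (1 - s) * real n"
      by (simp add: algebra_simps)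
    finally show ?thesis .
  qed
  finally have "2 * (1 - s) * real n \<le> ln A\<^sub>0" by simp
  then have "real n \<le> ln A\<^sub>0 / (2 * (1 - s))" using s by (simp add: field_simps)
  then have "\<rho> \<le> \<kappa> * (1 + ln A\<^sub>0 / (2 * (1 - s)))"
  proof -
    assume "real n \<le> ln A\<^sub>0 / (2 * (1 - s))"
    then have "\<rho> / \<kappa> \<le> 1 + ln A\<^sub>0 / (2 * (1 - s))" using n(2) by linarith
    then show ?thesis using \<kappa>_pos by (simp add: pos_divide_le_eq mult.commute)
  qed
  then show ?thesis using \<rho>_ge by simp
qed

lemma range_bound:
  "2 * \<kappa> + 2 * K\<^sub>0 \<le> 8 * \<kappa> * ((16 * ln_plus \<kappa> + 8 * A\<^sub>0 / 3 + 33) / (1 - s)\<^sup>2)"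
proof -
  define q where "q = 1 - s"
  have q: "0 < q" "q \<le> 1" using s by (auto simp: q_def)
  have lp: "0 \<le> ln_plus \<kappa>" by (simp add: ln_plus_def)
  have lnA: "0 \<le> ln A\<^sub>0" "ln A\<^sub>0 \<le> A\<^sub>0 - 1" using A\<^sub>0_ge_1 ln_le_minus_one by auto
  have iq: "1 \<le> 1 / q" "1 / q \<le> 1 / q\<^sup>2"
    using q by (auto simp: field_simps power2_eq_square)
  have "ln ((2 * \<kappa> / q + 1) * A\<^sub>0) = ln (2 * \<kappa> / q + 1) + ln A\<^sub>0"
    using \<kappa>_pos q A\<^sub>0_ge_1 by (intro ln_mult_pos) (auto intro: add_pos_pos)
  \<comment> \<open>The logarithm is split so that \<open>\<kappa>\<close> enters only through
    \<open>ln_plus\<close>. The part \<open>ln (3 / q)\<close> is traded for a multiple of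
    \<open>1 / q\<close>, which is where the second power of \<open>1 / q\<close> comes
    from.\<close>
  also have "ln (2 * \<kappa> / q + 1) \<le> ln (max \<kappa> 1 * (3 / q))"
  proof -
    have "2 * \<kappa> / q + 1 \<le> 2 * max \<kappa> 1 / q + max \<kappa> 1 / q"
    proof (intro add_mono divide_right_mono mult_left_mono)
      have "1 \<le> 1 / q" by (rule iq)
      also have "\<dots> \<le> max \<kappa> 1 / q" using q by (intro divide_right_mono) auto
      finally show "1 \<le> max \<kappa> 1 / q" .
    qed (use q in auto)
    also have "\<dots> = max \<kappa> 1 * (3 / q)" by (simp add: field_simps)
    finally show ?thesis using \<kappa>_pos q by (subst ln_le_cancel_iff) (auto intro: add_pos_pos mult_pos_pos)
  qed
  also have "\<dots> = ln (max \<kappa> 1) + ln (3 / q)" using q by (intro ln_mult_pos) auto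
  also have "ln (max \<kappa> 1) = ln_plus \<kappa>" using \<kappa>_pos by (auto simp: ln_plus_def max_def)
  also have "ln (3 / q) \<le> 3 / q - 1" using q by (intro ln_le_minus_one) auto
  finally have L: "ln ((2 * \<kappa> / q + 1) * A\<^sub>0) \<le> ln_plus \<kappa> + 3 / q - 1 + (A\<^sub>0 - 1)" using lnA by simp
  \<comment> \<open>Both summands of \<open>K\<^sub>0\<close> will be at most
    \<open>\<kappa> * (B / q\<^sup>2)\<close>, and \<open>2 + 4 * B\<close> lies well below 8 times
    the bracket in the statement.\<close>
  define B where "B = ln_plus \<kappa> + A\<^sub>0 + 3"
  have B: "3 \<le> B" using lp A\<^sub>0_ge_1 by (simp add: B_def)
  have "(ln ((2 * \<kappa> / q + 1) * A\<^sub>0) + 2) / q \<le> (ln_plus \<kappa> + A\<^sub>0 + 3 / q) / q"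
    using L q by (intro divide_right_mono) auto
  also have "\<dots> \<le> (B / q) / q"
  proof (intro divide_right_mono)
    have "(ln_plus \<kappa> + A\<^sub>0) * 1 \<le> (ln_plus \<kappa> + A\<^sub>0) * (1 / q)"
      using lp A\<^sub>0_ge_1 iq by (intro mult_left_mono) auto
    then show "ln_plus \<kappa> + A\<^sub>0 + 3 / q \<le> B / q" by (simp add: B_def add_divide_distrib)
  qed (use q in auto)
  finally have S: "(ln ((2 * \<kappa> / q + 1) * A\<^sub>0) + 2) / q \<le> B / q\<^sup>2" by (simp add: power2_eq_square)
  have "\<delta> \<le> \<kappa> * (1 + ln A\<^sub>0 / (2 * q)) / 14" using \<delta>_le by (simp add: q_def)
  also have "\<dots> \<le> \<kappa> * (B / q\<^sup>2)"
  proof -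
    have "ln A\<^sub>0 / (2 * q) \<le> A\<^sub>0 * (1 / q)" using lnA q A\<^sub>0_ge_1 by (simp add: field_simps)
    also have "\<dots> \<le> A\<^sub>0 * (1 / q\<^sup>2)" using iq A\<^sub>0_ge_1 by (intro mult_left_mono) auto
    finally have X: "ln A\<^sub>0 / (2 * q) \<le> A\<^sub>0 * (1 / q\<^sup>2)" .
    have "(1 + ln A\<^sub>0 / (2 * q)) / 14 \<le> (1 / q\<^sup>2 + A\<^sub>0 * (1 / q\<^sup>2)) / 14"
      by (intro divide_right_mono add_mono X) (use iq in auto)
    also have "\<dots> = (1 + A\<^sub>0) / 14 * (1 / q\<^sup>2)"
      by (simp add: ring_distribs add_divide_distrib)
    also have "\<dots> \<le> B * (1 / q\<^sup>2)" using q lp A\<^sub>0_ge_1 by (intro mult_right_mono) (auto simp: B_def)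
    finally have Y: "(1 + ln A\<^sub>0 / (2 * q)) / 14 \<le> B / q\<^sup>2" by simp
    have "\<kappa> * (1 + ln A\<^sub>0 / (2 * q)) / 14 = \<kappa> * ((1 + ln A\<^sub>0 / (2 * q)) / 14)" by simp
    also have "\<dots> \<le> \<kappa> * (B / q\<^sup>2)" using \<kappa>_pos by (intro mult_left_mono Y) simp
    finally show ?thesis .
  qed
  finally have "K\<^sub>0 \<le> \<kappa> * (B / q\<^sup>2) + \<kappa> * (B / q\<^sup>2)"
    unfolding K\<^sub>0_def using S \<kappa>_pos by (intro add_mono mult_left_mono) (auto simp: q_def)
  moreover have "\<kappa> * 1 \<le> \<kappa> * (1 / q\<^sup>2)" using iq \<kappa>_pos by (intro mult_left_mono) auto
  moreover have "\<kappa> * ((2 + 4 * B) / q\<^sup>2) = 2 * (\<kappa> * (1 / q\<^sup>2)) + 4 * (\<kappa> * (B / q\<^sup>2))"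
    by (simp add: add_divide_distrib ring_distribs mult_ac)
  ultimately have "2 * \<kappa> + 2 * K\<^sub>0 \<le> \<kappa> * ((2 + 4 * B) / q\<^sup>2)" by linarith
  also have "\<dots> \<le> \<kappa> * (8 * (16 * ln_plus \<kappa> + 8 * A\<^sub>0 / 3 + 33) / q\<^sup>2)"
    using \<kappa>_pos q lp A\<^sub>0_ge_1 by (intro mult_left_mono divide_right_mono) (auto simp: B_def)
  finally show ?thesis by (simp add: q_def algebra_simps)
qed

definition W :: real where "W = 2 * \<kappa> + 2 * K\<^sub>0"

lemma K\<^sub>0_nonneg: "0 \<le> K\<^sub>0"
proof -
    have "1 * 1 \<le> (2 * \<kappa> / (1 - s) + 1) * A\<^sub>0" using \<kappa>_pos s A\<^sub>0_ge_1 by (intro mult_mono) auto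
    then have "0 \<le> ln ((2 * \<kappa> / (1 - s) + 1) * A\<^sub>0)" by simp
    then show ?thesis
      unfolding K\<^sub>0_def using \<kappa>_pos s \<delta>_nonneg
      by (intro add_nonneg_nonneg mult_nonneg_nonneg divide_nonneg_nonneg) auto
qed

lemma W_pos: "0 < W"
  using K\<^sub>0_nonneg \<kappa>_pos by (simp add: W_def)

text \<open>The 64 from squaring the range is written as 2 times 32: the 2 cancels the one in the
  exponent \<open>2 * u\<^sup>2 / W\<^sup>2\<close> of the deviation bound.\<close>

lemma W_bound:
  "W\<^sup>2 \<le> 2 * (\<kappa>\<^sup>2 * (32 * (16 * ln_plus \<kappa> + 8 * A\<^sub>0 / 3 + 33)\<^sup>2 * (1 / (1 - s) ^ 4)))"
proof -
  have "W\<^sup>2 \<le> (8 * \<kappa> * ((16 * ln_plus \<kappa> + 8 * A\<^sub>0 / 3 + 33) / (1 - s)\<^sup>2))\<^sup>2"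
    using range_bound W_pos unfolding W_def by (intro power_mono) auto
  also have "\<dots> = 2 * (\<kappa>\<^sup>2 * (32 * (16 * ln_plus \<kappa> + 8 * A\<^sub>0 / 3 + 33)\<^sup>2 * (1 / (1 - s) ^ 4)))"
    by (simp add: power_mult_distrib power_divide flip: power_mult)
  finally show ?thesis .
qed

end

subsection \<open>The corrector\<close>

lemma (in separable_metric) borel_measurable_gromov_product_pair:
  fixes p :: 'a and N :: "'b measure"
  assumes f: "f \<in> measurable N isom_borel" and h: "h \<in> measurable N isom_borel"
  shows "(\<lambda>x. gromov_product p (f x p) (h x p)) \<in> borel_measurable N"
proof -
  have "(\<lambda>x. dist (f x p) p) \<in> borel_measurable N" "(\<lambda>x. dist (h x p) p) \<in> borel_measurable N"
      "(\<lambda>x. dist (f x p) (h x p)) \<in> borel_measurable N"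
    by (intro borel_measurable_dist_sep measurable_eval_isom f h measurable_const; simp)+
  then show ?thesis unfolding gromov_product_def by measurable
qed

lemma dist_inv_base: "g \<in> isoms \<Longrightarrow> dist (inv g p) p = displacement p g"
  using isoms_dist_inv[of g p p] by (simp add: displacement_def dist_commute)

locale hyp_walk_mean = hyp_walk w m p \<delta> \<kappa> r \<rho> \<mu>
  for w :: "nat \<Rightarrow> 'a::metric_space" and m :: "('a \<Rightarrow> 'a) measure" and p :: 'a
    and \<delta> \<kappa> r \<rho> :: real and \<mu> :: "('a \<Rightarrow> 'a) measure" +
  fixes \<theta> :: real
  assumes \<theta>: "0 < \<theta>" "\<theta> < 1"
begin

definition \<eta> :: "('a \<Rightarrow> 'a) measure" where "\<eta> = geometric_conv \<theta> \<mu>"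

lemma \<eta>: "isom_prob \<eta>" unfolding \<eta>_def by (rule isom_prob_geometric_conv[OF \<mu>])

sublocale \<eta>: prob_space \<eta> by (rule isom_prob_simps(1)[OF \<eta>])
sublocale \<mu>: prob_space \<mu> by (rule isom_prob_simps(1)[OF \<mu>])

lemma sets_\<eta> [measurable_cong]: "sets \<eta> = sets isom_borel" by (rule isom_prob_simps(2)[OF \<eta>])
lemma sets_\<mu> [measurable_cong]: "sets \<mu> = sets isom_borel" by (rule isom_prob_simps(2)[OF \<mu>])
lemma space_\<eta> [simp]: "space \<eta> = isoms" by (rule isom_prob_simps(3)[OF \<eta>])
lemma space_\<mu> [simp]: "space \<mu> = isoms" by (rule isom_prob_simps(3)[OF \<mu>])

lemma measure_isoms [simp]: "measure \<eta> isoms = 1" "measure \<mu> isoms = 1"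
  using \<eta>.prob_space \<mu>.prob_space by simp_all

lemma integrable_bounded:
  fixes f :: "('a \<Rightarrow> 'a) \<Rightarrow> real"
  assumes "isom_prob \<xi>" "f \<in> borel_measurable isom_borel" "\<And>h. h \<in> isoms \<Longrightarrow> \<bar>f h\<bar> \<le> B"
  shows "integrable \<xi> f"
proof -
  interpret prob_space \<xi> by (rule isom_prob_simps(1)[OF assms(1)])
  show ?thesis
    using assms by (intro integrable_const_bound[where B = B])
      (auto simp: isom_prob_simps(3)[OF assms(1)] measurable_cong_sets[OF isom_prob_simps(2)[OF assms(1)] refl])
qed

lemma borel_measurable_integral_comp:
  fixes f :: "('a \<Rightarrow> 'a) \<Rightarrow> real"
  assumes "f \<in> borel_measurable isom_borel"
  shows "(\<lambda>x. \<integral>h. f (x \<circ> h) \<partial>\<eta>) \<in> borel_measurable isom_borel"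
proof (rule \<eta>.borel_measurable_lebesgue_integral)
  show "(\<lambda>(x, h). f (x \<circ> h)) \<in> borel_measurable (isom_borel \<Otimes>\<^sub>M \<eta>)"
    using measurable_compose[OF measurable_conv_comp[OF refl sets_\<eta>] assms] by (simp add: split_beta')
qed

text \<open>Real form of the renewal identity; \<open>f\<close> is nonnegative and bounded, so
  passing through \<open>ennreal\<close> loses nothing.\<close>

lemma \<eta>_mean:
  fixes f :: "('a \<Rightarrow> 'a) \<Rightarrow> real"
  assumes f: "f \<in> borel_measurable isom_borel" and B: "\<And>h. h \<in> isoms \<Longrightarrow> 0 \<le> f h" "\<And>h. h \<in> isoms \<Longrightarrow> f h \<le> B"
  shows "(\<integral>h. f h \<partial>\<eta>) = (1 - \<theta>) * f id + \<theta> * (\<integral>x. \<integral>h. f (x \<circ> h) \<partial>\<eta> \<partial>\<mu>)"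
proof -
  have fx: "(\<lambda>h. f (x \<circ> h)) \<in> borel_measurable isom_borel" if "x \<in> isoms" for x
  proof -
    have "(\<lambda>h. x \<circ> h) \<in> measurable isom_borel isom_borel"
      using that by (intro measurable_comp_isom) auto
    from measurable_compose[OF this f] show ?thesis .
  qed
  have i: "integrable \<eta> f" using f B by (intro integrable_bounded[OF \<eta>, where B = B]) auto
  have ix: "integrable \<eta> (\<lambda>h. f (x \<circ> h))" if "x \<in> isoms" for x
    using fx[OF that] B isoms_comp[OF that] by (intro integrable_bounded[OF \<eta>, where B = B]) auto
  define F where "F x = (\<integral>h. f (x \<circ> h) \<partial>\<eta>)" for x
  have F0: "0 \<le> F x" if "x \<in> isoms" for x
    unfolding F_def using B isoms_comp[OF that] by (intro integral_nonneg_AE) auto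
  have FB: "F x \<le> B" if "x \<in> isoms" for x
    unfolding F_def using ix[OF that] B isoms_comp[OF that] by (intro \<eta>.integral_le_const) auto
  have iF: "integrable \<mu> F"
    using F0 FB borel_measurable_integral_comp[OF f] by (intro integrable_bounded[OF \<mu>, where B = B]) (auto simp: F_def[abs_def])
  have "ennreal (\<integral>h. f h \<partial>\<eta>) = (\<integral>\<^sup>+h. ennreal (f h) \<partial>\<eta>)"
    using i B by (intro nn_integral_eq_integral[symmetric]) auto
  also have "\<dots> = ennreal (1 - \<theta>) * ennreal (f id) + ennreal \<theta> * (\<integral>\<^sup>+x. \<integral>\<^sup>+h. ennreal (f (x \<circ> h)) \<partial>\<eta> \<partial>\<mu>)"
    unfolding \<eta>_def using f by (intro nn_integral_geometric_conv[OF \<theta> \<mu>]) measurable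
  also have "(\<integral>\<^sup>+x. \<integral>\<^sup>+h. ennreal (f (x \<circ> h)) \<partial>\<eta> \<partial>\<mu>) = (\<integral>\<^sup>+x. ennreal (F x) \<partial>\<mu>)"
    unfolding F_def using ix B
    by (intro nn_integral_cong nn_integral_eq_integral) (auto intro!: AE_I2 simp: isoms_comp)
  also have "\<dots> = ennreal (\<integral>x. F x \<partial>\<mu>)"
    using iF F0 by (intro nn_integral_eq_integral) auto
  also have "ennreal (1 - \<theta>) * ennreal (f id) + ennreal \<theta> * ennreal (\<integral>x. F x \<partial>\<mu>)
      = ennreal ((1 - \<theta>) * f id + \<theta> * (\<integral>x. F x \<partial>\<mu>))"
  proof -
    have "0 \<le> (\<integral>x. F x \<partial>\<mu>)" using F0 by (intro Bochner_Integration.integral_nonneg) auto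
    then show ?thesis using \<theta> B(1)[OF isoms_id] by (simp add: ennreal_plus ennreal_mult)
  qed
  finally have "ennreal (\<integral>h. f h \<partial>\<eta>) = ennreal ((1 - \<theta>) * f id + \<theta> * (\<integral>x. F x \<partial>\<mu>))" .
  moreover have "0 \<le> (\<integral>h. f h \<partial>\<eta>)" using B by (intro integral_nonneg_AE) auto
  moreover have "0 \<le> (1 - \<theta>) * f id + \<theta> * (\<integral>x. F x \<partial>\<mu>)"
    using \<theta> B(1)[OF isoms_id] F0 by (intro add_nonneg_nonneg mult_nonneg_nonneg integral_nonneg_AE) auto
  ultimately show ?thesis by (simp add: F_def)
qed

text \<open>The mean Gromov product \<open>corr\<close> is the corrector: it turns the displacement, up to a small
  multiple of \<open>corr\<close>, into a martingale with constant drift.\<close>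

definition corr :: "('a \<Rightarrow> 'a) \<Rightarrow> real" where
  "corr g = (\<integral>h. gromov_product p (inv g p) (h p) \<partial>\<eta>)"

definition \<psi> :: "('a \<Rightarrow> 'a) \<Rightarrow> real" where "\<psi> g = displacement p g - 2 * corr g"

text \<open>The difference is kept under one integral because it is bounded by
  \<open>displacement p x\<close>, whereas no moment bound for the displacement under
  \<open>\<eta>\<close> is at hand.\<close>

definition gain :: "('a \<Rightarrow> 'a) \<Rightarrow> real" where
  "gain x = (\<integral>h. (displacement p (x \<circ> h) - displacement p h) \<partial>\<eta>)"

definition drift :: real where "drift = (\<integral>x. gain x \<partial>\<mu>)"

lemma corr_bounds: "0 \<le> corr g" "corr g \<le> K\<^sub>0"
  using gromov_product_mean[OF \<theta>] gromov_product_bounds(1)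
  by (auto simp: corr_def \<eta>_def intro!: Bochner_Integration.integral_nonneg)

lemma borel_measurable_corr [measurable]: "corr \<in> borel_measurable isom_borel"
  unfolding corr_def[abs_def]
proof (rule \<eta>.borel_measurable_lebesgue_integral)
  have "(\<lambda>x. gromov_product p (inv (fst x) p) (snd x p)) \<in> borel_measurable (isom_borel \<Otimes>\<^sub>M \<eta>)"
    by (intro borel_measurable_gromov_product_pair measurable_inv_isom measurable_fst)
      (use measurable_cong_sets[OF refl sets_\<eta>] measurable_snd in blast)
  then show "(\<lambda>(g, h). gromov_product p (inv g p) (h p)) \<in> borel_measurable (isom_borel \<Otimes>\<^sub>M \<eta>)"
    by (simp add: split_beta')
qed

lemma borel_measurable_\<psi> [measurable]: "\<psi> \<in> borel_measurable isom_borel"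
  unfolding \<psi>_def[abs_def] by measurable

lemma displacement_diff:
  assumes x: "x \<in> isoms" shows "\<bar>displacement p (x \<circ> h) - displacement p h\<bar> \<le> displacement p x"
proof -
  have "dist (h p) p = dist (x (h p)) (x p)" by (simp add: isoms_dist[OF x])
  also have "\<dots> \<le> dist (x (h p)) p + dist (x p) p" by (rule dist_triangle2)
  finally show ?thesis using displacement_comp[OF x, of p h] by (simp add: displacement_def)
qed

lemma integrable_displacement_diff:
  assumes x: "x \<in> isoms" shows "integrable \<eta> (\<lambda>h. displacement p (x \<circ> h) - displacement p h)"
  using displacement_diff[OF x] measurable_comp_left[OF borel_measurable_displacement x, of p]
  by (intro integrable_bounded[OF \<eta>, where B = "displacement p x"]) auto

lemma gain_bound:
  assumes "x \<in> isoms" shows "\<bar>gain x\<bar> \<le> displacement p x"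
proof -
  have "\<bar>gain x\<bar> \<le> (\<integral>h. \<bar>displacement p (x \<circ> h) - displacement p h\<bar> \<partial>\<eta>)"
    unfolding gain_def by (rule integral_abs_bound)
  also have "\<dots> \<le> displacement p x"
    using displacement_diff[OF assms] integrable_displacement_diff[OF assms]
    by (intro \<eta>.integral_le_const) auto
  finally show ?thesis .
qed

lemma borel_measurable_gain: "gain \<in> borel_measurable isom_borel"
  unfolding gain_def[abs_def]
proof (rule \<eta>.borel_measurable_lebesgue_integral)
  have "(\<lambda>(x, h). displacement p (x \<circ> h)) \<in> borel_measurable (isom_borel \<Otimes>\<^sub>M \<eta>)"
    using measurable_compose[OF measurable_conv_comp[OF refl sets_\<eta>] borel_measurable_displacement[of p]]
    by (simp add: split_beta')
  moreover have "(\<lambda>(x, h). displacement p h) \<in> borel_measurable (isom_borel \<Otimes>\<^sub>M \<eta>)"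
    unfolding split_beta' by measurable
  ultimately show "(\<lambda>(x, h). displacement p (x \<circ> h) - displacement p h) \<in> borel_measurable (isom_borel \<Otimes>\<^sub>M \<eta>)"
    unfolding split_beta' by (rule borel_measurable_diff)
qed

lemma integrable_gain: "integrable \<mu> gain"
proof (rule \<mu>.integrable_const_bound[where B = \<kappa>])
  show "AE x in \<mu>. norm (gain x) \<le> \<kappa>"
    using \<mu>_bounded AE_space
  proof eventually_elim
    case (elim x)
    with gain_bound[of x] show ?case by simp
  qed
  show "gain \<in> borel_measurable \<mu>"
    using borel_measurable_gain by (simp add: measurable_cong_sets[OF sets_\<mu> refl])
qed

context
  fixes g :: "'a \<Rightarrow> 'a"
  assumes g: "g \<in> isoms"
begin

definition prod_mean :: "('a \<Rightarrow> 'a) \<Rightarrow> real" where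
  "prod_mean x = (\<integral>h. gromov_product p (inv g p) ((x \<circ> h) p) \<partial>\<eta>)"

text \<open>The renewal identity is applied to the Gromov product with \<open>inv g p\<close>. Its
  identity term drops out, because a Gromov product with the base point is 0.\<close>

lemma integrable_prod_mean: "integrable \<mu> prod_mean"
  and corr_eq: "corr g = \<theta> * (\<integral>x. prod_mean x \<partial>\<mu>)"
proof -
  have B: "0 \<le> gromov_product p (inv g p) (h p)" "gromov_product p (inv g p) (h p) \<le> displacement p g" for h
    using gromov_product_bounds(1)[of p "inv g p" "h p"] gromov_product_bounds(2)[of p "inv g p" "h p"]
    by (simp_all add: dist_inv_base[OF g])
  have fm: "(\<lambda>h. gromov_product p (inv g p) (h p)) \<in> borel_measurable isom_borel"
    by (rule borel_measurable_gromov_product)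
  have i: "integrable \<eta> (\<lambda>h. gromov_product p (inv g p) ((x \<circ> h) p))" if "x \<in> isoms" for x
    using B(1,2)[of "x \<circ> _"] measurable_comp_left[OF fm that]
    by (intro integrable_bounded[OF \<eta>, where B = "displacement p g"]) auto
  have 1: "0 \<le> prod_mean x" for x unfolding prod_mean_def using B(1)[of "x \<circ> _"] by (intro integral_nonneg_AE) auto
  have 2: "prod_mean x \<le> displacement p g" if "x \<in> isoms" for x
    unfolding prod_mean_def using i[OF that] B(2)[of "x \<circ> _"] by (intro \<eta>.integral_le_const) auto
  show "integrable \<mu> prod_mean"
    using 1 2 borel_measurable_integral_comp[OF fm]
    by (intro integrable_bounded[OF \<mu>, where B = "displacement p g"]) (auto simp: prod_mean_def[abs_def])
  have "corr g = (1 - \<theta>) * gromov_product p (inv g p) (id p) + \<theta> * (\<integral>x. prod_mean x \<partial>\<mu>)"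
    unfolding corr_def prod_mean_def by (rule \<eta>_mean[OF fm, where B = "displacement p g"]) (rule B)+
  also have "gromov_product p (inv g p) (id p) = 0" by (simp add: gromov_product_def dist_commute)
  finally show "corr g = \<theta> * (\<integral>x. prod_mean x \<partial>\<mu>)" by simp
qed

text \<open>The products of \<open>inv (g \<circ> x) p\<close> with \<open>h p\<close> and of
  \<open>inv g p\<close> with \<open>x (h p)\<close> share the same mutual distance, so they differ
  only by displacements. Subtracting twice the corrector thus removes
  \<open>displacement p (g \<circ> x)\<close>, and of what remains only \<open>prod_mean\<close>
  couples \<open>g\<close> with \<open>x\<close>.\<close>

lemma \<psi>_comp:
  assumes x: "x \<in> isoms"
  shows "\<psi> (g \<circ> x) = displacement p g - 2 * prod_mean x + gain x"
proof -
  have gx: "g \<circ> x \<in> isoms" using g x by (rule isoms_comp)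
  have B: "\<bar>gromov_product p (inv g p) (h p)\<bar> \<le> displacement p g" if "g \<in> isoms" for g h
    using gromov_product_bounds(1)[of p "inv g p" "h p"] gromov_product_bounds(2)[of p "inv g p" "h p"]
    by (simp add: dist_inv_base[OF that])
  have fm: "(\<lambda>h. gromov_product p (inv g p) (h p)) \<in> borel_measurable isom_borel" for g :: "'a \<Rightarrow> 'a"
    by (rule borel_measurable_gromov_product)
  have i: "integrable \<eta> (\<lambda>h. gromov_product p (inv g p) ((x \<circ> h) p))"
    using B[OF g, of "x \<circ> _"] measurable_comp_left[OF fm x]
    by (intro integrable_bounded[OF \<eta>, where B = "displacement p g"]) auto
  have "2 * corr (g \<circ> x) = (\<integral>h. 2 * gromov_product p (inv (g \<circ> x) p) (h p) \<partial>\<eta>)"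
    by (simp add: corr_def)
  also have "\<dots> = (\<integral>h. (displacement p (g \<circ> x) - displacement p g) +
      (2 * gromov_product p (inv g p) ((x \<circ> h) p) - (displacement p (x \<circ> h) - displacement p h)) \<partial>\<eta>)"
  proof (intro Bochner_Integration.integral_cong refl)
    fix h
    have "dist (inv (g \<circ> x) p) (h p) = dist (inv g p) (x (h p))"
      using isoms_dist_inv[OF gx, of p "h p"] isoms_dist_inv[OF g, of p "x (h p)"] by simp
    moreover have "dist (inv (g \<circ> x) p) p = dist p (g (x p))" "dist (inv g p) p = dist p (g p)"
      using isoms_dist_inv[OF gx, of p p] isoms_dist_inv[OF g, of p p] by simp_all
    ultimately show "2 * gromov_product p (inv (g \<circ> x) p) (h p) = (displacement p (g \<circ> x) - displacement p g) +
      (2 * gromov_product p (inv g p) ((x \<circ> h) p) - (displacement p (x \<circ> h) - displacement p h))"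
      by (simp add: gromov_product_def displacement_def dist_commute field_simps)
  qed
  also have "\<dots> = (displacement p (g \<circ> x) - displacement p g) + (2 * prod_mean x - gain x)"
    unfolding prod_mean_def gain_def
    using i integrable_displacement_diff[OF x]
    by (subst Bochner_Integration.integral_add, simp, simp)
      (subst Bochner_Integration.integral_diff, simp_all)
  finally show ?thesis by (simp add: \<psi>_def)
qed

text \<open>The \<mu>-mean of \<open>prod_mean\<close> is \<open>corr g / \<theta>\<close> instead
  of \<open>corr g\<close>; this mismatch is all that prevents an exact martingale after subtraction
  of the drift.\<close>

lemma \<psi>_mean: "(\<integral>x. \<psi> (g \<circ> x) \<partial>\<mu>) = \<psi> g + drift - 2 * corr g * (1 / \<theta> - 1)"
proof -
  have "(\<integral>x. \<psi> (g \<circ> x) \<partial>\<mu>) = (\<integral>x. displacement p g - 2 * prod_mean x + gain x \<partial>\<mu>)"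
    by (intro Bochner_Integration.integral_cong refl) (simp add: \<psi>_comp)
  also have "\<dots> = displacement p g - 2 * (\<integral>x. prod_mean x \<partial>\<mu>) + drift"
    using integrable_prod_mean integrable_gain by (simp add: drift_def)
  also have "(\<integral>x. prod_mean x \<partial>\<mu>) = corr g / \<theta>" using corr_eq \<theta> by simp
  also have "displacement p g - 2 * (corr g / \<theta>) + drift = \<psi> g + drift - 2 * corr g * (1 / \<theta> - 1)"
    using \<theta> by (simp add: \<psi>_def field_simps)
  finally show ?thesis .
qed

lemma \<psi>_exp_step:
  assumes l: "0 < l" and \<sigma>: "\<sigma> = 1 \<or> \<sigma> = -1"
  shows "(\<integral>\<^sup>+x. ennreal (exp (l * (\<sigma> * \<psi> (g \<circ> x)))) \<partial>\<mu>)
    \<le> ennreal (exp (l * (\<sigma> * drift + 2 * K\<^sub>0 * (1 / \<theta> - 1)) + l\<^sup>2 * W\<^sup>2 / 8)) * ennreal (exp (l * (\<sigma> * \<psi> g)))"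
proof -
  define f where "f x = \<sigma> * \<psi> (g \<circ> x)" for x
  \<comment> \<open>Lower end of the range: the displacement varies by \<open>\<kappa>\<close>
    either way around \<open>displacement p g\<close>, and twice the corrector, between 0 and
    \<open>2 * K\<^sub>0\<close>, is subtracted for \<sigma> = 1 and added for \<sigma> =
    -1.\<close>
  define a where "a = (if \<sigma> = 1 then displacement p g - \<kappa> - 2 * K\<^sub>0 else - displacement p g - \<kappa>)"
  have fm: "f \<in> borel_measurable \<mu>"
    using measurable_comp_left[OF borel_measurable_\<psi> g] unfolding f_def[abs_def]
    by (intro borel_measurable_times) (auto simp: measurable_cong_sets[OF sets_\<mu> refl])
  interpret interval_bounded_random_variable \<mu> f a "a + W"
  proof unfold_locales
    show "AE x in \<mu>. f x \<in> {a..a + W}"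
      using \<mu>_bounded AE_space
    proof eventually_elim
      case (elim x)
      then have x: "x \<in> isoms" by simp
      have "displacement p g - \<kappa> \<le> displacement p (g \<circ> x)"
      proof -
        have "dist (g p) p \<le> dist (g p) (g (x p)) + dist (g (x p)) p" by (rule dist_triangle)
        then show ?thesis using elim(1) by (simp add: displacement_def isoms_dist[OF g] dist_commute)
      qed
      then show ?case
        using displacement_comp[OF g, of p x] elim(1) corr_bounds[of "g \<circ> x"] \<sigma>
        by (auto simp: f_def a_def W_def \<psi>_def)
    qed
  qed (rule fm)
  have E: "\<mu>.expectation f = \<sigma> * (\<psi> g + drift - 2 * corr g * (1 / \<theta> - 1))"
    unfolding f_def by (simp add: \<psi>_mean)
  \<comment> \<open>The defect has a definite sign and is harmful only for \<sigma> = -1; the bound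
    allows for it in both cases.\<close>
  have E': "\<mu>.expectation f \<le> \<sigma> * \<psi> g + \<sigma> * drift + 2 * K\<^sub>0 * (1 / \<theta> - 1)"
  proof -
    define X Y where "X = 2 * corr g * (1 / \<theta> - 1)" and "Y = 2 * K\<^sub>0 * (1 / \<theta> - 1)"
    have t: "0 \<le> 1 / \<theta> - 1" using \<theta> by simp
    have "0 \<le> X" "X \<le> Y"
      using corr_bounds[of g] t unfolding X_def Y_def by (auto intro!: mult_right_mono)
    then show ?thesis unfolding E X_def[symmetric] Y_def[symmetric] using \<sigma> by auto
  qed
  have "(\<integral>\<^sup>+x. ennreal (exp (l * f x)) \<partial>\<mu>)
      = (\<integral>\<^sup>+x. ennreal (exp (l * \<mu>.expectation f)) * ennreal (exp (l * (f x - \<mu>.expectation f))) \<partial>\<mu>)"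
    by (intro nn_integral_cong) (simp add: algebra_simps flip: ennreal_mult exp_add)
  also have "\<dots> = ennreal (exp (l * \<mu>.expectation f)) * (\<integral>\<^sup>+x. ennreal (exp (l * (f x - \<mu>.expectation f))) \<partial>\<mu>)"
    using fm by (intro nn_integral_cmult) measurable
  also have "\<dots> \<le> ennreal (exp (l * \<mu>.expectation f)) * ennreal (exp (l\<^sup>2 * (a + W - a)\<^sup>2 / 8))"
    using Hoeffdings_lemma_nn_integral[OF l] by (intro mult_left_mono) auto
  also have "\<dots> = ennreal (exp (l * \<mu>.expectation f + l\<^sup>2 * W\<^sup>2 / 8))"
    by (simp add: exp_add ennreal_mult)
  also have "\<dots> \<le> ennreal (exp (l * (\<sigma> * \<psi> g + \<sigma> * drift + 2 * K\<^sub>0 * (1 / \<theta> - 1)) + l\<^sup>2 * W\<^sup>2 / 8))"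
    using E' l by (intro ennreal_leI) simp
  also have "\<dots> = ennreal (exp (l * (\<sigma> * drift + 2 * K\<^sub>0 * (1 / \<theta> - 1)) + l\<^sup>2 * W\<^sup>2 / 8)) * ennreal (exp (l * (\<sigma> * \<psi> g)))"
    by (simp add: algebra_simps flip: ennreal_mult exp_add)
  finally show ?thesis by (simp add: f_def)
qed

end

end

subsection \<open>Deviations of the walk\<close>

text \<open>Exhibits the position after n steps as a measurable function of the first n coordinates,
  hence as independent of the next step.\<close>

lemma measurable_walk_coordinates:
  fixes w :: "nat \<Rightarrow> 'a::metric_space"
  assumes "separable_metric w" "k \<le> n"
  shows "walk (\<lambda>i y. y i) k \<in> measurable (PiM {1..n} (\<lambda>_. isom_borel)) (isom_borel :: ('a \<Rightarrow> 'a) measure)"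
  using assms(2)
proof (induction k)
  interpret separable_metric w by fact
  {
    case 0
    have "walk (\<lambda>i y. y i) 0 = (\<lambda>_ :: nat \<Rightarrow> 'a \<Rightarrow> 'a. id)" by (rule ext) (rule walk.simps(1))
    then show ?case by (simp only:) (rule measurable_const, simp only: space_isom_borel isoms_id)
  next
    case (Suc k)
    have "(\<lambda>y. y (Suc k)) \<in> measurable (PiM {1..n} (\<lambda>_. isom_borel)) (isom_borel :: ('a \<Rightarrow> 'a) measure)"
      using Suc.prems by (intro measurable_component_singleton) auto
    then have "(\<lambda>y. walk (\<lambda>i y. y i) k y \<circ> y (Suc k))
        \<in> measurable (PiM {1..n} (\<lambda>_. isom_borel)) (isom_borel :: ('a \<Rightarrow> 'a) measure)"
      using Suc.prems by (intro measurable_comp_isom Suc.IH) simp_all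
    moreover have "walk (\<lambda>i y. y i) (Suc k) = (\<lambda>y :: nat \<Rightarrow> 'a \<Rightarrow> 'a. walk (\<lambda>i y. y i) k y \<circ> y (Suc k))"
      by (rule ext) (rule walk.simps(2))
    ultimately show ?case by (simp only:)
  }
qed

locale iid_walk = separable_metric w for w :: "nat \<Rightarrow> 'a::metric_space" +
  fixes P :: "'w measure" and X :: "nat \<Rightarrow> 'w \<Rightarrow> 'a \<Rightarrow> 'a" and \<mu> :: "('a \<Rightarrow> 'a) measure"
  assumes iid: "iid_isoms P X \<mu>" and isom_prob_\<mu>: "isom_prob \<mu>"
begin

sublocale P: prob_space P using iid by (simp add: iid_isoms_def)

lemma measurable_X: "1 \<le> i \<Longrightarrow> X i \<in> measurable P isom_borel"
  using iid unfolding iid_isoms_def P.indep_vars_def by auto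

lemma measurable_walk [measurable]: "walk X n \<in> measurable P isom_borel"
proof (induction n)
  case 0
  have "walk X 0 = (\<lambda>_. id)" by (rule ext) (rule walk.simps(1))
  then show ?case by (simp only:) (rule measurable_const, simp only: space_isom_borel isoms_id)
next
  case (Suc n)
  have "walk X (Suc n) = (\<lambda>\<omega>. walk X n \<omega> \<circ> X (Suc n) \<omega>)" by (rule ext) (rule walk.simps(2))
  moreover have "(\<lambda>\<omega>. walk X n \<omega> \<circ> X (Suc n) \<omega>) \<in> measurable P isom_borel"
    by (rule measurable_comp_isom[OF Suc measurable_X]) simp
  ultimately show ?case by (simp only:)
qed

lemma walk_restrict:
  "k \<le> n \<Longrightarrow> walk (\<lambda>i y. y i) k (restrict (\<lambda>i. X i \<omega>) {1..n}) = walk X k \<omega>"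
  by (induction k) auto

lemma nn_integral_walk_Suc:
  assumes f: "f \<in> borel_measurable isom_borel"
  shows "(\<integral>\<^sup>+\<omega>. f (walk X (Suc n) \<omega>) \<partial>P) = (\<integral>\<^sup>+\<omega>. \<integral>\<^sup>+x. f (walk X n \<omega> \<circ> x) \<partial>\<mu> \<partial>P)"
proof -
  have iv: "P.indep_vars (\<lambda>_. isom_borel) X {1..}" and dX: "distr P isom_borel (X (Suc n)) = \<mu>"
    using iid by (auto simp: iid_isoms_def)
  have "P.indep_var (PiM {1..n} (\<lambda>_. isom_borel)) (\<lambda>\<omega>. restrict (\<lambda>i. X i \<omega>) {1..n})
      (PiM {Suc n} (\<lambda>_. isom_borel)) (\<lambda>\<omega>. restrict (\<lambda>i. X i \<omega>) {Suc n})"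
    by (rule P.indep_var_restrict[OF iv]) auto
  note ic = P.indep_var_compose[OF this
      measurable_walk_coordinates[OF separable_metric_axioms order_refl]
      measurable_component_singleton[of "Suc n" "{Suc n}" "\<lambda>_. isom_borel"]]
  have c: "walk (\<lambda>i y. y i) n \<circ> (\<lambda>\<omega>. restrict (\<lambda>i. X i \<omega>) {1..n}) = walk X n"
      "(\<lambda>y. y (Suc n)) \<circ> (\<lambda>\<omega>. restrict (\<lambda>i. X i \<omega>) {Suc n}) = X (Suc n)"
    by (rule ext, simp only: comp_apply walk_restrict order_refl) (rule ext, simp)
  have "P.indep_var isom_borel (walk X n) isom_borel (X (Suc n))"
    using ic unfolding c by simp
  then have eq: "distr P isom_borel (walk X n) \<Otimes>\<^sub>M \<mu>
      = distr P (isom_borel \<Otimes>\<^sub>M isom_borel) (\<lambda>\<omega>. (walk X n \<omega>, X (Suc n) \<omega>))"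
    by (simp add: P.indep_var_distribution_eq dX)
  interpret \<mu>: prob_space \<mu> by (rule isom_prob_simps(1)[OF isom_prob_\<mu>])
  let ?f = "\<lambda>(g, x). f (g \<circ> x)"
  have m1: "?f \<in> borel_measurable (isom_borel \<Otimes>\<^sub>M isom_borel)"
    using measurable_compose[OF measurable_conv_comp[OF refl refl] f] by (simp add: split_beta')
  have m2: "?f \<in> borel_measurable (distr P isom_borel (walk X n) \<Otimes>\<^sub>M \<mu>)"
    using measurable_compose[OF measurable_conv_comp[OF _ isom_prob_simps(2)[OF isom_prob_\<mu>]] f,
      of "distr P isom_borel (walk X n)"] by (simp add: split_beta')
  have "(\<integral>\<^sup>+\<omega>. f (walk X (Suc n) \<omega>) \<partial>P) = (\<integral>\<^sup>+\<omega>. ?f (walk X n \<omega>, X (Suc n) \<omega>) \<partial>P)" by simp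
  also have "\<dots> = (\<integral>\<^sup>+z. ?f z \<partial>distr P (isom_borel \<Otimes>\<^sub>M isom_borel) (\<lambda>\<omega>. (walk X n \<omega>, X (Suc n) \<omega>)))"
    using measurable_X[of "Suc n"] m1 by (intro nn_integral_distr[symmetric] measurable_Pair measurable_walk) simp_all
  also have "\<dots> = (\<integral>\<^sup>+z. ?f z \<partial>(distr P isom_borel (walk X n) \<Otimes>\<^sub>M \<mu>))" by (simp only: eq)
  also have "\<dots> = (\<integral>\<^sup>+g. \<integral>\<^sup>+x. f (g \<circ> x) \<partial>\<mu> \<partial>distr P isom_borel (walk X n))"
    using \<mu>.nn_integral_fst[OF m2] by simp
  also have "\<dots> = (\<integral>\<^sup>+\<omega>. \<integral>\<^sup>+x. f (walk X n \<omega> \<circ> x) \<partial>\<mu> \<partial>P)"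
    using borel_measurable_nn_integral_comp[OF isom_prob_\<mu> f]
    by (intro nn_integral_distr measurable_walk) simp
  finally show ?thesis .
qed

end

locale hyp_walk_iid = hyp_walk_mean w m p \<delta> \<kappa> r \<rho> \<mu> \<theta> + iid_walk w P X \<mu>
  for w :: "nat \<Rightarrow> 'a::metric_space" and m :: "('a \<Rightarrow> 'a) measure" and p :: 'a
    and \<delta> \<kappa> r \<rho> :: real and \<mu> :: "('a \<Rightarrow> 'a) measure" and \<theta> :: real
    and P :: "'w measure" and X :: "nat \<Rightarrow> 'w \<Rightarrow> 'a \<Rightarrow> 'a"
begin

definition err :: real where "err = 2 * K\<^sub>0 * (1 / \<theta> - 1)"

lemma err_nonneg: "0 \<le> err"
  using K\<^sub>0_nonneg \<theta> by (simp add: err_def)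

lemma \<psi>_id: "\<psi> id = 0"
proof -
  have "inv id p = p" by (metis id_apply isoms_id isoms_inv_apply(1))
  then have "gromov_product p (inv id p) (h p) = 0" for h :: "'a \<Rightarrow> 'a"
    by (simp add: gromov_product_def dist_commute)
  then have "corr id = 0" unfolding corr_def by simp
  then show ?thesis by (simp add: \<psi>_def)
qed

lemma walk_mgf:
  assumes l: "0 < l" and \<sigma>: "\<sigma> = 1 \<or> \<sigma> = -1"
  shows "(\<integral>\<^sup>+\<omega>. ennreal (exp (l * (\<sigma> * \<psi> (walk X n \<omega>)))) \<partial>P)
    \<le> ennreal (exp (real n * (l * (\<sigma> * drift + err) + l\<^sup>2 * W\<^sup>2 / 8)))"
proof (induction n)
  case 0
  have "(\<integral>\<^sup>+\<omega>. ennreal (exp (l * (\<sigma> * \<psi> (walk X 0 \<omega>)))) \<partial>P) = (\<integral>\<^sup>+\<omega>. 1 \<partial>P)"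
    by (simp only: walk.simps \<psi>_id mult_zero_right exp_zero ennreal_1)
  then show ?case
    by (simp only: of_nat_0 mult_zero_left exp_zero ennreal_1 nn_integral_const P.emeasure_space_1 mult_1_left order_refl)
next
  case (Suc n)
  define c where "c = l * (\<sigma> * drift + err) + l\<^sup>2 * W\<^sup>2 / 8"
  define f where "f g = ennreal (exp (l * (\<sigma> * \<psi> g)))" for g
  have fm: "f \<in> borel_measurable isom_borel"
    using borel_measurable_\<psi> unfolding f_def[abs_def] by measurable
  have "(\<integral>\<^sup>+\<omega>. f (walk X (Suc n) \<omega>) \<partial>P) = (\<integral>\<^sup>+\<omega>. \<integral>\<^sup>+x. f (walk X n \<omega> \<circ> x) \<partial>\<mu> \<partial>P)"
    by (rule nn_integral_walk_Suc[OF fm])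
  also have "\<dots> \<le> (\<integral>\<^sup>+\<omega>. ennreal (exp c) * f (walk X n \<omega>) \<partial>P)"
    unfolding f_def c_def err_def
    by (intro nn_integral_mono \<psi>_exp_step[OF _ l \<sigma>] measurable_space_isom[OF measurable_walk])
  also have "\<dots> = ennreal (exp c) * (\<integral>\<^sup>+\<omega>. f (walk X n \<omega>) \<partial>P)"
    using measurable_compose[OF measurable_walk fm] by (rule nn_integral_cmult)
  also have "\<dots> \<le> ennreal (exp c) * ennreal (exp (real n * c))"
    using Suc unfolding f_def c_def by (intro mult_left_mono) auto
  also have "\<dots> = ennreal (exp (real (Suc n) * c))"
    by (simp add: algebra_simps flip: ennreal_mult exp_add)
  finally show ?case by (simp only: f_def c_def)
qed

lemma chernoff:
  assumes l: "0 < l" and \<sigma>: "\<sigma> = 1 \<or> \<sigma> = -1"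
  shows "measure P {\<omega> \<in> space P. real n * (\<sigma> * drift + u) \<le> \<sigma> * displacement p (walk X n \<omega>)}
    \<le> exp (2 * l * K\<^sub>0 + real n * (l * (err - u) + l\<^sup>2 * W\<^sup>2 / 8))"
proof -
  let ?A = "{\<omega> \<in> space P. real n * (\<sigma> * drift + u) \<le> \<sigma> * displacement p (walk X n \<omega>)}"
  have [measurable]: "(\<lambda>\<omega>. displacement p (walk X n \<omega>)) \<in> borel_measurable P"
    by (rule measurable_compose[OF measurable_walk borel_measurable_displacement])
  have A: "?A \<in> sets P" by measurable
  have m: "(\<lambda>\<omega>. ennreal (exp (l * (\<sigma> * \<psi> (walk X n \<omega>))))) \<in> borel_measurable P"
    using measurable_compose[OF measurable_walk borel_measurable_\<psi>] by measurable
  define C where "C = exp (2 * l * K\<^sub>0 - l * (real n * (\<sigma> * drift + u)))"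
  have "ennreal (measure P ?A) = (\<integral>\<^sup>+\<omega>. indicator ?A \<omega> \<partial>P)"
    using A by (simp add: P.emeasure_eq_measure)
  also have "\<dots> \<le> (\<integral>\<^sup>+\<omega>. ennreal C * ennreal (exp (l * (\<sigma> * \<psi> (walk X n \<omega>)))) \<partial>P)"
  proof (intro nn_integral_mono)
    fix \<omega>
    show "indicator ?A \<omega> \<le> ennreal C * ennreal (exp (l * (\<sigma> * \<psi> (walk X n \<omega>))))"
    proof (cases "\<omega> \<in> ?A")
      case True
      then have "real n * (\<sigma> * drift + u) \<le> \<sigma> * displacement p (walk X n \<omega>)" by simp
      \<comment> \<open>Passing from the displacement to \<open>\<psi>\<close> costs at most
        \<open>2 * K\<^sub>0\<close>, which does not grow with \<open>n\<close>; for \<sigma> = -1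
        it costs nothing, as \<open>corr\<close> is nonnegative.\<close>
      also have "\<dots> \<le> \<sigma> * \<psi> (walk X n \<omega>) + 2 * K\<^sub>0"
        using corr_bounds[of "walk X n \<omega>"] K\<^sub>0_nonneg \<sigma> by (auto simp: \<psi>_def)
      finally have "l * (real n * (\<sigma> * drift + u)) \<le> l * (\<sigma> * \<psi> (walk X n \<omega>) + 2 * K\<^sub>0)"
        using l by (intro mult_left_mono) auto
      then have "0 \<le> 2 * l * K\<^sub>0 - l * (real n * (\<sigma> * drift + u)) + l * (\<sigma> * \<psi> (walk X n \<omega>))"
        by (simp add: algebra_simps)
      then have "1 \<le> C * exp (l * (\<sigma> * \<psi> (walk X n \<omega>)))"
        unfolding C_def by (simp only: exp_add[symmetric] one_le_exp_iff)
      then show ?thesis using True by (simp add: C_def flip: ennreal_mult)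
    qed simp
  qed
  also have "\<dots> = ennreal C * (\<integral>\<^sup>+\<omega>. ennreal (exp (l * (\<sigma> * \<psi> (walk X n \<omega>)))) \<partial>P)"
    by (rule nn_integral_cmult[OF m])
  also have "\<dots> \<le> ennreal C * ennreal (exp (real n * (l * (\<sigma> * drift + err) + l\<^sup>2 * W\<^sup>2 / 8)))"
    by (intro mult_left_mono walk_mgf[OF l \<sigma>]) simp
  also have "\<dots> = ennreal (exp (2 * l * K\<^sub>0 + real n * (l * (err - u) + l\<^sup>2 * W\<^sup>2 / 8)))"
    unfolding C_def by (simp add: algebra_simps flip: ennreal_mult exp_add)
  finally show ?thesis by simp
qed

lemma chernoff_opt:
  assumes u: "err < u" and \<sigma>: "\<sigma> = 1 \<or> \<sigma> = -1"
  shows "measure P {\<omega> \<in> space P. real n * (\<sigma> * drift + u) \<le> \<sigma> * displacement p (walk X n \<omega>)}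
    \<le> exp (8 * (u - err) / W\<^sup>2 * K\<^sub>0) * exp (- (2 * (u - err)\<^sup>2 / W\<^sup>2)) ^ n"
proof -
  \<comment> \<open>The minimiser of the quadratic
    \<open>l * (err - u) + l\<^sup>2 * W\<^sup>2 / 8\<close>.\<close>
  define l where "l = 4 * (u - err) / W\<^sup>2"
  have l: "0 < l" using u W_pos by (simp add: l_def)
  have eq: "l * (err - u) + l\<^sup>2 * W\<^sup>2 / 8 = - (2 * (u - err)\<^sup>2 / W\<^sup>2)"
    using W_pos by (simp add: l_def field_simps power2_eq_square)
  have "2 * l * K\<^sub>0 = 8 * (u - err) / W\<^sup>2 * K\<^sub>0" by (simp add: l_def)
  then show ?thesis
    using chernoff[OF l \<sigma>, of n u] by (simp only: eq exp_add exp_of_nat_mult)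
qed

text \<open>The exponential bounds are summable, so Borel-Cantelli places the almost sure limit on
  the correct side, up to \<open>err\<close> and any positive margin. Here \<open>drift\<close>
  depends on \<open>\<theta>\<close>, while \<open>ell\<close> does not.\<close>

lemma drift_close:
  assumes lim: "AE \<omega> in P. (\<lambda>n. displacement p (walk X n \<omega>) / real n) \<longlonglongrightarrow> ell"
    and \<sigma>: "\<sigma> = 1 \<or> \<sigma> = -1"
  shows "\<sigma> * ell \<le> \<sigma> * drift + err"
proof (rule field_le_epsilon)
  fix e :: real assume e: "0 < e"
  define u where "u = err + e"
  define A where "A n = {\<omega> \<in> space P. real n * (\<sigma> * drift + u) \<le> \<sigma> * displacement p (walk X n \<omega>)}" for n
  have [measurable]: "(\<lambda>\<omega>. displacement p (walk X n \<omega>)) \<in> borel_measurable P" for n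
    by (rule measurable_compose[OF measurable_walk borel_measurable_displacement])
  have Am: "A n \<in> sets P" for n unfolding A_def by measurable
  define q where "q = exp (- (2 * (u - err)\<^sup>2 / W\<^sup>2))"
  have q: "0 < q" "q < 1" using e W_pos by (auto simp: q_def u_def)
  have "summable (\<lambda>n. measure P (A n))"
  proof (rule summable_comparison_test')
    show "summable (\<lambda>n. exp (8 * (u - err) / W\<^sup>2 * K\<^sub>0) * q ^ n)"
      using q by (intro summable_mult summable_geometric) simp
    show "norm (measure P (A n)) \<le> exp (8 * (u - err) / W\<^sup>2 * K\<^sub>0) * q ^ n" for n
      using chernoff_opt[OF _ \<sigma>, of u n] e by (simp add: A_def q_def u_def)
  qed
  then have "AE \<omega> in P. eventually (\<lambda>n. \<omega> \<in> space P - A n) sequentially"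
    by (intro borel_cantelli_AE1 Am) (auto simp: P.emeasure_eq_measure)
  with lim have "AE \<omega> in P. \<sigma> * ell \<le> \<sigma> * drift + u"
  proof eventually_elim
    case (elim \<omega>)
    have "(\<lambda>n. \<sigma> * (displacement p (walk X n \<omega>) / real n)) \<longlonglongrightarrow> \<sigma> * ell"
      by (intro tendsto_mult_left elim(1))
    moreover have "eventually (\<lambda>n. \<sigma> * (displacement p (walk X n \<omega>) / real n) \<le> \<sigma> * drift + u) sequentially"
      using elim(2) eventually_gt_at_top[of 0]
    proof eventually_elim
      case (elim n)
      then have "\<sigma> * displacement p (walk X n \<omega>) < real n * (\<sigma> * drift + u)" by (auto simp: A_def)
      then show ?case using elim(2) by (simp add: field_simps)
    qed
    ultimately show ?case by (rule tendsto_upperbound) simp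
  qed
  then show "\<sigma> * ell \<le> \<sigma> * drift + err + e"
    by (simp add: u_def add.assoc P.emeasure_space_1)
qed

text \<open>One \<open>err\<close> comes from the defect of the martingale, the other from
  recentring at \<open>ell\<close> instead of \<open>drift\<close>.\<close>

lemma deviation:
  assumes lim: "AE \<omega> in P. (\<lambda>n. displacement p (walk X n \<omega>) / real n) \<longlonglongrightarrow> ell"
    and \<sigma>: "\<sigma> = 1 \<or> \<sigma> = -1" and u: "2 * err < u"
  shows "\<exists>C > 0. \<forall>n > 0. measure P {\<omega> \<in> space P. u \<le> \<sigma> * (displacement p (walk X n \<omega>) / real n - ell)}
    \<le> C * exp (- (2 * (u - 2 * err)\<^sup>2 / W\<^sup>2)) ^ n"
proof -
  have u': "err < u - err" using u by simp
  have [measurable]: "(\<lambda>\<omega>. displacement p (walk X n \<omega>)) \<in> borel_measurable P" for n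
    by (rule measurable_compose[OF measurable_walk borel_measurable_displacement])
  have d: "\<sigma> * drift \<le> \<sigma> * ell + err"
    using drift_close[OF lim, of "- \<sigma>"] \<sigma> by auto
  have "measure P {\<omega> \<in> space P. u \<le> \<sigma> * (displacement p (walk X n \<omega>) / real n - ell)}
      \<le> exp (8 * (u - err - err) / W\<^sup>2 * K\<^sub>0) * exp (- (2 * (u - err - err)\<^sup>2 / W\<^sup>2)) ^ n" if n: "0 < n" for n
  proof -
    have "{\<omega> \<in> space P. u \<le> \<sigma> * (displacement p (walk X n \<omega>) / real n - ell)}
        \<subseteq> {\<omega> \<in> space P. real n * (\<sigma> * drift + (u - err)) \<le> \<sigma> * displacement p (walk X n \<omega>)}"
    proof safe
      fix \<omega> assume "u \<le> \<sigma> * (displacement p (walk X n \<omega>) / real n - ell)"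
      then have "\<sigma> * drift + (u - err) \<le> \<sigma> * displacement p (walk X n \<omega>) / real n"
        using d by (simp add: algebra_simps)
      then show "real n * (\<sigma> * drift + (u - err)) \<le> \<sigma> * displacement p (walk X n \<omega>)"
        using n by (simp add: field_simps)
    qed
    then have "measure P {\<omega> \<in> space P. u \<le> \<sigma> * (displacement p (walk X n \<omega>) / real n - ell)}
        \<le> measure P {\<omega> \<in> space P. real n * (\<sigma> * drift + (u - err)) \<le> \<sigma> * displacement p (walk X n \<omega>)}"
      by (intro P.finite_measure_mono) measurable
    also note chernoff_opt[OF u' \<sigma>, of n]
    finally show ?thesis .
  qed
  then show ?thesis by (intro exI[of _ "exp (8 * (u - err - err) / W\<^sup>2 * K\<^sub>0)"]) (simp add: algebra_simps)
qed

end

subsection \<open>The rate function\<close>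

lemma ereal_ln_rate_bound:
  assumes P: "\<And>n. 0 < n \<Longrightarrow> P n \<le> C * exp (- c) ^ n" and C: "0 < C"
  shows "liminf (\<lambda>n. ereal (1 / real n) * ereal_ln (P n)) \<le> ereal (- c)"
proof -
  \<comment> \<open>At \<open>n = 0\<close> the division gives \<open>1 / 0 = 0\<close>, so this
    index is left out; a vanishing probability has logarithm -\<infinity>, which only helps.\<close>
  have le: "ereal (1 / real n) * ereal_ln (P n) \<le> ereal (ln C / real n - c)" if n: "0 < n" for n
  proof (cases "P n \<le> 0")
    case True
    then show ?thesis using n by (simp add: ereal_ln_def)
  next
    case False
    then have "ln (P n) \<le> ln (C * exp (- c) ^ n)" using P[OF n] by (intro ln_mono) auto
    also have "\<dots> = ln C - real n * c"
      using C by (simp add: ln_mult_pos ln_realpow)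
    finally have "1 / real n * ln (P n) \<le> 1 / real n * (ln C - real n * c)"
      by (intro mult_left_mono) auto
    also have "\<dots> = ln C / real n - c" using n by (simp add: field_simps)
    finally show ?thesis using False by (simp add: ereal_ln_def)
  qed
  have "liminf (\<lambda>n. ereal (1 / real n) * ereal_ln (P n)) \<le> liminf (\<lambda>n. ereal (ln C / real n - c))"
    using le by (intro Liminf_mono eventually_sequentiallyI[of 1]) auto
  also have "\<dots> = ereal (- c)"
  proof (intro lim_imp_Liminf)
    have "(\<lambda>n. ln C / real n - c) \<longlonglongrightarrow> 0 - c"
      by (intro tendsto_diff tendsto_const lim_const_over_n)
    then show "(\<lambda>n. ereal (ln C / real n - c)) \<longlonglongrightarrow> ereal (- c)" by simp
  qed simp
  finally show ?thesis .
qed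

text \<open>The LDP bounds the probability of an open set from below by the rate at any of its
  points, so exponential decay on a neighbourhood of \<open>t\<close> forces the rate at
  \<open>t\<close> to be large.\<close>

lemma LDP_lower_bound:
  assumes LDP: "satisfies_LDP P Z I" and J: "open J" "t \<in> J" "0 \<le> t"
    and P: "\<And>n. 0 < n \<Longrightarrow> measure P {\<omega> \<in> space P. Z n \<omega> \<in> J} \<le> C * exp (- c) ^ n" and C: "0 < C"
  shows "ereal c \<le> I t"
proof -
  have "- (INF \<alpha>\<in>interior J \<inter> {0..}. I \<alpha>)
      \<le> liminf (\<lambda>n. ereal (1 / real n) * ereal_ln (measure P {\<omega> \<in> space P. Z n \<omega> \<in> J}))"
    using J(1) by (intro LDP[unfolded satisfies_LDP_def, THEN bspec, THEN conjunct1]) simp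
  also have "\<dots> \<le> ereal (- c)" by (rule ereal_ln_rate_bound[OF P C])
  also have "ereal (- c) = - ereal c" by simp
  finally have "ereal c \<le> (INF \<alpha>\<in>interior J \<inter> {0..}. I \<alpha>)"
    by (simp only: ereal_minus_le_minus)
  also have "\<dots> \<le> I t" using J by (intro INF_lower) (auto simp: interior_open)
  finally show ?thesis .
qed

context hyp_walk
begin

lemma rate_bound:
  assumes iid: "iid_isoms P X \<mu>"
    and lim: "AE \<omega> in P. (\<lambda>n. displacement p (walk X n \<omega>) / real n) \<longlonglongrightarrow> ell"
    and LDP: "satisfies_LDP P (\<lambda>n \<omega>. displacement p (walk X n \<omega>) / real n) I"
    and t: "0 \<le> t" "t \<noteq> ell"
  shows "ereal (2 * (t - ell)\<^sup>2 / W\<^sup>2) \<le> I t"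
proof -
  define \<sigma> :: real where "\<sigma> = (if ell < t then 1 else -1)"
  define d where "d = \<bar>t - ell\<bar>"
  have \<sigma>: "\<sigma> = 1 \<or> \<sigma> = -1" and d: "0 < d" "\<sigma> * (t - ell) = d" using t by (auto simp: \<sigma>_def d_def)
  have step: "ereal (2 * (d - 2 * e)\<^sup>2 / W\<^sup>2) \<le> I t" if e: "0 < e" "2 * e < d" for e
  proof -
    \<comment> \<open>Chosen so that \<open>1 / \<theta> - 1 = e / (4 * W)\<close>; since
      \<open>2 * K\<^sub>0\<close> is at most \<open>W\<close>, this keeps \<open>err\<close> at or
      below \<open>e / 4\<close>.\<close>
    define \<theta> where "\<theta> = 4 * W / (4 * W + e)"
    have \<theta>: "0 < \<theta>" "\<theta> < 1" using e W_pos by (auto simp: \<theta>_def field_simps)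
    interpret hyp_walk_iid w m p \<delta> \<kappa> r \<rho> \<mu> \<theta> P X
      by unfold_locales (fact \<theta> iid \<mu>)+
    have "1 / \<theta> - 1 = e / (4 * W)" using W_pos by (simp add: \<theta>_def field_simps)
    moreover have "2 * K\<^sub>0 \<le> W" using \<kappa>_pos by (simp add: W_def)
    ultimately have "err \<le> W * (e / (4 * W))"
      unfolding err_def using e W_pos by (intro mult_mono) auto
    also have "\<dots> = e / 4" using W_pos by simp
    finally have err: "2 * err \<le> e" "2 * err < d - e" using e err_nonneg by linarith+
    from deviation[OF lim \<sigma> err(2)] obtain C where C: "C > 0"
      "\<And>n. n > 0 \<Longrightarrow> measure P {\<omega> \<in> space P. d - e \<le> \<sigma> * (displacement p (walk X n \<omega>) / real n - ell)}
        \<le> C * exp (- (2 * (d - e - 2 * err)\<^sup>2 / W\<^sup>2)) ^ n" by blast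
    have "ereal (2 * (d - 2 * e)\<^sup>2 / W\<^sup>2) \<le> ereal (2 * (d - e - 2 * err)\<^sup>2 / W\<^sup>2)"
      using err e by (simp add: divide_right_mono power_mono)
    also have "\<dots> \<le> I t"
    proof (rule LDP_lower_bound[OF LDP _ _ t(1) _ C(1), of "{t - e<..<t + e}"])
      fix n :: nat assume n: "0 < n"
      have m: "(\<lambda>\<omega>. displacement p (walk X n \<omega>)) \<in> borel_measurable P"
        by (rule measurable_compose[OF measurable_walk borel_measurable_displacement])
      have "measure P {\<omega> \<in> space P. displacement p (walk X n \<omega>) / real n \<in> {t - e<..<t + e}}
          \<le> measure P {\<omega> \<in> space P. d - e \<le> \<sigma> * (displacement p (walk X n \<omega>) / real n - ell)}"
      proof (rule P.finite_measure_mono)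
        show "{\<omega> \<in> space P. displacement p (walk X n \<omega>) / real n \<in> {t - e<..<t + e}}
            \<subseteq> {\<omega> \<in> space P. d - e \<le> \<sigma> * (displacement p (walk X n \<omega>) / real n - ell)}"
          using d(2) \<sigma> by auto
        show "{\<omega> \<in> space P. d - e \<le> \<sigma> * (displacement p (walk X n \<omega>) / real n - ell)} \<in> P.events"
          using m by measurable
      qed
      also note C(2)[OF n]
      finally show "measure P {\<omega> \<in> space P. displacement p (walk X n \<omega>) / real n \<in> {t - e<..<t + e}}
          \<le> C * exp (- (2 * (d - e - 2 * err)\<^sup>2 / W\<^sup>2)) ^ n" .
    qed (use e in auto)
    finally show ?thesis .
  qed
  \<comment> \<open>The width of the interval around \<open>t\<close> and the defect of
    \<open>\<theta>\<close> vanish together with \<open>e\<close>.\<close>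
  have "((\<lambda>e. 2 * (d - 2 * e)\<^sup>2 / W\<^sup>2) \<longlongrightarrow> 2 * (d - 2 * 0)\<^sup>2 / W\<^sup>2) (at_right 0)"
    using W_pos by (intro tendsto_intros) auto
  then have "((\<lambda>e. ereal (2 * (d - 2 * e)\<^sup>2 / W\<^sup>2)) \<longlongrightarrow> ereal (2 * (t - ell)\<^sup>2 / W\<^sup>2)) (at_right 0)"
    by (simp add: d_def)
  moreover have "eventually (\<lambda>e. ereal (2 * (d - 2 * e)\<^sup>2 / W\<^sup>2) \<le> I t) (at_right 0)"
    using eventually_at_right_real[of 0 "d / 2"] d(1) by (auto elim!: eventually_mono intro!: step)
  ultimately show ?thesis by (rule tendsto_upperbound) simp
qed

end

theorem corollary1p8:
  fixes p :: "'a::metric_space"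
    and \<delta> :: real
    and m \<mu> :: "('a \<Rightarrow> 'a) measure"
    and P :: "'w measure"
    and X :: "nat \<Rightarrow> 'w \<Rightarrow> 'a \<Rightarrow> 'a"
    and I :: "real \<Rightarrow> ereal"
    and ell r t A\<^sub>0 D\<^sub>0 \<kappa>\<^sub>S :: real
  assumes "proper_space TYPE('a)"
    and "geodesic_space TYPE('a)"
    and "hyperbolic_space TYPE('a) \<delta>"
    and "cocompact_action TYPE('a)"
    and "haar_measure m"
    and "isom_prob \<mu>"
    and "non_elementary p \<mu>"
    and "bounded_isoms p (isom_support \<mu>)"
    and "iid_isoms P X \<mu>"
    and "AE \<omega> in P. (\<lambda>n. displacement p (walk X n \<omega>) / real n) \<longlonglongrightarrow> ell"
    and "proper_convex_rate_function I"
    and "satisfies_LDP P (\<lambda>n \<omega>. displacement p (walk X n \<omega>) / real n) I"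
    and "0 \<le> t"
    and "0 \<le> r" and "r < 1"
  defines "D\<^sub>0 \<equiv> 2 * quotient_diam TYPE('a)"
    and "A\<^sub>0 \<equiv> volume_ratio m p (hyp_radius \<delta>) D\<^sub>0"
    and "\<kappa>\<^sub>S \<equiv> max_displacement p (isom_support \<mu>)"
  shows "I t \<ge> ereal ((t - ell)\<^sup>2) /
    (ereal (\<kappa>\<^sub>S\<^sup>2) * deviation_const A\<^sub>0 \<kappa>\<^sub>S (regular_norm m (lazy r \<mu>)))"
proof -
  have It: "0 \<le> I t" using assms(11,13) by (simp add: proper_convex_rate_function_def)
  have \<kappa>: "0 < \<kappa>\<^sub>S" unfolding \<kappa>\<^sub>S_def by (rule max_displacement_pos[OF assms(7,8)])
  consider "t = ell" | "\<not> regular_norm m (lazy r \<mu>) < 1" | "t \<noteq> ell" "regular_norm m (lazy r \<mu>) < 1"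
    by blast
  then show ?thesis
  proof cases
    case 1
    \<comment> \<open>The numerator is 0, and in \<open>ereal\<close> the quotient is then 0
      whatever the denominator.\<close>
    then show ?thesis using It by (simp add: divide_ereal_def flip: zero_ereal_def)
  next
    case 2
    then have "ereal (\<kappa>\<^sub>S\<^sup>2) * deviation_const A\<^sub>0 \<kappa>\<^sub>S (regular_norm m (lazy r \<mu>)) = \<infinity>"
      using \<kappa> by (simp add: deviation_const_def)
    then show ?thesis using It by simp
  next
    case 3
    obtain w :: "nat \<Rightarrow> 'a" where w: "separable_metric w"
      using proper_space_separable[OF assms(1)] by blast
    interpret separable_metric w by (rule w)
    define \<rho> where "\<rho> = hyp_radius \<delta> + D\<^sub>0"
    have bdd: "AE g in \<mu>. displacement p g \<le> \<kappa>\<^sub>S"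
      using AE_support[OF assms(6)]
    proof eventually_elim
      case (elim g)
      then show ?case
        unfolding \<kappa>\<^sub>S_def max_displacement_def using assms(8)
        by (intro cSUP_upper) (auto simp: bounded_isoms_def)
    qed
    interpret H: hyp_walk w m p \<delta> \<kappa>\<^sub>S r \<rho> \<mu>
      by unfold_locales (use assms(1-6,14,15) \<kappa> bdd 3 in \<open>simp_all add: \<rho>_def D\<^sub>0_def\<close>)
    have A: "H.A\<^sub>0 = A\<^sub>0"
    proof -
      have "2 * \<rho> = 2 * hyp_radius \<delta> + 2 * D\<^sub>0" by (simp add: \<rho>_def)
      then show ?thesis
        unfolding H.A\<^sub>0_def A\<^sub>0_def volume_ratio_def H.V_def by (simp add: \<rho>_def powr_half_sqrt)
    qed
    define D where "D = 32 * (16 * ln_plus \<kappa>\<^sub>S + 8 * A\<^sub>0 / 3 + 33)\<^sup>2 * (1 / (1 - sqrt (regular_norm m (lazy r \<mu>))) ^ 4)"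
    have D: "deviation_const A\<^sub>0 \<kappa>\<^sub>S (regular_norm m (lazy r \<mu>)) = ereal D"
      using 3 by (simp add: deviation_const_def D_def)
    have wb: "H.W\<^sup>2 \<le> 2 * (\<kappa>\<^sub>S\<^sup>2 * D)"
      using H.W_bound unfolding A H.s_def D_def .
    have pos: "0 < \<kappa>\<^sub>S\<^sup>2 * D"
    proof -
      have "0 < H.W\<^sup>2" using H.W_pos by simp
      with wb show ?thesis by linarith
    qed
    have "(t - ell)\<^sup>2 / (\<kappa>\<^sub>S\<^sup>2 * D) = 2 * (t - ell)\<^sup>2 / (2 * (\<kappa>\<^sub>S\<^sup>2 * D))" by simp
    also have "\<dots> \<le> 2 * (t - ell)\<^sup>2 / H.W\<^sup>2"
      using wb H.W_pos pos by (intro divide_left_mono) (auto intro: mult_pos_pos)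
    finally have "ereal ((t - ell)\<^sup>2 / (\<kappa>\<^sub>S\<^sup>2 * D)) \<le> ereal (2 * (t - ell)\<^sup>2 / H.W\<^sup>2)" by simp
    also have "\<dots> \<le> I t" by (rule H.rate_bound[OF assms(9,10,12,13) 3(1)])
    finally show ?thesis
      unfolding D times_ereal.simps using pos by (subst ereal_divide) auto
  qed
qed

end
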